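(* Let $n\ge1$, let $\mathbb{T}^n=\mathbb{S}^1\times\cdots\times\mathbb{S}^1\subset\mathbb{R}^{2n}$ be the flat $n$-torus, and let $f(x)=e^{g(x)}$, where $g:\mathbb{R}\to\mathbb{R}$ is a smooth function such that: (A) $h(x)=g''(x)+(g'(x))^2\ge0$ for every $x\in\mathbb{R}$; (B) $h$ is a periodic function with period $T>0$; (C) there are positive constants $C_1,C_2$ such that $\frac{C_1}{2}<g'(x)<\frac{C_2}{2}$ for every $x\in\mathbb{R}$. Then the (non-compact) warped product manifold $\mathbb{R}\times_f\mathbb{T}^n$ has non-positive sectional curvature and its geodesic flow is of Anosov type.
   Context: Warped product. For Riemannian manifolds $(M,g_M)$, $(N,g_N)$ and a smooth function $f>0$ on $M$, the warped product $M\times_f N$ is the manifold $M\times N$ with the Riemannian metric $\pi_M^*(g_M)+(f\circ\pi_M)^2\pi_N^*(g_N)$, where $\pi_M,\pi_N$ are the projections. Here $\mathbb{R}$ carries its standard metric and $\mathbb{T}^n$ the flat metric induced from $\mathbb{R}^{2n}$ (each $\mathbb{S}^1$ is the unit circle), so in local angular coordinates the metric is $dx^2+f(x)^2(dy_1^2+\cdots+dy_n^2)$. Geodesic flow. For a complete Riemannian manifold $P$ with unit tangent bundle $SP$, the geodesic flow is $\phi^t(\theta)=(\gamma_\theta(t),\gamma_\theta'(t))$ on $SP$, where $\gamma_\theta$ is the geodesic with initial position and velocity $\theta=(p,v)$; $G$ is its generating vector field. $SP$ carries the Sasaki metric $\langle\xi,\eta\rangle_\theta=\langle d_\theta\pi(\xi),d_\theta\pi(\eta)\rangle+\langle\alpha_\theta(\xi),\alpha_\theta(\eta)\rangle$,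 where $\pi:TP\to P$ is the projection and $\alpha:TTP\to TP$ the connection map of the Levi-Civita connection. Anosov. The geodesic flow $\phi^t:SP\to SP$ is of Anosov type if there is a continuous splitting $T(SP)=E^s\oplus\langle G\rangle\oplus E^u$ and constants $C>0$, $\lambda\in(0,1)$ such that, for all $\theta\in SP$, $d_\theta\phi^t(E^{s}(\theta))=E^{s}(\phi^t(\theta))$ and $d_\theta\phi^t(E^{u}(\theta))=E^{u}(\phi^t(\theta))$ for all $t\in\mathbb{R}$, and $\|d_\theta\phi^t|_{E^s(\theta)}\|\le C\lambda^t$, $\|d_\theta\phi^{-t}|_{E^u(\theta)}\|\le C\lambda^t$ for all $t\ge0$. *)

theory Defs
  imports "HOL-Analysis.Analysis"
begin

text \<open>
  A manifold is given as a subset \<open>M\<close> of a Euclidean space \<open>'a\<close> together with a surjective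
  smooth local diffeomorphism \<open>\<Psi>\<close> from a Euclidean space \<open>'c\<close> onto \<open>M\<close>; the local inverses
  of \<open>\<Psi>\<close> are the charts. A Riemannian metric on \<open>M\<close> is a function \<open>m\<close> such that \<open>m p u v\<close> is
  the inner product at \<open>p\<close> of \<open>u\<close> and \<open>v\<close>; only \<open>p \<in> M\<close> and \<open>u, v\<close> tangent to \<open>M\<close> at \<open>p\<close> matter.
\<close>

type_synonym 'a metric = "'a \<Rightarrow> 'a \<Rightarrow> 'a \<Rightarrow> real"

definition smooth_real :: "(real \<Rightarrow> real) \<Rightarrow> bool" where
  "smooth_real g \<longleftrightarrow> (\<forall>k x. ((deriv ^^ k) g) field_differentiable (at x))"

section \<open>Submanifolds of Euclidean spaces\<close>

definition tangent_space :: "'a::euclidean_space set \<Rightarrow> 'a \<Rightarrow> 'a set" where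
  "tangent_space M p =
     {v. \<exists>c :: real \<Rightarrow> 'a. c 0 = p \<and> (\<forall>t. c t \<in> M) \<and> (c has_vector_derivative v) (at 0)}"

definition unit_tangent_bundle :: "'a::euclidean_space set \<Rightarrow> 'a metric \<Rightarrow> ('a \<times> 'a) set" where
  "unit_tangent_bundle M m = {(p, v). p \<in> M \<and> v \<in> tangent_space M p \<and> m p v v = 1}"

text \<open>
  The differential of \<open>F\<close> along \<open>S\<close>: the library's derivative within \<open>S\<close> is determined on tangent
  vectors of \<open>S\<close> (and only there), so this is only applied to tangent vectors.
\<close>
definition differential_on ::
    "'a::euclidean_space set \<Rightarrow> ('a \<Rightarrow> 'b::euclidean_space) \<Rightarrow> 'a \<Rightarrow> 'a \<Rightarrow> 'b" where
  "differential_on S F p = frechet_derivative F (at p within S)"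

section \<open>Levi-Civita connection and curvature in coordinates\<close>

text \<open>
  Here \<open>m\<close> is a metric on the vector space \<open>'c\<close>. The vector \<open>christoffel m q u v\<close> is
  \<open>\<Gamma>(u, v) = \<Sum> \<Gamma>\<^sup>k\<^sub>i\<^sub>j u\<^sub>i v\<^sub>j e\<^sub>k\<close>, that is \<open>\<nabla>\<^sub>u v\<close> for constant
  fields \<open>u, v\<close>, given by the Koszul formula.
\<close>
definition christoffel :: "'c::euclidean_space metric \<Rightarrow> 'c \<Rightarrow> 'c \<Rightarrow> 'c \<Rightarrow> 'c" where
  "christoffel m q u v =
     (THE z. \<forall>w. m q z w =
        (frechet_derivative (\<lambda>r. m r v w) (at q) u
         + frechet_derivative (\<lambda>r. m r u w) (at q) v
         - frechet_derivative (\<lambda>r. m r u v) (at q) w) / 2)"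

text \<open>\<open>R(u, v) w = \<nabla>\<^sub>u \<nabla>\<^sub>v w - \<nabla>\<^sub>v \<nabla>\<^sub>u w\<close> for constant (hence commuting) \<open>u, v\<close>.\<close>
definition curvature_tensor :: "'c::euclidean_space metric \<Rightarrow> 'c \<Rightarrow> 'c \<Rightarrow> 'c \<Rightarrow> 'c \<Rightarrow> 'c" where
  "curvature_tensor m q u v w =
     frechet_derivative (\<lambda>r. christoffel m r v w) (at q) u
     - frechet_derivative (\<lambda>r. christoffel m r u w) (at q) v
     + christoffel m q u (christoffel m q v w)
     - christoffel m q v (christoffel m q u w)"

definition coord_sectional_curvature :: "'c::euclidean_space metric \<Rightarrow> 'c \<Rightarrow> 'c \<Rightarrow> 'c \<Rightarrow> real" where
  "coord_sectional_curvature m q u v =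
     m q (curvature_tensor m q u v v) u / (m q u u * m q v v - (m q u v)\<^sup>2)"

section \<open>Transfer to the manifold\<close>

definition pullback_metric ::
    "('c::euclidean_space \<Rightarrow> 'a::euclidean_space) \<Rightarrow> 'a metric \<Rightarrow> 'c metric" where
  "pullback_metric \<Psi> m q u v =
     m (\<Psi> q) (frechet_derivative \<Psi> (at q) u) (frechet_derivative \<Psi> (at q) v)"

definition tangent_map ::
    "('c::euclidean_space \<Rightarrow> 'a::euclidean_space) \<Rightarrow> 'c \<times> 'c \<Rightarrow> 'a \<times> 'a" where
  "tangent_map \<Psi> = (\<lambda>(q, w). (\<Psi> q, frechet_derivative \<Psi> (at q) w))"

text \<open>
  Below, a point of \<open>M\<close> (or of \<open>TM\<close>) is expressed in some chart around it; as usual, the results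
  do not depend on the chart. Two charts of the same point for the parametrization used in the
  statement differ by a translation preserving the metric.
\<close>
definition sectional_curvature ::
    "('c::euclidean_space \<Rightarrow> 'a::euclidean_space) \<Rightarrow> 'a metric \<Rightarrow> 'a \<Rightarrow> 'a \<Rightarrow> 'a \<Rightarrow> real" where
  "sectional_curvature \<Psi> m p u v =
     (let q = (SOME q. \<Psi> q = p);
          u' = (THE u'. frechet_derivative \<Psi> (at q) u' = u);
          v' = (THE v'. frechet_derivative \<Psi> (at q) v' = v)
      in coord_sectional_curvature (pullback_metric \<Psi> m) q u' v')"

definition nonpositive_sectional_curvature ::
    "'a::euclidean_space set \<Rightarrow> ('c::euclidean_space \<Rightarrow> 'a) \<Rightarrow> 'a metric \<Rightarrow> bool" where
  "nonpositive_sectional_curvature M \<Psi> m \<longleftrightarrow>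
     (\<forall>p\<in>M. \<forall>u\<in>tangent_space M p. \<forall>v\<in>tangent_space M p.
        u \<noteq> v \<and> independent {u, v} \<longrightarrow> sectional_curvature \<Psi> m p u v \<le> 0)"

text \<open>
  The connection map \<open>\<alpha>\<close> at \<open>\<theta> \<in> TM\<close>: if \<open>\<xi>\<close> is the velocity of a curve \<open>(c, V)\<close> in \<open>TM\<close>, then
  \<open>\<alpha> \<xi>\<close> is the covariant derivative of \<open>V\<close> along \<open>c\<close>, which reads \<open>w' + \<Gamma>(q', w)\<close> in coordinates.
\<close>
definition connection_map ::
    "('c::euclidean_space \<Rightarrow> 'a::euclidean_space) \<Rightarrow> 'a metric \<Rightarrow> 'a \<times> 'a \<Rightarrow> 'a \<times> 'a \<Rightarrow> 'a" where
  "connection_map \<Psi> m \<theta> \<xi> =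
     (let (q, w) = (SOME z. tangent_map \<Psi> z = \<theta>);
          (q', w') = (THE z'. frechet_derivative (tangent_map \<Psi>) (at (q, w)) z' = \<xi>)
      in frechet_derivative \<Psi> (at q) (w' + christoffel (pullback_metric \<Psi> m) q q' w))"

text \<open>The differential of the projection \<open>TM \<rightarrow> M\<close> is \<open>fst\<close>.\<close>
definition sasaki_metric ::
    "('c::euclidean_space \<Rightarrow> 'a::euclidean_space) \<Rightarrow> 'a metric \<Rightarrow> ('a \<times> 'a) metric" where
  "sasaki_metric \<Psi> m \<theta> \<xi> \<eta> =
     m (fst \<theta>) (fst \<xi>) (fst \<eta>)
     + m (fst \<theta>) (connection_map \<Psi> m \<theta> \<xi>) (connection_map \<Psi> m \<theta> \<eta>)"

section \<open>Geodesic flow\<close>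

definition geodesic ::
    "'a::euclidean_space set \<Rightarrow> ('c::euclidean_space \<Rightarrow> 'a) \<Rightarrow> 'a metric \<Rightarrow> (real \<Rightarrow> 'a) \<Rightarrow> bool" where
  "geodesic M \<Psi> m c \<longleftrightarrow>
     (\<exists>c' c''. \<forall>t. c t \<in> M \<and>
        (c has_vector_derivative c' t) (at t) \<and> (c' has_vector_derivative c'' t) (at t) \<and>
        connection_map \<Psi> m (c t, c' t) (c' t, c'' t) = 0)"

definition geodesic_from ::
    "'a::euclidean_space set \<Rightarrow> ('c::euclidean_space \<Rightarrow> 'a) \<Rightarrow> 'a metric \<Rightarrow> 'a \<times> 'a \<Rightarrow>
     (real \<Rightarrow> 'a) \<Rightarrow> bool" where
  "geodesic_from M \<Psi> m \<theta> c \<longleftrightarrow>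
     geodesic M \<Psi> m c \<and> c 0 = fst \<theta> \<and> vector_derivative c (at 0) = snd \<theta>"

definition geodesically_complete ::
    "'a::euclidean_space set \<Rightarrow> ('c::euclidean_space \<Rightarrow> 'a) \<Rightarrow> 'a metric \<Rightarrow> bool" where
  "geodesically_complete M \<Psi> m \<longleftrightarrow>
     (\<forall>\<theta>\<in>unit_tangent_bundle M m. \<exists>!c. geodesic_from M \<Psi> m \<theta> c)"

definition geodesic_flow ::
    "'a::euclidean_space set \<Rightarrow> ('c::euclidean_space \<Rightarrow> 'a) \<Rightarrow> 'a metric \<Rightarrow>
     real \<Rightarrow> 'a \<times> 'a \<Rightarrow> 'a \<times> 'a" where
  "geodesic_flow M \<Psi> m t \<theta> =
     (let c = (THE c. geodesic_from M \<Psi> m \<theta> c) in (c t, vector_derivative c (at t)))"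

section \<open>Anosov flows\<close>

definition continuous_subbundle :: "'b::euclidean_space set \<Rightarrow> ('b \<Rightarrow> 'b set) \<Rightarrow> bool" where
  "continuous_subbundle S E \<longleftrightarrow>
     (\<forall>\<theta>\<in>S. \<exists>U k. \<exists>X :: nat \<Rightarrow> 'b \<Rightarrow> 'b. open U \<and> \<theta> \<in> U \<and>
        (\<forall>i<k. continuous_on (S \<inter> U) (X i)) \<and>
        (\<forall>\<eta>\<in>S \<inter> U. inj_on (\<lambda>i. X i \<eta>) {..<k} \<and> independent ((\<lambda>i. X i \<eta>) ` {..<k}) \<and>
           span ((\<lambda>i. X i \<eta>) ` {..<k}) = E \<eta>))"

definition direct_sum3 :: "'b::real_vector set \<Rightarrow> 'b set \<Rightarrow> 'b set \<Rightarrow> 'b set \<Rightarrow> bool" where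
  "direct_sum3 V A B C \<longleftrightarrow>
     subspace A \<and> subspace B \<and> subspace C \<and> V = {a + b + c | a b c. a \<in> A \<and> b \<in> B \<and> c \<in> C} \<and>
     (\<forall>a\<in>A. \<forall>b\<in>B. \<forall>c\<in>C. a + b + c = 0 \<longrightarrow> a = 0 \<and> b = 0 \<and> c = 0)"

text \<open>\<open>m\<close> is the Riemannian metric on \<open>S\<close> defining the norms, and \<open>\<phi> t\<close> the time-\<open>t\<close> map of the flow.\<close>
definition anosov_flow ::
    "'b::euclidean_space set \<Rightarrow> 'b metric \<Rightarrow> (real \<Rightarrow> 'b \<Rightarrow> 'b) \<Rightarrow> bool" where
  "anosov_flow S m \<phi> \<longleftrightarrow>
     (\<forall>t. \<phi> t differentiable_on S) \<and>
     (\<exists>Es Eu C lam.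
        continuous_subbundle S Es \<and> continuous_subbundle S Eu \<and> C > 0 \<and> 0 < lam \<and> lam < 1 \<and>
        (\<forall>\<theta>\<in>S.
           direct_sum3 (tangent_space S \<theta>)
             (Es \<theta>) (span {vector_derivative (\<lambda>t. \<phi> t \<theta>) (at 0)}) (Eu \<theta>) \<and>
           (\<forall>t. differential_on S (\<phi> t) \<theta> ` Es \<theta> = Es (\<phi> t \<theta>)) \<and>
           (\<forall>t. differential_on S (\<phi> t) \<theta> ` Eu \<theta> = Eu (\<phi> t \<theta>)) \<and>
           (\<forall>t\<ge>0. \<forall>\<xi>\<in>Es \<theta>.
              sqrt (m (\<phi> t \<theta>) (differential_on S (\<phi> t) \<theta> \<xi>) (differential_on S (\<phi> t) \<theta> \<xi>))
              \<le> C * lam powr t * sqrt (m \<theta> \<xi> \<xi>)) \<and>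
           (\<forall>t\<ge>0. \<forall>\<xi>\<in>Eu \<theta>.
              sqrt (m (\<phi> (-t) \<theta>) (differential_on S (\<phi> (-t)) \<theta> \<xi>) (differential_on S (\<phi> (-t)) \<theta> \<xi>))
              \<le> C * lam powr t * sqrt (m \<theta> \<xi> \<xi>))))"

text \<open>Completeness is what makes \<open>geodesic_flow\<close> meaningful, so it is part of the definition.\<close>
definition geodesic_flow_anosov ::
    "'a::euclidean_space set \<Rightarrow> ('c::euclidean_space \<Rightarrow> 'a) \<Rightarrow> 'a metric \<Rightarrow> bool" where
  "geodesic_flow_anosov M \<Psi> m \<longleftrightarrow>
     geodesically_complete M \<Psi> m \<and>
     anosov_flow (unit_tangent_bundle M m) (sasaki_metric \<Psi> m) (geodesic_flow M \<Psi> m)"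

section \<open>The warped product of the line and the torus\<close>

definition flat_metric :: "'a::euclidean_space metric" where
  "flat_metric p u v = u \<bullet> v"

definition warped_metric ::
    "'a::euclidean_space metric \<Rightarrow> ('a \<Rightarrow> real) \<Rightarrow> 'b::euclidean_space metric \<Rightarrow> ('a \<times> 'b) metric" where
  "warped_metric m\<^sub>M f m\<^sub>N p u v =
     m\<^sub>M (fst p) (fst u) (fst v) + (f (fst p))\<^sup>2 * m\<^sub>N (snd p) (snd u) (snd v)"

text \<open>The ambient space \<open>complex ^ 'n\<close> is \<open>\<real>\<^sup>2\<^sup>n\<close> with its standard inner product.\<close>
definition torus :: "(complex ^ 'n) set" where
  "torus = {z. \<forall>i. z $ i \<in> sphere 0 1}"

definition angular_param :: "real \<times> (real ^ 'n) \<Rightarrow> real \<times> (complex ^ 'n)" where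
  "angular_param = (\<lambda>(x, y). (x, \<chi> i. cis (y $ i)))"

lemma range_angular_param: "range (angular_param :: real \<times> (real ^ 'n) \<Rightarrow> _) = UNIV \<times> torus"
proof -
  have "\<exists>y :: real ^ 'n. (\<chi> i. cis (y $ i)) = z" if "z \<in> torus" for z :: "complex ^ 'n"
  proof (intro exI)
    have "cis (Arg (z $ i)) = z $ i" for i
    proof -
      have "norm (z $ i) = 1" using that by (simp add: torus_def)
      moreover from this have "z $ i \<noteq> 0" by auto
      ultimately show ?thesis using cis_Arg[of "z $ i"] by (simp add: sgn_eq)
    qed
    then show "(\<chi> i. cis ((\<chi> i. Arg (z $ i)) $ i)) = z"
      by (simp add: vec_eq_iff)
  qed
  then show ?thesis
    by (fastforce simp: angular_param_def torus_def image_iff)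
qed

lemma has_derivative_angular_param:
  "(angular_param has_derivative (\<lambda>(a, b). (a, \<chi> i. of_real (b $ i) * (\<i> * cis (snd q $ i))))) (at q)"
  for q :: "real \<times> (real ^ 'n)"
proof -
  have cis: "((\<lambda>r :: real \<times> (real ^ 'n). cis (snd r $ i)) has_derivative
         (\<lambda>z. of_real (snd z $ i) * (\<i> * cis (snd q $ i)))) (at q)" for i
  proof -
    have "((\<lambda>r :: real \<times> (real ^ 'n). snd r $ i) has_derivative (\<lambda>z. snd z $ i)) (at q)"
      by (intro bounded_linear.has_derivative[OF bounded_linear_vec_nth]
            bounded_linear_imp_has_derivative bounded_linear_snd)
    from has_derivative_cis[OF this] show ?thesis
      by (simp add: scaleR_conv_of_real)
  qed
  have "((\<lambda>r :: real \<times> (real ^ 'n). (\<chi> i. cis (snd r $ i))) has_derivative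
        (\<lambda>z. \<chi> i. of_real (snd z $ i) * (\<i> * cis (snd q $ i)))) (at q)"
    by (subst has_derivative_componentwise_within)
      (auto simp: Basis_vec_def inner_axis intro!: has_derivative_inner_left cis)
  from has_derivative_Pair[OF bounded_linear_imp_has_derivative[OF bounded_linear_fst] this]
  show ?thesis
    by (simp add: angular_param_def case_prod_unfold)
qed

text \<open>In angular coordinates the metric is \<open>dx\<^sup>2 + f(x)\<^sup>2 (dy\<^sub>1\<^sup>2 + \<dots> + dy\<^sub>n\<^sup>2)\<close>.\<close>
lemma pullback_warped_metric:
  fixes q u v :: "real \<times> (real ^ 'n)"
  shows "pullback_metric angular_param (warped_metric flat_metric f flat_metric) q u v =
    fst u * fst v + (f (fst q))\<^sup>2 * (\<Sum>i\<in>UNIV. snd u $ i * snd v $ i)"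
proof -
  have fd: "frechet_derivative angular_param (at q) =
      (\<lambda>(a, b). (a, \<chi> i. of_real (b $ i) * (\<i> * cis (snd q $ i))))"
    using frechet_derivative_at[OF has_derivative_angular_param[of q]] by simp
  have "(of_real a * (\<i> * cis y)) \<bullet> (of_real b * (\<i> * cis y)) = a * b" for a b y
  proof -
    have "(of_real a * (\<i> * cis y)) \<bullet> (of_real b * (\<i> * cis y)) = a * b * ((sin y)\<^sup>2 + (cos y)\<^sup>2)"
      by (simp add: inner_complex_def power2_eq_square algebra_simps
          del: sin_cos_squared_add sin_cos_squared_add2 sin_cos_squared_add3)
    then show ?thesis by simp
  qed
  then show ?thesis
    unfolding pullback_metric_def fd
    by (simp add: warped_metric_def flat_metric_def angular_param_def case_prod_unfold
        inner_vec_def)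
qed

end

theory Submission
  imports Defs
begin

text \<open>
  In the orthonormal frame \<open>\<partial>\<^sub>x, f\<^sup>-\<^sup>1 \<partial>\<^sub>y\<close> a unit vector is a pair \<open>(s, w)\<close>, and with \<open>f = exp g\<close> the
  geodesic equation becomes \<open>x' = s\<close>, \<open>y' = w / f\<close>, \<open>s' = g'(x) |w|\<^sup>2\<close>, \<open>w' = - g'(x) s w\<close>: the torus
  coordinate does not act back on the other variables, and the direction of \<open>w\<close> is constant. Putting
  \<open>s = sin \<phi>\<close> turns \<open>(x, s)\<close> into the globally Lipschitz plane system \<open>x' = sin \<phi>\<close>, \<open>\<phi>' = g'(x) cos \<phi>\<close>,
  which gives completeness. Differentiability of the flow comes from a theorem on
  dependence on the initial value, with derivative the solution operator of the
  variational equation.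

  Along a geodesic, the Jacobi fields orthogonal to it decouple into scalar equations \<open>j'' = k j\<close>, with
  \<open>k = h\<close> for the direction in the plane spanned by \<open>\<partial>\<^sub>x\<close> and \<open>w\<close>, and \<open>k = s\<^sup>2 h + (1 - s\<^sup>2) g'\<^sup>2\<close> for the directions
  orthogonal to that plane. Both are nonnegative and bounded (\<open>h\<close> is continuous and periodic). For such \<open>k\<close> there
  is, up to scaling, one solution \<open>j\<close> bounded on the positive half line; it is positive and convex, and the slopes
  \<open>U = - j' / j\<close> in the two kinds of direction make up an operator on the orthogonal complement of the velocity.
  The stable space consists of the vectors with horizontal part \<open>u\<close> and vertical part \<open>- U u\<close>.

  Contraction must be uniform although \<open>h\<close> may vanish on intervals. The slope satisfies \<open>U' = U\<^sup>2 - k\<close> and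
  \<open>0 \<le> U \<le> M\<close>, so \<open>U \<ge> U\<^sup>2 / M = (U' + k) / M\<close>, and it suffices that \<open>k\<close> has a positive lower bound up to the
  derivative of a bounded function. Both choices of \<open>k\<close> are at least \<open>s\<^sup>2 h\<close>, and a short computation gives
  \<open>s\<^sup>2 h \<ge> (C1/2)\<^sup>2 + (s (g' - C2))'\<close>. Hence \<open>\<integral> U\<close> grows at least linearly, with constants that do not
  depend on the geodesic (\<open>decaying_jacobi_exponential\<close>, \<open>potential_derivative\<close>).

  Continuity of the bundle follows from a Wronskian estimate for the slopes (\<open>stable_slope_continuity\<close>).
  The unstable bundle is the image of the stable one under reversal of velocities. The two are transverse
  because both slopes are positive. The curvature statement is a computation with the Christoffel symbols:
  the numerator of the sectional curvature is minus a sum of two products of nonnegative terms.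
\<close>

section \<open>Flows of vector fields\<close>

lemma norm_fst_snd: "norm (fst z) \<le> norm z" "norm (snd z) \<le> norm z"
  by (metis norm_fst_le prod.collapse) (metis norm_snd_le prod.collapse)

lemma inner_has_real_derivative:
  fixes f :: "real \<Rightarrow> 'a::real_inner"
  assumes "(f has_vector_derivative f') (at t)" "(k has_vector_derivative k') (at t)"
  shows "((\<lambda>t. f t \<bullet> k t) has_real_derivative f t \<bullet> k' + f' \<bullet> k t) (at t)"
  unfolding has_field_derivative_def
  by (rule has_derivative_eq_rhs[OF has_derivative_inner[OF assms[unfolded has_vector_derivative_def]]])
     (simp add: fun_eq_iff algebra_simps)

lemma real_lipschitz:
  fixes f :: "real \<Rightarrow> real"
  assumes "\<And>x. (f has_real_derivative f' x) (at x)" "\<And>x. \<bar>f' x\<bar> \<le> B"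
  shows "\<bar>f a - f b\<bar> \<le> B * \<bar>a - b\<bar>"
  using field_differentiable_bound[of UNIV f f' B a b] assms by (simp add: abs_minus_commute)

lemma antiderivative_exists:
  fixes f :: "real \<Rightarrow> 'a::euclidean_space"
  assumes "continuous_on UNIV f"
  shows "\<exists>G. G 0 = 0 \<and> (\<forall>t. (G has_vector_derivative f t) (at t))"
proof -
  have "isCont f x" for x
    using assms by (simp add: continuous_on_eq_continuous_at)
  with einterval_antiderivative[of "-\<infinity>" "\<infinity>" f]
  obtain F where F: "\<And>x. (F has_vector_derivative f x) (at x)" by auto
  have "((\<lambda>x. F x - F 0) has_vector_derivative f x) (at x)" for x
    by (auto intro!: derivative_eq_intros F)
  then show ?thesis
    by (intro exI[of _ "\<lambda>x. F x - F 0"]) simp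
qed

lemma has_vector_derivative_reflect:
  fixes G :: "real \<Rightarrow> 'a::real_normed_vector"
  assumes "\<And>t. (G has_vector_derivative f t) (at t)"
  shows "((\<lambda>t. G (- t)) has_vector_derivative - f (- t)) (at t)"
proof -
  have "((G \<circ> uminus) has_vector_derivative ((-1) *\<^sub>R f (- t))) (at t)"
    by (rule vector_diff_chain_at) (auto intro!: derivative_eq_intros assms)
  then show ?thesis by (simp add: o_def)
qed

text \<open>
  The factor \<open>1 / (k + 1)\<close> gained by each integration is what makes Picard iterates converge for all times.
\<close>
lemma norm_growth:
  fixes G :: "real \<Rightarrow> 'a::real_normed_vector"
  assumes "G 0 = 0" and G: "\<And>t. (G has_vector_derivative f t) (at t)"
    and bound: "\<And>t. \<bar>t\<bar> \<le> R \<Longrightarrow> norm (f t) \<le> c * \<bar>t\<bar> ^ k" and t: "\<bar>t\<bar> \<le> R"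
  shows "norm (G t) \<le> c * \<bar>t\<bar> ^ Suc k / real (Suc k)"
proof -
  have pos: "norm (G t) \<le> c * t ^ Suc k / real (Suc k)"
    if t: "0 < t" "t \<le> R" and "G 0 = 0" and G: "\<And>t. (G has_vector_derivative f t) (at t)"
      and bound: "\<And>t. \<bar>t\<bar> \<le> R \<Longrightarrow> norm (f t) \<le> c * \<bar>t\<bar> ^ k"
    for G :: "real \<Rightarrow> 'a" and f t
  proof -
    have "norm (G t - G 0) \<le> c * t ^ Suc k / real (Suc k) - c * 0 ^ Suc k / real (Suc k)"
    proof (rule differentiable_bound_general[where f' = f and \<phi>' = "\<lambda>x. c * x ^ k"])
      show "continuous_on {0..t} G"
        by (meson G continuous_at_imp_continuous_on has_vector_derivative_continuous)
      show "((\<lambda>t. c * t ^ Suc k / real (Suc k)) has_vector_derivative c * x ^ k) (at x)" for x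
        unfolding has_real_derivative_iff_has_vector_derivative[symmetric]
          using DERIV_cmult[OF DERIV_pow[of "Suc k" x], of "c / real (Suc k)"]
          by (simp del: of_nat_Suc)
      show "norm (f x) \<le> c * x ^ k" if "0 < x" "x < t" for x
        using bound[of x] that t by simp
    qed (use t G in \<open>auto intro!: continuous_intros\<close>)
    then show ?thesis using that by simp
  qed
  consider "t = 0" | "t > 0" | "t < 0" by linarith
  then show ?thesis
  proof cases
    case 3
    have "norm (G (- (- t))) \<le> c * (- t) ^ Suc k / real (Suc k)"
      by (rule pos[of "- t" "\<lambda>t. G (- t)" "\<lambda>t. - f (- t)"])
         (use 3 t assms bound[of "- _"] has_vector_derivative_reflect[of G f] in auto)
    with 3 show ?thesis by simp
  qed (use assms pos[of t G f] in auto)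
qed

text \<open>
  The Lipschitz constant is uniform in time, so consecutive Picard iterates differ by at most
  \<open>M L\<^sup>k |t|\<^sup>k\<^sup>+\<^sup>1 / (k + 1)!\<close> on a bounded interval. The iterates do not depend on the interval; their limit is a
  solution on the whole line.
\<close>
theorem picard_lindeloef:
  fixes F :: "real \<Rightarrow> 'a::euclidean_space \<Rightarrow> 'a"
  assumes cont: "continuous_on UNIV (\<lambda>(t, x). F t x)"
    and lip: "\<And>t x y. norm (F t x - F t y) \<le> L * norm (x - y)"
  shows "\<exists>u. u 0 = x0 \<and> (\<forall>t. (u has_vector_derivative F t (u t)) (at t))"
proof -
  obtain I where I: "\<And>f :: real \<Rightarrow> 'a. continuous_on UNIV f \<Longrightarrow>
      I f 0 = 0 \<and> (\<forall>t. (I f has_vector_derivative f t) (at t))"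
    using antiderivative_exists by metis
  have L: "L \<ge> 0"
  proof -
    obtain b :: 'a where b: "b \<in> Basis" using nonempty_Basis by blast
    have "0 \<le> L * norm (b - 0)" using lip[of 0 b 0] norm_ge_zero order_trans by blast
    with b show ?thesis by simp
  qed
  have contF: "continuous_on UNIV (\<lambda>t. F t (v t))" if "continuous_on UNIV v" for v
    using continuous_on_compose2[OF cont, of UNIV "\<lambda>t. (t, v t)"] that
    by (simp add: continuous_on_Pair)
  define u where "u = rec_nat (\<lambda>_. x0) (\<lambda>_ v t. x0 + I (\<lambda>\<tau>. F \<tau> (v \<tau>)) t)"
  have u0: "u 0 = (\<lambda>_. x0)" and uS: "u (Suc k) = (\<lambda>t. x0 + I (\<lambda>\<tau>. F \<tau> (u k \<tau>)) t)" for k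
    by (simp_all add: u_def)
  have IF: "I (\<lambda>\<tau>. F \<tau> (v \<tau>)) 0 = 0"
    "(I (\<lambda>\<tau>. F \<tau> (v \<tau>)) has_vector_derivative F t (v t)) (at t)"
    if "continuous_on UNIV v" for v t
    using I[OF contF[OF that]] by blast+
  have uc: "continuous_on UNIV (u k)" for k
  proof (induction k)
    case (Suc k)
    have "continuous_on UNIV (I (\<lambda>\<tau>. F \<tau> (u k \<tau>)))"
      using IF(2)[OF Suc] has_vector_derivative_continuous
      by (fastforce simp: continuous_on_eq_continuous_at)
    then show ?case unfolding uS by (intro continuous_intros)
  qed (simp add: u0)
  define U where "U = (\<lambda>t. x0 + (\<Sum>i. u (Suc i) t - u i t))"
  have unif: "uniform_limit {-R..R} u U sequentially" if R: "R \<ge> 0" for R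
  proof -
    have "compact ((\<lambda>t. F t x0) ` {-R..R})"
      by (intro compact_continuous_image continuous_on_subset[OF contF]) auto
    then obtain M where M: "\<And>t. t \<in> {-R..R} \<Longrightarrow> norm (F t x0) \<le> M"
      using compact_imp_bounded bounded_iff by (metis imageI)
    have M0: "M \<ge> 0" using order_trans[OF norm_ge_zero M[of 0]] R by simp
    have bd: "norm (u (Suc k) t - u k t) \<le> M * L ^ k / fact (Suc k) * \<bar>t\<bar> ^ Suc k"
      if "\<bar>t\<bar> \<le> R" for k t
      using that
    proof (induction k arbitrary: t)
      case 0
      have "norm (I (\<lambda>\<tau>. F \<tau> x0) t) \<le> M * \<bar>t\<bar> ^ Suc 0 / real (Suc 0)"
        by (rule norm_growth[OF IF[of "\<lambda>_. x0"], of R]) (use M 0 in \<open>auto simp: abs_le_iff minus_le_iff\<close>)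
      then show ?case by (simp add: u0 uS)
    next
      case (Suc k)
      have "norm (I (\<lambda>\<tau>. F \<tau> (u (Suc k) \<tau>)) t - I (\<lambda>\<tau>. F \<tau> (u k \<tau>)) t)
          \<le> (L * (M * L ^ k / fact (Suc k))) * \<bar>t\<bar> ^ Suc (Suc k) / real (Suc (Suc k))"
      proof (rule norm_growth[where R = R and
            f = "\<lambda>t. F t (u (Suc k) t) - F t (u k t)"])
        show "norm (F t (u (Suc k) t) - F t (u k t)) \<le> L * (M * L ^ k / fact (Suc k)) * \<bar>t\<bar> ^ Suc k"
          if "\<bar>t\<bar> \<le> R" for t
          using lip[of t "u (Suc k) t" "u k t"] mult_left_mono[OF Suc.IH[OF that] L]
          by (simp add: mult.assoc)
      qed (use IF uc Suc.prems in \<open>auto intro!: derivative_eq_intros\<close>)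
      also have "(L * (M * L ^ k / fact (Suc k))) * \<bar>t\<bar> ^ Suc (Suc k) / real (Suc (Suc k))
         = M * L ^ Suc k / fact (Suc (Suc k)) * \<bar>t\<bar> ^ Suc (Suc k)"
        by (simp add: field_simps)
      finally show ?case by (simp add: uS[of "Suc k"] uS[of k])
    qed
    have "uniform_limit {-R..R} (\<lambda>n t. \<Sum>i<n. u (Suc i) t - u i t)
        (\<lambda>t. \<Sum>i. u (Suc i) t - u i t) sequentially"
    proof (rule Weierstrass_m_test[where M = "\<lambda>k. M * R * (inverse (fact k) * (L * R) ^ k)"])
      fix n t assume "t \<in> {-R..R}"
      then have t: "\<bar>t\<bar> \<le> R" by auto
      have "M * L ^ n / fact (Suc n) * \<bar>t\<bar> ^ Suc n \<le> M * L ^ n / fact n * R ^ Suc n"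
        using M0 L t by (intro mult_mono divide_left_mono power_mono)
           (auto intro!: fact_mono mult_nonneg_nonneg)
      also have "M * L ^ n / fact n * R ^ Suc n = M * R * (inverse (fact n) * (L * R) ^ n)"
        by (simp add: field_simps power_mult_distrib)
      finally show "norm (u (Suc n) t - u n t) \<le> M * R * (inverse (fact n) * (L * R) ^ n)"
        using bd[OF t, of n] by linarith
    qed (intro summable_mult summable_exp)
    then have "uniform_limit {-R..R} (\<lambda>n t. x0 + (\<Sum>i<n. u (Suc i) t - u i t)) U sequentially"
      unfolding U_def by (intro uniform_limit_intros)
    moreover have "x0 + (\<Sum>i<n. u (Suc i) t - u i t) = u n t" for n t
      by (subst sum_lessThan_telescope) (simp add: u0)
    ultimately show ?thesis by simp
  qed
  have Uc: "continuous_on UNIV U"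
  proof -
    have "isCont U x" for x
    proof -
      have "continuous_on {-(\<bar>x\<bar> + 1)..\<bar>x\<bar> + 1} U"
        by (rule uniform_limit_theorem[OF _ unif])
           (auto intro!: always_eventually continuous_on_subset[OF uc])
      then show ?thesis
        by (rule continuous_on_interior) (auto simp: interior_atLeastAtMost_real)
    qed
    then show ?thesis by (simp add: continuous_on_eq_continuous_at)
  qed
  have fix_U: "U t = x0 + I (\<lambda>\<tau>. F \<tau> (U \<tau>)) t" for t
  proof -
    define R where "R = \<bar>t\<bar> + 1"
    have R: "R \<ge> 0" "t \<in> {-R..R}" "R > 0" by (auto simp: R_def)
    have "(\<lambda>k. u (Suc k) t) \<longlonglongrightarrow> x0 + I (\<lambda>\<tau>. F \<tau> (U \<tau>)) t"
    proof (rule metric_LIMSEQ_I)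
      fix e :: real assume e: "e > 0"
      define d where "d = e / (2 * (L + 1) * R)"
      have d: "d > 0" using e L by (auto simp: d_def R_def intro!: divide_pos_pos mult_pos_pos)
      from uniform_limitD[OF unif[OF R(1)] d]
      obtain N where N: "\<And>k \<tau>. k \<ge> N \<Longrightarrow> \<tau> \<in> {-R..R} \<Longrightarrow> dist (u k \<tau>) (U \<tau>) < d"
        unfolding eventually_sequentially by blast
      have "dist (u (Suc k) t) (x0 + I (\<lambda>\<tau>. F \<tau> (U \<tau>)) t) < e" if "k \<ge> N" for k
      proof -
        have "norm (I (\<lambda>\<tau>. F \<tau> (u k \<tau>)) t - I (\<lambda>\<tau>. F \<tau> (U \<tau>)) t) \<le> (L * d) * \<bar>t\<bar> ^ Suc 0 / real (Suc 0)"
        proof (rule norm_growth[where R = R and f = "\<lambda>t. F t (u k t) - F t (U t)"])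
          fix t assume "\<bar>t\<bar> \<le> R"
          then have "norm (u k t - U t) \<le> d"
            using N[OF that, of t] by (auto simp: dist_norm abs_le_iff minus_le_iff)
          then show "norm (F t (u k t) - F t (U t)) \<le> L * d * \<bar>t\<bar> ^ 0"
            using lip[of t "u k t" "U t"] mult_left_mono[OF _ L] by fastforce
        qed (use IF uc Uc R in \<open>auto intro!: derivative_eq_intros\<close>)
        also have "\<dots> \<le> (L + 1) * d * R"
          using L d R by (auto intro!: mult_mono)
        also have "\<dots> = e / 2"
        proof -
          have "L + 1 \<noteq> 0" "R \<noteq> 0" using L R by auto
          then have "(L + 1) * (e / (2 * (L + 1) * R)) * R = e / 2" by (simp add: divide_simps)
          then show ?thesis by (simp only: d_def)
        qed
        finally show ?thesis using e by (simp add: uS dist_norm)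
      qed
      then show "\<exists>N. \<forall>k\<ge>N. dist (u (Suc k) t) (x0 + I (\<lambda>\<tau>. F \<tau> (U \<tau>)) t) < e" by blast
    qed
    moreover have "(\<lambda>k. u (Suc k) t) \<longlonglongrightarrow> U t"
      using tendsto_uniform_limitI[OF unif[OF R(1)] R(2)] by (rule LIMSEQ_Suc)
    ultimately show ?thesis by (rule LIMSEQ_unique[rotated])
  qed
  have "(U has_vector_derivative F t (U t)) (at t)" for t
  proof -
    have "((\<lambda>t. x0 + I (\<lambda>\<tau>. F \<tau> (U \<tau>)) t) has_vector_derivative F t (U t)) (at t)"
      using IF(2)[OF Uc] by (auto intro!: derivative_eq_intros)
    then show ?thesis by (simp only: fix_U[symmetric])
  qed
  moreover have "U 0 = x0" using fix_U[of 0] IF(1)[OF Uc] by simp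
  ultimately show ?thesis by blast
qed

text \<open>
  The estimate is for squares, which are differentiable where \<open>d\<close> vanishes; carrying \<open>c\<^sup>2\<close> along absorbs the
  inhomogeneous term, because \<open>2 c |d| \<le> |d|\<^sup>2 + c\<^sup>2\<close>.
\<close>
lemma gronwall:
  fixes d :: "real \<Rightarrow> 'a::real_inner"
  assumes L: "L \<ge> 0" and d: "\<And>t. (d has_vector_derivative d' t) (at t)"
    and bound: "\<And>t. \<bar>t\<bar> \<le> R \<Longrightarrow> norm (d' t) \<le> L * norm (d t) + c" and t: "\<bar>t\<bar> \<le> R" and c: "c \<ge> 0"
  shows "(norm (d t))\<^sup>2 + c\<^sup>2 \<le> ((norm (d 0))\<^sup>2 + c\<^sup>2) * exp ((2 * L + 1) * \<bar>t\<bar>)"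
proof -
  have pos: "(norm (d t))\<^sup>2 + c\<^sup>2 \<le> ((norm (d 0))\<^sup>2 + c\<^sup>2) * exp ((2 * L + 1) * t)"
    if d: "\<And>t. (d has_vector_derivative d' t) (at t)"
      and bound: "\<And>t. \<bar>t\<bar> \<le> R \<Longrightarrow> norm (d' t) \<le> L * norm (d t) + c" and t: "0 \<le> t" "t \<le> R"
    for d d' :: "real \<Rightarrow> 'a" and t
  proof -
    define E where "E = (\<lambda>s. (d s \<bullet> d s + c\<^sup>2) * exp (- ((2 * L + 1) * s)))"
    have "E t \<le> E 0"
    proof (rule DERIV_nonpos_imp_nonincreasing[OF t(1)])
      fix s assume s: "0 \<le> s" "s \<le> t"
      have "((\<lambda>s. d s \<bullet> d s) has_real_derivative 2 * (d s \<bullet> d' s)) (at s)"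
        using d[of s] unfolding has_real_derivative_iff_has_vector_derivative
          has_vector_derivative_def
        by (auto intro!: derivative_eq_intros simp: inner_commute algebra_simps fun_eq_iff)
      then have "(E has_real_derivative
          (2 * (d s \<bullet> d' s) - (2 * L + 1) * (d s \<bullet> d s + c\<^sup>2)) * exp (- ((2 * L + 1) * s))) (at s)"
        unfolding E_def by (auto intro!: derivative_eq_intros simp: algebra_simps)
      moreover have "2 * (d s \<bullet> d' s) - (2 * L + 1) * (d s \<bullet> d s + c\<^sup>2) \<le> 0"
      proof -
        have "2 * (d s \<bullet> d' s) \<le> 2 * (norm (d s) * norm (d' s))"
          using norm_cauchy_schwarz[of "d s" "d' s"] by simp
        also have "\<dots> \<le> 2 * (norm (d s) * (L * norm (d s) + c))"
          using bound[of s] s t by (intro mult_left_mono) auto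
        finally have *: "2 * (d s \<bullet> d' s) \<le> 2 * L * (norm (d s))\<^sup>2 + 2 * norm (d s) * c"
          by (simp add: algebra_simps power2_eq_square)
        have "2 * L * c\<^sup>2 \<ge> 0" using L by simp
        moreover have "2 * norm (d s) * c \<le> (norm (d s))\<^sup>2 + c\<^sup>2"
          using sum_squares_bound by blast
        ultimately show ?thesis using * by (simp add: dot_square_norm algebra_simps)
      qed
      ultimately show "\<exists>y. (E has_real_derivative y) (at s) \<and> y \<le> 0"
        by (meson exp_ge_zero mult_nonpos_nonneg)
    qed
    then have "E t * exp ((2 * L + 1) * t) \<le> E 0 * exp ((2 * L + 1) * t)" by simp
    then show ?thesis by (simp add: E_def dot_square_norm mult.assoc flip: exp_add)
  qed
  show ?thesis
  proof (cases "t \<ge> 0")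
    case False
    show ?thesis
      using pos[of "\<lambda>t. d (- t)" "\<lambda>t. - d' (- t)" "- t"] False t bound[of "- _"]
        has_vector_derivative_reflect[of d d', OF d] by auto
  qed (use pos[OF d bound] t in auto)
qed

text \<open>
  The derivative is a bounded linear function, so that its continuity is continuity in the operator norm.
\<close>
definition C1_field :: "('a::euclidean_space \<Rightarrow> 'a) \<Rightarrow> ('a \<Rightarrow> 'a \<Rightarrow>\<^sub>L 'a) \<Rightarrow> bool" where
  "C1_field X DX \<longleftrightarrow> (\<forall>a. (X has_derivative blinfun_apply (DX a)) (at a)) \<and> continuous_on UNIV DX"

definition integral_curve :: "('a::real_normed_vector \<Rightarrow> 'a) \<Rightarrow> (real \<Rightarrow> 'a) \<Rightarrow> bool" where
  "integral_curve X u \<longleftrightarrow> (\<forall>t. (u has_vector_derivative X (u t)) (at t))"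

lemma integral_curve_continuous: "integral_curve X u \<Longrightarrow> continuous_on A u"
  unfolding integral_curve_def
  by (meson continuous_at_imp_continuous_on has_vector_derivative_continuous)

lemma C1_field_bounded_derivative:
  assumes "C1_field X DX" "compact K"
  obtains L where "L \<ge> 0" "\<And>b. b \<in> K \<Longrightarrow> norm (DX b) \<le> L"
proof -
  have "compact (DX ` K)"
    using assms unfolding C1_field_def
    by (metis compact_continuous_image continuous_on_subset subset_UNIV)
  then obtain L where "\<And>b. b \<in> K \<Longrightarrow> norm (DX b) \<le> L"
    using compact_imp_bounded bounded_iff by (metis imageI)
  then have "\<And>b. b \<in> K \<Longrightarrow> norm (DX b) \<le> max L 0" by fastforce
  then show ?thesis using that[of "max L 0"] by auto
qed

lemma C1_field_lipschitz:
  assumes X: "C1_field X DX" and K: "convex K" and L: "\<And>b. b \<in> K \<Longrightarrow> norm (DX b) \<le> L"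
    and ab: "a \<in> K" "b \<in> K"
  shows "norm (X a - X b) \<le> L * norm (a - b)"
proof (rule differentiable_bound[OF K])
  show "(X has_derivative blinfun_apply (DX x)) (at x within K)" for x
    using X by (auto simp: C1_field_def intro: has_derivative_at_withinI)
qed (use L ab in \<open>auto simp: norm_blinfun.rep_eq\<close>)

lemma integral_curve_unique:
  assumes X: "C1_field X DX" and u: "integral_curve X u" and v: "integral_curve X v"
    and 0: "u 0 = v 0"
  shows "u = v"
proof
  fix t :: real
  define R where "R = \<bar>t\<bar>"
  have "compact (u ` {-R..R} \<union> v ` {-R..R})"
    by (intro compact_Un compact_continuous_image integral_curve_continuous[OF u]
        integral_curve_continuous[OF v]) auto
  then obtain B where "\<forall>y \<in> u ` {-R..R} \<union> v ` {-R..R}. norm y \<le> B"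
    using compact_imp_bounded bounded_iff by metis
  then have B: "u ` {-R..R} \<union> v ` {-R..R} \<subseteq> cball 0 B"
    by auto
  obtain L where L: "L \<ge> 0" "\<And>b. b \<in> cball 0 B \<Longrightarrow> norm (DX b) \<le> L"
    using C1_field_bounded_derivative[OF X compact_cball[of 0 B]] by blast
  have "(norm (u t - v t))\<^sup>2 + 0\<^sup>2 \<le> ((norm (u 0 - v 0))\<^sup>2 + 0\<^sup>2) * exp ((2 * L + 1) * \<bar>t\<bar>)"
  proof (rule gronwall[where R = R and d' = "\<lambda>t. X (u t) - X (v t)"])
    show "norm (X (u s) - X (v s)) \<le> L * norm (u s - v s) + 0" if "\<bar>s\<bar> \<le> R" for s
    proof -
      have "u s \<in> cball 0 B" "v s \<in> cball 0 B"
        using that B by (auto simp: image_subset_iff abs_le_iff)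
      then show ?thesis
        using C1_field_lipschitz[OF X convex_cball L(2)] by (metis add.right_neutral)
    qed
  qed (use u v L in \<open>auto simp: R_def integral_curve_def intro!: derivative_intros\<close>)
  then show "u t = v t" by (simp add: 0)
qed

lemma integral_curve_dependence:
  assumes X: "C1_field X DX" and K: "convex K" and L: "\<And>b. b \<in> K \<Longrightarrow> norm (DX b) \<le> L" "L \<ge> 0"
    and u: "integral_curve X u" "\<And>t. \<bar>t\<bar> \<le> R \<Longrightarrow> u t \<in> K"
    and v: "integral_curve X v" "\<And>t. \<bar>t\<bar> \<le> R \<Longrightarrow> v t \<in> K"
    and t: "\<bar>t\<bar> \<le> R"
  shows "norm (u t - v t) \<le> norm (u 0 - v 0) * exp ((L + 1) * R)"
proof -
  have "(norm (u t - v t))\<^sup>2 + 0\<^sup>2 \<le> ((norm (u 0 - v 0))\<^sup>2 + 0\<^sup>2) * exp ((2 * L + 1) * \<bar>t\<bar>)"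
    by (rule gronwall[where R = R and d' = "\<lambda>t. X (u t) - X (v t)"])
       (use u v L t C1_field_lipschitz[OF X K L(1)]
         in \<open>auto simp: integral_curve_def intro!: derivative_intros\<close>)
  also have "\<dots> \<le> (norm (u 0 - v 0))\<^sup>2 * exp (2 * ((L + 1) * R))"
  proof -
    have "(2 * L + 1) * \<bar>t\<bar> \<le> (2 * (L + 1)) * R" using t L by (intro mult_mono) auto
    then show ?thesis by (auto intro!: mult_left_mono simp: algebra_simps)
  qed
  also have "\<dots> = (norm (u 0 - v 0) * exp ((L + 1) * R))\<^sup>2"
    by (simp add: power_mult_distrib exp_double)
  finally show ?thesis by (simp add: power2_le_iff_abs_le)
qed

text \<open>
  If \<open>\<delta>\<close> solves the variational equation along \<open>u a0\<close> with initial value \<open>y - a0\<close>, then the error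
  \<open>u y - u a0 - \<delta>\<close> solves that linear equation up to a remainder \<open>o(|y - a0|)\<close>, and Gronwall's inequality
  bounds it. Initial values range over a set \<open>S\<close> only: the curves are given there, and the derivative is
  taken within \<open>S\<close>. The second conclusion identifies the derivative.
\<close>
theorem flow_differentiable:
  fixes X :: "'a::euclidean_space \<Rightarrow> 'a"
  assumes X: "C1_field X DX" and K: "compact K" "convex K" and r: "r > 0"
    and u: "\<And>a. a \<in> S \<Longrightarrow> integral_curve X (u a)" "\<And>a. a \<in> S \<Longrightarrow> u a 0 = a"
    and uK: "\<And>a \<tau>. a \<in> S \<Longrightarrow> norm (a - a0) < r \<Longrightarrow> \<bar>\<tau>\<bar> \<le> R \<Longrightarrow> u a \<tau> \<in> K"
    and a0: "a0 \<in> S" and t: "\<bar>t\<bar> \<le> R"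
  shows "\<exists>D. ((\<lambda>a. u a t) has_derivative D) (at a0 within S) \<and>
    (\<forall>\<delta>. (\<forall>\<tau>. (\<delta> has_vector_derivative DX (u a0 \<tau>) (\<delta> \<tau>)) (at \<tau>)) \<longrightarrow> D (\<delta> 0) = \<delta> t)"
proof -
  have R: "R \<ge> 0" using t by linarith
  obtain L where L: "L \<ge> 0" "\<And>b. b \<in> K \<Longrightarrow> norm (DX b) \<le> L"
    using C1_field_bounded_derivative[OF X K(1)] by blast
  have u0K: "u a0 \<tau> \<in> K" if "\<bar>\<tau>\<bar> \<le> R" for \<tau>
    using uK[OF a0 _ that] r by simp
  \<comment> \<open>The coefficients are frozen outside \<open>[-R, R]\<close>, which makes them bounded on the whole line.\<close>
  define cl where "cl = (\<lambda>\<tau>. max (- R) (min R \<tau>))"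
  have cl: "\<bar>cl \<tau>\<bar> \<le> R" "\<bar>\<tau>\<bar> \<le> R \<Longrightarrow> cl \<tau> = \<tau>" for \<tau> using R by (auto simp: cl_def)
  define A where "A = (\<lambda>\<tau>. DX (u a0 (cl \<tau>)))"
  have AL: "norm (A \<tau>) \<le> L" for \<tau> unfolding A_def by (intro L u0K cl)
  have Ac: "continuous_on UNIV A" unfolding A_def
  proof (rule continuous_on_compose2[of UNIV DX])
    show "continuous_on UNIV (\<lambda>\<tau>. u a0 (cl \<tau>))" unfolding cl_def
      by (rule continuous_on_compose2[OF integral_curve_continuous[OF u(1)[OF a0], of UNIV]])
         (auto intro!: continuous_intros)
  qed (use X in \<open>auto simp: C1_field_def\<close>)
  have "\<exists>\<delta>. \<delta> 0 = x0 \<and> (\<forall>t. (\<delta> has_vector_derivative A t (\<delta> t)) (at t))" for x0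
  proof (rule picard_lindeloef)
    have "continuous_on UNIV (\<lambda>p. A (fst p) (snd p))"
      by (intro continuous_intros continuous_on_compose2[OF Ac]) auto
    then show "continuous_on UNIV (\<lambda>(t, x). blinfun_apply (A t) x)"
      by (simp add: case_prod_unfold)
    show "norm (A t x - A t y) \<le> L * norm (x - y)" for t x y
      by (metis AL blinfun.diff_right norm_blinfun mult_right_mono norm_ge_zero order_trans)
  qed
  then obtain dl where dl: "\<And>\<xi>. dl \<xi> 0 = \<xi>"
    "\<And>\<xi> t. (dl \<xi> has_vector_derivative A t (dl \<xi> t)) (at t)"
    by metis
  have lin_unique: "\<delta> t = \<delta>' t"
    if "\<And>t. (\<delta> has_vector_derivative e t) (at t)" "\<And>t. \<bar>t\<bar> \<le> R \<Longrightarrow> e t = A t (\<delta> t)"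
      "\<And>t. (\<delta>' has_vector_derivative e' t) (at t)" "\<And>t. \<bar>t\<bar> \<le> R \<Longrightarrow> e' t = A t (\<delta>' t)"
      "\<delta> 0 = \<delta>' 0" for \<delta> \<delta>' e e'
  proof -
    have "(norm (\<delta> t - \<delta>' t))\<^sup>2 + 0\<^sup>2 \<le> ((norm (\<delta> 0 - \<delta>' 0))\<^sup>2 + 0\<^sup>2) * exp ((2 * L + 1) * \<bar>t\<bar>)"
    proof (rule gronwall[where R = R and d' = "\<lambda>t. e t - e' t"])
      show "norm (e s - e' s) \<le> L * norm (\<delta> s - \<delta>' s) + 0" if "\<bar>s\<bar> \<le> R" for s
        using that(1) \<open>\<And>t. \<bar>t\<bar> \<le> R \<Longrightarrow> e t = _\<close> \<open>\<And>t. \<bar>t\<bar> \<le> R \<Longrightarrow> e' t = _\<close>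
        order_trans[OF norm_blinfun mult_right_mono[OF AL[of s] norm_ge_zero]]
        by (simp flip: blinfun.diff_right)
    qed (use that t L in \<open>auto intro!: derivative_intros\<close>)
    then show ?thesis using that by simp
  qed
  define D where "D = (\<lambda>\<xi>. dl \<xi> t)"
  have linD: "linear D"
  proof (rule linearI)
    show "D (x + y) = D x + D y" for x y
      unfolding D_def
      by (rule lin_unique[where \<delta>' = "\<lambda>t. dl x t + dl y t"])
         (auto intro!: derivative_intros dl simp: dl blinfun.add_right)
    show "D (c *\<^sub>R x) = c *\<^sub>R D x" for c x
      unfolding D_def
      by (rule lin_unique[where \<delta>' = "\<lambda>t. c *\<^sub>R dl x t"])
         (auto intro!: derivative_eq_intros dl simp: dl blinfun.scaleR_right)
  qed
  define M where "M = exp ((L + 1) * R)"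
  have "((\<lambda>a. u a t) has_derivative D) (at a0 within S)"
    unfolding has_derivative_within_alt
  proof (intro conjI allI impI)
    show "bounded_linear D" using linD linear_conv_bounded_linear by blast
    fix e :: real assume e: "e > 0"
    define e' where "e' = e / (M * M)"
    have M: "M > 0" and e': "e' > 0" using e by (auto simp: e'_def M_def)
    have "uniformly_continuous_on K DX"
      using X K unfolding C1_field_def
      by (metis compact_uniformly_continuous continuous_on_subset subset_UNIV)
    with e' obtain d where d: "d > 0"
      "\<And>x y. x \<in> K \<Longrightarrow> y \<in> K \<Longrightarrow> dist y x < d \<Longrightarrow> dist (DX y) (DX x) < e'"
      unfolding uniformly_continuous_on_def by blast
    have "norm (u y t - u a0 t - D (y - a0)) \<le> e * norm (y - a0)"
      if y: "y \<in> S" "norm (y - a0) < min r (d / M)" for y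
    proof -
      define \<eta> where "\<eta> = norm (y - a0)"
      have yK: "u y \<tau> \<in> K" if "\<bar>\<tau>\<bar> \<le> R" for \<tau> using uK[OF y(1) _ that] y by simp
      have close: "norm (u y \<tau> - u a0 \<tau>) \<le> \<eta> * M" if "\<bar>\<tau>\<bar> \<le> R" for \<tau>
        using integral_curve_dependence[OF X K(2) L(2,1) u(1)[OF y(1)] yK u(1)[OF a0] u0K that] y a0 u(2)
        by (simp add: \<eta>_def M_def)
      have \<eta>M: "\<eta> * M < d" using y M by (simp add: \<eta>_def pos_less_divide_eq)
      have rem: "norm (X (u y \<tau>) - X (u a0 \<tau>) - A \<tau> (u y \<tau> - u a0 \<tau>)) \<le> e' * (\<eta> * M)"
        if \<tau>: "\<bar>\<tau>\<bar> \<le> R" for \<tau>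
      proof -
        define K' where "K' = K \<inter> cball (u a0 \<tau>) (\<eta> * M)"
        have \<eta>0: "0 \<le> \<eta> * M" using M by (simp add: \<eta>_def)
        have "norm ((X (u y \<tau>) - A \<tau> (u y \<tau>)) - (X (u a0 \<tau>) - A \<tau> (u a0 \<tau>)))
            \<le> e' * norm (u y \<tau> - u a0 \<tau>)"
        proof (rule differentiable_bound[of K'])
          show "convex K'" unfolding K'_def by (intro convex_Int K convex_cball)
          show "((\<lambda>a. X a - A \<tau> a) has_derivative (\<lambda>h. DX x h - A \<tau> h)) (at x within K')" for x
            using X has_derivative_at_withinI[of X "blinfun_apply (DX x)" x K']
            by (intro has_derivative_diff bounded_linear_imp_has_derivative blinfun.bounded_linear_right)
               (simp add: C1_field_def)
          show "onorm (\<lambda>h. DX x h - A \<tau> h) \<le> e'" if "x \<in> K'" for x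
          proof -
            have "dist (DX x) (DX (u a0 \<tau>)) < e'"
              using that \<eta>M u0K[OF \<tau>] by (intro d) (auto simp: K'_def dist_commute)
            then show ?thesis
              using cl(2)[OF \<tau>] by (simp add: A_def dist_norm norm_blinfun.rep_eq blinfun.diff_left minus_blinfun.rep_eq)
          qed
        qed (use yK[OF \<tau>] u0K[OF \<tau>] close[OF \<tau>] \<eta>0 in \<open>auto simp: K'_def dist_norm norm_minus_commute\<close>)
        also have "\<dots> \<le> e' * (\<eta> * M)" using e' close[OF \<tau>] by (intro mult_left_mono) auto
        finally show ?thesis by (simp add: blinfun.diff_right algebra_simps)
      qed
      define c where "c = e' * (\<eta> * M)"
      have c: "c \<ge> 0" using e' M by (simp add: c_def \<eta>_def)
      let ?r = "\<lambda>\<tau>. u y \<tau> - u a0 \<tau> - dl (y - a0) \<tau>"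
      have "(norm (?r t))\<^sup>2 + c\<^sup>2 \<le> ((norm (?r 0))\<^sup>2 + c\<^sup>2) * exp ((2 * L + 1) * \<bar>t\<bar>)"
      proof (rule gronwall[where R = R and d' = "\<lambda>\<tau>. X (u y \<tau>) - X (u a0 \<tau>) - A \<tau> (dl (y - a0) \<tau>)"])
        show "norm (X (u y \<tau>) - X (u a0 \<tau>) - A \<tau> (dl (y - a0) \<tau>)) \<le> L * norm (?r \<tau>) + c"
          if "\<bar>\<tau>\<bar> \<le> R" for \<tau>
        proof -
          have "X (u y \<tau>) - X (u a0 \<tau>) - A \<tau> (dl (y - a0) \<tau>)
             = (X (u y \<tau>) - X (u a0 \<tau>) - A \<tau> (u y \<tau> - u a0 \<tau>)) + A \<tau> (?r \<tau>)"
            by (simp add: blinfun.diff_right)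
          also have "norm \<dots> \<le> c + L * norm (?r \<tau>)"
          proof (rule norm_triangle_mono)
            show "norm (A \<tau> (?r \<tau>)) \<le> L * norm (?r \<tau>)"
              by (rule order_trans[OF norm_blinfun mult_right_mono[OF AL norm_ge_zero]])
          qed (use rem[OF that] in \<open>simp add: c_def\<close>)
          finally show ?thesis by simp
        qed
        show "(?r has_vector_derivative X (u y \<tau>) - X (u a0 \<tau>) - A \<tau> (dl (y - a0) \<tau>)) (at \<tau>)" for \<tau>
          using u(1)[OF y(1)] u(1)[OF a0] dl(2)[of "y - a0" \<tau>] unfolding integral_curve_def
          by (intro derivative_intros) auto
      qed (use t L c in auto)
      also have "\<dots> \<le> c\<^sup>2 * exp (2 * ((L + 1) * R))"
      proof -
        have "(2 * L + 1) * \<bar>t\<bar> \<le> (2 * (L + 1)) * R" using t L by (intro mult_mono) auto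
        moreover have "?r 0 = 0" using u y a0 dl by simp
        ultimately show ?thesis by (auto intro!: mult_left_mono simp: algebra_simps)
      qed
      also have "\<dots> = (c * M)\<^sup>2" by (simp add: power_mult_distrib exp_double M_def)
      finally have "(norm (?r t))\<^sup>2 \<le> (c * M)\<^sup>2" using zero_le_power2[of c] by linarith
      then have "norm (?r t) \<le> c * M" using c M by (simp add: power2_le_iff_abs_le)
      also have "\<dots> = e * \<eta>" using M by (simp add: c_def e'_def)
      finally show ?thesis by (simp add: D_def \<eta>_def)
    qed
    moreover have "min r (d / M) > 0" using r d M by simp
    ultimately show "\<exists>d>0. \<forall>y\<in>S. norm (y - a0) < d \<longrightarrow>
        norm (u y t - u a0 t - D (y - a0)) \<le> e * norm (y - a0)"
      by blast
  qed
  moreover have "D (\<delta> 0) = \<delta> t"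
    if "\<And>\<tau>. (\<delta> has_vector_derivative DX (u a0 \<tau>) (\<delta> \<tau>)) (at \<tau>)" for \<delta>
    unfolding D_def
    by (rule lin_unique[OF dl(2) _ that]) (auto simp: dl A_def cl)
  ultimately show ?thesis by blast
qed

section \<open>The scalar Jacobi equation\<close>

definition jacobi :: "(real \<Rightarrow> real) \<Rightarrow> (real \<Rightarrow> real) \<Rightarrow> (real \<Rightarrow> real) \<Rightarrow> bool" where
  "jacobi k j j' \<longleftrightarrow> (\<forall>t. (j has_real_derivative j' t) (at t) \<and>
     (j' has_real_derivative k t * j t) (at t))"

definition jacobi_coeff :: "real \<Rightarrow> (real \<Rightarrow> real) \<Rightarrow> bool" where
  "jacobi_coeff K k \<longleftrightarrow> continuous_on UNIV k \<and> (\<forall>t. 0 \<le> k t \<and> k t \<le> K)"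

lemma jacobiD:
  assumes "jacobi k j j'"
  shows "(j has_real_derivative j' t) (at t)" "(j' has_real_derivative k t * j t) (at t)"
  using assms by (auto simp: jacobi_def)

lemma jacobi_lincomb:
  assumes "jacobi k i i'" "jacobi k j j'"
  shows "jacobi k (\<lambda>t. a * i t + b * j t) (\<lambda>t. a * i' t + b * j' t)"
  unfolding jacobi_def
  by (auto intro!: derivative_eq_intros jacobiD[OF assms(1)] jacobiD[OF assms(2)] simp: algebra_simps)

lemma jacobi_shift:
  assumes "jacobi k j j'"
  shows "jacobi (\<lambda>t. k (t + s)) (\<lambda>t. c * j (t + s)) (\<lambda>t. c * j' (t + s))"
  unfolding jacobi_def
  using jacobiD[OF assms]
  by (auto simp: DERIV_shift[symmetric] mult.left_commute intro!: DERIV_cmult[THEN DERIV_cong])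

lemma jacobi_reflect:
  assumes "jacobi k j j'"
  shows "jacobi (\<lambda>t. k (- t)) (\<lambda>t. j (- t)) (\<lambda>t. - j' (- t))"
  unfolding jacobi_def
proof (intro allI conjI)
  fix t
  show "((\<lambda>t. j (- t)) has_real_derivative - j' (- t)) (at t)"
    using DERIV_mirror[of j "j' (- t)" t] jacobiD(1)[OF assms, of "- t"]
    by (simp add: DERIV_mirror)
  show "((\<lambda>t. - j' (- t)) has_real_derivative k (- t) * j (- t)) (at t)"
    using DERIV_minus[of "\<lambda>t. j' (- t)" "- (k (- t) * j (- t))" t] jacobiD(2)[OF assms, of "- t"]
    by (simp add: DERIV_mirror)
qed

lemma jacobi_coeff_shift: "jacobi_coeff K k \<Longrightarrow> jacobi_coeff K (\<lambda>t. k (t + s))"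
  unfolding jacobi_coeff_def
  using continuous_on_compose2[of UNIV k UNIV "\<lambda>t. t + s"] by (simp add: continuous_intros)

lemma jacobi_exists:
  assumes k: "jacobi_coeff K k"
  obtains j j' where "jacobi k j j'" "j 0 = a" "j' 0 = b"
proof -
  have kK: "0 \<le> k t" "k t \<le> K" "0 \<le> K" for t
    using k order_trans[of 0 "k t" K] by (auto simp: jacobi_coeff_def)
  define F :: "real \<Rightarrow> real \<times> real \<Rightarrow> real \<times> real" where "F = (\<lambda>t z. (snd z, k t * fst z))"
  have "\<exists>u. u 0 = (a, b) \<and> (\<forall>t. (u has_vector_derivative F t (u t)) (at t))"
  proof (rule picard_lindeloef)
    have kc: "continuous_on UNIV k" using k by (simp add: jacobi_coeff_def)
    have "continuous_on UNIV (\<lambda>p. F (fst p) (snd p))" unfolding F_def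
      by (intro continuous_intros continuous_on_compose2[OF kc]) auto
    then show "continuous_on UNIV (\<lambda>(t, x). F t x)" by (simp add: case_prod_unfold)
    show "norm (F t x - F t y) \<le> (1 + K) * norm (x - y)" for t x y
    proof -
      have "norm (F t x - F t y) \<le> \<bar>snd (x - y)\<bar> + \<bar>k t * fst (x - y)\<bar>"
        using norm_Pair_le[of "snd (x - y)" "k t * fst (x - y)"]
        by (simp add: F_def algebra_simps)
      also have "\<dots> \<le> norm (x - y) + K * norm (x - y)"
      proof (rule add_mono)
        show "\<bar>snd (x - y)\<bar> \<le> norm (x - y)"
          using norm_fst_snd(2)[of "x - y"] by (simp only: real_norm_def)
        have "\<bar>fst (x - y)\<bar> \<le> norm (x - y)"
          using norm_fst_snd(1)[of "x - y"] by (simp only: real_norm_def)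
        then show "\<bar>k t * fst (x - y)\<bar> \<le> K * norm (x - y)"
          using kK(1,2)[of t] kK(3) unfolding abs_mult by (intro mult_mono) auto
      qed
      finally show ?thesis by (simp add: algebra_simps)
    qed
  qed
  then obtain u where u: "u 0 = (a, b)" "\<And>t. (u has_vector_derivative F t (u t)) (at t)" by blast
  have "((\<lambda>t. fst (u t)) has_vector_derivative fst (F t (u t))) (at t)"
    "((\<lambda>t. snd (u t)) has_vector_derivative snd (F t (u t))) (at t)" for t
    using bounded_linear.has_vector_derivative[OF bounded_linear_fst u(2)]
      bounded_linear.has_vector_derivative[OF bounded_linear_snd u(2)] by auto
  then have "jacobi k (\<lambda>t. fst (u t)) (\<lambda>t. snd (u t))"
    by (simp add: jacobi_def has_real_derivative_iff_has_vector_derivative F_def)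
  with u that show ?thesis by simp
qed

text \<open>
  \<open>(j j')' = j'\<^sup>2 + k j\<^sup>2\<close> is nonnegative, so \<open>j\<^sup>2\<close> cannot decrease and \<open>j\<close> keeps its sign.
\<close>
lemma jacobi_pos_aux:
  assumes k: "\<And>t. k t \<ge> 0" and j: "jacobi k j j'" and 0: "j 0 > 0" "j' 0 \<ge> 0" and t: "t \<ge> 0"
  shows "j t > 0 \<and> j' t \<ge> j' 0"
proof -
  have prod: "j s * j' s \<ge> 0" if "s \<ge> 0" for s
  proof -
    have "j 0 * j' 0 \<le> j s * j' s"
    proof (rule DERIV_nonneg_imp_nondecreasing[OF that])
      fix x :: real
      have "((\<lambda>s. j s * j' s) has_real_derivative (j' x)\<^sup>2 + k x * (j x)\<^sup>2) (at x)"
        by (auto intro!: derivative_eq_intros jacobiD[OF j] simp: power2_eq_square algebra_simps)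
      moreover have "(j' x)\<^sup>2 + k x * (j x)\<^sup>2 \<ge> 0" using k[of x] by simp
      ultimately show "\<exists>y. ((\<lambda>s. j s * j' s) has_real_derivative y) (at x) \<and> 0 \<le> y" by blast
    qed
    moreover have "j 0 * j' 0 \<ge> 0" using 0 by simp
    ultimately show ?thesis by linarith
  qed
  have nz: "j s \<noteq> 0" if "s \<ge> 0" for s
  proof -
    have "(j 0)\<^sup>2 \<le> (j s)\<^sup>2"
    proof (rule DERIV_nonneg_imp_nondecreasing[OF that])
      fix x :: real assume "0 \<le> x"
      have "((\<lambda>s. (j s)\<^sup>2) has_real_derivative 2 * (j x * j' x)) (at x)"
        by (auto intro!: derivative_eq_intros jacobiD[OF j] simp: power2_eq_square algebra_simps)
      then show "\<exists>y. ((\<lambda>s. (j s)\<^sup>2) has_real_derivative y) (at x) \<and> 0 \<le> y"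
        using prod[OF \<open>0 \<le> x\<close>] by fastforce
    qed
    with 0 show ?thesis by auto
  qed
  have jpos: "j s > 0" if "s \<ge> 0" for s
  proof (rule ccontr)
    assume "\<not> j s > 0"
    then have "\<exists>x\<ge>0. x \<le> s \<and> j x = 0"
      using 0 that DERIV_isCont[OF jacobiD(1)[OF j]] by (intro IVT2) auto
    with nz show False by blast
  qed
  have "j' 0 \<le> j' t"
    by (rule DERIV_nonneg_imp_nondecreasing[OF t])
       (use jacobiD(2)[OF j] jpos k in \<open>meson less_imp_le mult_nonneg_nonneg\<close>)
  with jpos t show ?thesis by simp
qed

text \<open>
  The previous lemma needs \<open>j 0 > 0\<close>; adding a small multiple of a positive solution removes this.
\<close>
lemma jacobi_growth:
  assumes k: "jacobi_coeff K k" and j: "jacobi k j j'" and 0: "j 0 \<ge> 0" "j' 0 \<ge> 0" and t: "t \<ge> 0"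
  shows "j' t \<ge> j' 0" "j t \<ge> j 0 + j' 0 * t"
proof -
  have k0: "k t \<ge> 0" for t using k by (simp add: jacobi_coeff_def)
  obtain i i' where i: "jacobi k i i'" "i 0 = 1" "i' 0 = 0"
    using jacobi_exists[OF k, of 1 0] by blast
  have j': "j' s \<ge> j' 0" if s: "s \<ge> 0" for s
  proof (rule field_le_epsilon)
    fix e :: real assume e: "e > 0"
    define d where "d = e / (\<bar>i' s\<bar> + 1)"
    have d: "d > 0" using e by (auto simp: d_def intro!: divide_pos_pos)
    have "jacobi k (\<lambda>t. 1 * j t + d * i t) (\<lambda>t. 1 * j' t + d * i' t)"
      by (rule jacobi_lincomb[OF j i(1)])
    from jacobi_pos_aux[OF k0 this _ _ s] have "j' s + d * i' s \<ge> j' 0"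
      using i 0 d by simp
    moreover have "d * i' s \<le> d * (\<bar>i' s\<bar> + 1)"
      using d by (intro mult_left_mono) auto
    moreover have "d * (\<bar>i' s\<bar> + 1) = e" by (simp add: d_def)
    ultimately show "j' 0 \<le> j' s + e" by simp
  qed
  then show "j' t \<ge> j' 0" using t by blast
  have "j 0 - j' 0 * 0 \<le> j t - j' 0 * t"
  proof (rule DERIV_nonneg_imp_nondecreasing[OF t])
    fix x :: real assume "0 \<le> x"
    have "((\<lambda>t. j t - j' 0 * t) has_real_derivative j' x - j' 0) (at x)"
      by (auto intro!: derivative_eq_intros jacobiD[OF j])
    with j'[OF \<open>0 \<le> x\<close>] show "\<exists>y. ((\<lambda>t. j t - j' 0 * t) has_real_derivative y) (at x) \<and> 0 \<le> y"
      by fastforce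
  qed
  then show "j t \<ge> j 0 + j' 0 * t" by simp
qed

definition decaying_jacobi :: "(real \<Rightarrow> real) \<Rightarrow> (real \<Rightarrow> real) \<Rightarrow> (real \<Rightarrow> real) \<Rightarrow> bool" where
  "decaying_jacobi k j j' \<longleftrightarrow> jacobi k j j' \<and> j 0 = 1 \<and> (\<forall>t. j t > 0) \<and> (\<forall>t. j' t \<le> 0)"

text \<open>
  For the solutions \<open>A, B\<close> with initial values \<open>(1, 0)\<close> and \<open>(0, 1)\<close> the quotient \<open>A / B\<close> decreases, \<open>A' / B'\<close>
  increases, and their difference is \<open>1 / (B B') > 0\<close>. A number \<open>U\<close> between them makes \<open>A - U B\<close> positive and
  nonincreasing on the positive half line; on the negative half line this follows from convexity.
\<close>
lemma decaying_jacobi_exists: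
  assumes k: "jacobi_coeff K k"
  obtains j j' where "decaying_jacobi k j j'"
proof -
  have k0: "k t \<ge> 0" for t using k by (simp add: jacobi_coeff_def)
  obtain A A' where A: "jacobi k A A'" "A 0 = 1" "A' 0 = 0"
    using jacobi_exists[OF k, of 1 0] by blast
  obtain B B' where B: "jacobi k B B'" "B 0 = 0" "B' 0 = 1"
    using jacobi_exists[OF k, of 0 1] by blast
  note dA = jacobiD[OF A(1)] and dB = jacobiD[OF B(1)]
  have A1: "A t \<ge> 1" "A' t \<ge> 0" if "t \<ge> 0" for t
    using jacobi_growth[OF k A(1) _ _ that] A by auto
  have B1: "B t \<ge> t" "B' t \<ge> 1" if "t \<ge> 0" for t
    using jacobi_growth[OF k B(1) _ _ that] B by auto
  have wronskian: "A t * B' t - A' t * B t = 1" for t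
  proof -
    have "((\<lambda>t. A t * B' t - A' t * B t) has_real_derivative 0) (at x)" for x
      by (auto intro!: derivative_eq_intros dA dB simp: algebra_simps)
    then show ?thesis
      using DERIV_isconst_all[of "\<lambda>t. A t * B' t - A' t * B t" t 0] A B by simp
  qed
  define Q where "Q = (\<lambda>t. A t / B t)"
  have Q_less: "Q t < Q s" if "0 < s" "s < t" for s t
  proof (rule DERIV_neg_imp_decreasing[OF that(2)])
    fix x :: real assume x: "s \<le> x" "x \<le> t"
    then have "B x > 0" using B1(1)[of x] that by linarith
    then have "(Q has_real_derivative (A' x * B x - A x * B' x) / (B x * B x)) (at x)"
      unfolding Q_def by (auto intro!: derivative_eq_intros dA dB)
    moreover have "(A' x * B x - A x * B' x) / (B x * B x) < 0"
      using wronskian[of x] \<open>B x > 0\<close> by (intro divide_neg_pos) auto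
    ultimately show "\<exists>y. (Q has_real_derivative y) (at x) \<and> y < 0" by blast
  qed
  have P_le: "A' s / B' s \<le> A' t / B' t" if "0 \<le> s" "s \<le> t" for s t
  proof (rule DERIV_nonneg_imp_nondecreasing[OF that(2)])
    fix x :: real assume x: "s \<le> x" "x \<le> t"
    then have "B' x > 0" using B1(2)[of x] that by linarith
    then have "((\<lambda>x. A' x / B' x) has_real_derivative
        (k x * A x * B' x - A' x * (k x * B x)) / (B' x * B' x)) (at x)"
      by (auto intro!: derivative_eq_intros dA dB)
    moreover have "k x * A x * B' x - A' x * (k x * B x) = k x * (A x * B' x - A' x * B x)"
      by (simp add: algebra_simps)
    then have "(k x * A x * B' x - A' x * (k x * B x)) / (B' x * B' x) \<ge> 0"
      using wronskian[of x] k0[of x] by simp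
    ultimately show "\<exists>y. ((\<lambda>x. A' x / B' x) has_real_derivative y) (at x) \<and> 0 \<le> y" by blast
  qed
  have P_Q: "A' t / B' t \<le> Q t" if "t > 0" for t
  proof -
    have "B t > 0" "B' t > 0" using B1[of t] that by linarith+
    then show ?thesis using wronskian[of t] by (simp add: Q_def divide_simps mult.commute)
  qed
  define U where "U = Inf (Q ` {0<..})"
  have Pge: "A' t / B' t \<le> Q s" if "t \<ge> 0" "s > 0" for s t
  proof (cases "s \<le> t")
    case True
    then have "Q t \<le> Q s" using Q_less[of s t] that by (cases "s = t") auto
    with P_Q[of t] True that show ?thesis by linarith
  next
    case False
    with P_le[of t s] P_Q[of s] that show ?thesis by linarith
  qed
  have bdd: "bdd_below (Q ` {0<..})"
    using Pge[of 0] by (intro bdd_belowI[of _ "A' 0 / B' 0"]) auto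
  have U_ge: "A' t / B' t \<le> U" if "t \<ge> 0" for t
    unfolding U_def by (rule cInf_greatest) (use Pge that in auto)
  have U_le: "U < Q t" if "t > 0" for t
  proof -
    have "U \<le> Q (t + 1)" unfolding U_def by (rule cInf_lower[OF _ bdd]) (use that in auto)
    also have "\<dots> < Q t" by (rule Q_less) (use that in auto)
    finally show ?thesis .
  qed
  define j where "j = (\<lambda>t. 1 * A t + (- U) * B t)"
  define j' where "j' = (\<lambda>t. 1 * A' t + (- U) * B' t)"
  have j: "jacobi k j j'" unfolding j_def j'_def by (rule jacobi_lincomb[OF A(1) B(1)])
  have j0: "j 0 = 1" "j' 0 = - U" using A B by (simp_all add: j_def j'_def)
  have U0: "U \<ge> 0" using U_ge[of 0] A by simp
  have pos: "j t > 0 \<and> j' t \<le> 0" if "t \<ge> 0" for t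
  proof
    have "B' t > 0" using B1(2)[OF that] by linarith
    with U_ge[OF that] show "j' t \<le> 0" by (simp add: j'_def divide_simps mult.commute)
    show "j t > 0"
    proof (cases "t = 0")
      case False
      with that have "B t > 0" "t > 0" using B1(1)[OF that] by linarith+
      with U_le[of t] show ?thesis by (simp add: j_def Q_def divide_simps mult.commute)
    qed (simp add: j0)
  qed
  have neg: "j t > 0 \<and> j' t \<le> 0" if "t \<le> 0" for t
  proof -
    have "j (- (- t)) > 0 \<and> - j' (- (- t)) \<ge> - j' (- 0)"
      by (rule jacobi_pos_aux[OF _ jacobi_reflect[OF j]]) (use k0 j0 U0 that in auto)
    then show ?thesis using j0 U0 by simp
  qed
  have "decaying_jacobi k j j'"
    unfolding decaying_jacobi_def using pos neg j j0 linear by metis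
  with that show ?thesis by blast
qed

lemma decaying_jacobi_le_1:
  assumes "decaying_jacobi k j j'" "t \<ge> 0"
  shows "j t \<le> 1"
proof -
  have "j t \<le> j 0"
    using assms unfolding decaying_jacobi_def jacobi_def
    by (intro DERIV_nonpos_imp_nonincreasing[OF assms(2)]) blast
  then show ?thesis using assms by (simp add: decaying_jacobi_def)
qed

text \<open>
  Two such solutions are bounded on the positive half line, but their difference grows at least linearly if the
  slopes at \<open>0\<close> differ.
\<close>
lemma decaying_jacobi_slope_unique:
  assumes k: "jacobi_coeff K k" and i: "decaying_jacobi k i i'" and j: "decaying_jacobi k j j'"
  shows "i' 0 = j' 0"
proof -
  have le: "i' 0 \<le> j' 0" if i: "decaying_jacobi k i i'" and j: "decaying_jacobi k j j'" for i i' j j'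
  proof (rule ccontr)
    assume "\<not> i' 0 \<le> j' 0"
    define \<delta> where "\<delta> = i' 0 - j' 0"
    have \<delta>: "\<delta> > 0" using \<open>\<not> i' 0 \<le> j' 0\<close> by (simp add: \<delta>_def)
    have d: "jacobi k (\<lambda>t. 1 * i t + (-1) * j t) (\<lambda>t. 1 * i' t + (-1) * j' t)"
      using i j by (intro jacobi_lincomb) (auto simp: decaying_jacobi_def)
    have "i (2 / \<delta>) - j (2 / \<delta>) \<ge> \<delta> * (2 / \<delta>)"
      using jacobi_growth(2)[OF k d, of "2 / \<delta>"] i j \<delta> by (simp add: decaying_jacobi_def \<delta>_def)
    moreover have "i (2 / \<delta>) \<le> 1" "j (2 / \<delta>) > 0"
      using decaying_jacobi_le_1[OF i, of "2 / \<delta>"] j \<delta> by (auto simp: decaying_jacobi_def)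
    ultimately show False using \<delta> by simp
  qed
  show ?thesis using le[OF i j] le[OF j i] by linarith
qed

definition stable_slope :: "(real \<Rightarrow> real) \<Rightarrow> real" where
  "stable_slope k = (THE u. \<exists>j j'. decaying_jacobi k j j' \<and> u = - j' 0)"

lemma stable_slope_eq:
  assumes "jacobi_coeff K k" "decaying_jacobi k j j'"
  shows "stable_slope k = - j' 0"
  unfolding stable_slope_def
proof (rule the_equality)
  fix u assume "\<exists>i i'. decaying_jacobi k i i' \<and> u = - i' 0"
  then show "u = - j' 0" using decaying_jacobi_slope_unique[OF assms(1) _ assms(2)] by auto
qed (use assms in blast)

text \<open>
  The restriction of a decaying solution to a later half line is again decaying, after rescaling.
\<close>
lemma stable_slope_shift:
  assumes k: "jacobi_coeff K k" and j: "decaying_jacobi k j j'"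
  shows "stable_slope (\<lambda>t. k (t + s)) = - j' s / j s"
proof -
  have "decaying_jacobi (\<lambda>t. k (t + s)) (\<lambda>t. (1 / j s) * j (t + s)) (\<lambda>t. (1 / j s) * j' (t + s))"
    using j jacobi_shift[of k j j' s "1 / j s"] unfolding decaying_jacobi_def
    by (auto simp: less_imp_neq[symmetric] divide_le_0_iff less_imp_le)
  from stable_slope_eq[OF jacobi_coeff_shift[OF k] this] show ?thesis by simp
qed

text \<open>
  While \<open>j \<le> 1\<close> the second derivative of \<open>j\<close> is at most \<open>K\<close>, so \<open>j\<close> would reach zero within unit time if its slope at
  \<open>0\<close> were below \<open>- (1 + K)\<close>.
\<close>
lemma stable_slope_bounds:
  assumes k: "jacobi_coeff K k"
  shows "0 \<le> stable_slope k" "stable_slope k \<le> 1 + K"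
proof -
  obtain j j' where j: "decaying_jacobi k j j'" using decaying_jacobi_exists[OF k] by blast
  note J = j[unfolded decaying_jacobi_def]
  have dj: "(j has_real_derivative j' t) (at t)" "(j' has_real_derivative k t * j t) (at t)" for t
    using J by (auto intro: jacobiD)
  have "- j' 0 \<le> 1 + K"
  proof -
    have K: "K \<ge> 0" using k by (meson jacobi_coeff_def order_trans)
    have j': "j' s \<le> j' 0 + K" if s: "0 \<le> s" "s \<le> 1" for s
    proof -
      have "j' s - K * s \<le> j' 0 - K * 0"
      proof (rule DERIV_nonpos_imp_nonincreasing[OF s(1)])
        fix x :: real assume x: "0 \<le> x"
        have "((\<lambda>s. j' s - K * s) has_real_derivative k x * j x - K) (at x)"
          by (auto intro!: derivative_eq_intros dj)
        moreover have "k x * j x \<le> K * 1"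
        proof (rule mult_mono)
          show "0 \<le> j x" using J less_imp_le by blast
        qed (use k K decaying_jacobi_le_1[OF j x] in \<open>auto simp: jacobi_coeff_def\<close>)
        ultimately show "\<exists>y. ((\<lambda>s. j' s - K * s) has_real_derivative y) (at x) \<and> y \<le> 0" by fastforce
      qed
      moreover have "K * s \<le> K * 1" using K s by (intro mult_left_mono) auto
      ultimately show ?thesis by simp
    qed
    have "j 1 - (j' 0 + K) * 1 \<le> j 0 - (j' 0 + K) * 0"
    proof (rule DERIV_nonpos_imp_nonincreasing[where f = "\<lambda>s. j s - (j' 0 + K) * s"])
      fix x :: real assume "0 \<le> x" "x \<le> 1"
      moreover have "((\<lambda>s. j s - (j' 0 + K) * s) has_real_derivative j' x - (j' 0 + K)) (at x)"
        by (auto intro!: derivative_eq_intros dj)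
      ultimately show "\<exists>y. ((\<lambda>s. j s - (j' 0 + K) * s) has_real_derivative y) (at x) \<and> y \<le> 0"
        using j'[of x] by fastforce
    qed simp
    moreover have "j 0 = 1" "j 1 > 0" using J by auto
    ultimately show ?thesis by simp
  qed
  then show "0 \<le> stable_slope k" "stable_slope k \<le> 1 + K"
    using J stable_slope_eq[OF k j] by simp_all
qed

text \<open>
  The Wronskian \<open>i j' - i' j\<close> has derivative \<open>(l - k) i j\<close>. Its value at \<open>0\<close> is the difference of the slopes, and
  at time \<open>T\<close> it is at most \<open>2 / T\<close>: a convex function that decreases from \<open>1\<close> without becoming negative has slope
  at least \<open>- 1 / T\<close> there.
\<close>
lemma stable_slope_continuity:
  assumes k: "jacobi_coeff K k" and l: "jacobi_coeff K l" and T: "T > 0"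
    and close: "\<And>t. 0 \<le> t \<Longrightarrow> t \<le> T \<Longrightarrow> \<bar>k t - l t\<bar> \<le> e"
  shows "\<bar>stable_slope k - stable_slope l\<bar> \<le> 2 / T + T * e"
proof -
  obtain i i' where i: "decaying_jacobi k i i'" using decaying_jacobi_exists[OF k] by blast
  obtain j j' where j: "decaying_jacobi l j j'" using decaying_jacobi_exists[OF l] by blast
  have di: "(i has_real_derivative i' t) (at t)" "(i' has_real_derivative k t * i t) (at t)" for t
    using i by (auto intro: jacobiD simp: decaying_jacobi_def)
  have dj: "(j has_real_derivative j' t) (at t)" "(j' has_real_derivative l t * j t) (at t)" for t
    using j by (auto intro: jacobiD simp: decaying_jacobi_def)
  have end_bound: "\<bar>j' T\<bar> \<le> 1 / T" if k: "jacobi_coeff K k" and j: "decaying_jacobi k j j'" for k j j'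
  proof -
    note J = j[unfolded decaying_jacobi_def]
    have dj: "(j has_real_derivative j' t) (at t)" "(j' has_real_derivative k t * j t) (at t)" for t
      using J by (auto intro: jacobiD)
    obtain z where z: "0 < z" "z < T" "j T - j 0 = (T - 0) * j' z"
      using MVT2[OF T, of j j'] dj by blast
    have "j' z \<le> j' T"
    proof (rule DERIV_nonneg_imp_nondecreasing[of z T])
      show "\<exists>y. (j' has_real_derivative y) (at x) \<and> 0 \<le> y" for x
        using dj(2)[of x] J k by (meson jacobi_coeff_def less_imp_le mult_nonneg_nonneg)
    qed (use z in simp)
    then have "T * j' z \<le> T * j' T" using T by (intro mult_left_mono) auto
    moreover have "j T > 0" "j 0 = 1" "j' T \<le> 0" using J by auto
    moreover have "T * j' z = j T - j 0" using z(3) by simp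
    ultimately have "- (T * j' T) \<le> 1" by linarith
    with T \<open>j' T \<le> 0\<close> show ?thesis by (simp add: field_simps)
  qed
  define w where "w = (\<lambda>t. i t * j' t - i' t * j t)"
  have dw: "(w has_real_derivative (l t - k t) * (i t * j t)) (at t)" for t
    unfolding w_def by (auto intro!: derivative_eq_intros di dj simp: algebra_simps)
  have 01: "0 < i t" "i t \<le> 1" "0 < j t" "j t \<le> 1" if "t \<ge> 0" for t
    using decaying_jacobi_le_1[OF i that] decaying_jacobi_le_1[OF j that] i j
    by (auto simp: decaying_jacobi_def)
  obtain z where z: "0 < z" "z < T" "w T - w 0 = (T - 0) * ((l z - k z) * (i z * j z))"
    using MVT2[OF T, of w "\<lambda>t. (l t - k t) * (i t * j t)"] dw by blast
  have "\<bar>(l z - k z) * (i z * j z)\<bar> \<le> e * (1 * 1)"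
    unfolding abs_mult using close[of z] 01[of z] z by (intro mult_mono) auto
  then have "\<bar>w T - w 0\<bar> \<le> T * e" using T z by (simp add: abs_mult)
  moreover have "\<bar>w T\<bar> \<le> 2 / T"
  proof -
    have "\<bar>i T * j' T\<bar> \<le> 1 * (1 / T)" "\<bar>i' T * j T\<bar> \<le> (1 / T) * 1"
      unfolding abs_mult using end_bound[OF k i] end_bound[OF l j] 01[of T] T by (intro mult_mono; simp)+
    then show ?thesis unfolding w_def by linarith
  qed
  moreover have "w 0 = stable_slope k - stable_slope l"
    using i j stable_slope_eq[OF k i] stable_slope_eq[OF l j]
    by (simp add: w_def decaying_jacobi_def)
  ultimately show ?thesis by linarith
qed

text \<open>
  The slope \<open>U = - j' / j\<close> solves \<open>U' = U\<^sup>2 - k\<close> and lies between \<open>0\<close> and \<open>1 + K\<close>. Hence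
  \<open>(ln j)' = - U \<le> - U\<^sup>2 / (1 + K) = - (U' + k) / (1 + K)\<close>, and the lower bound on \<open>k\<close> makes the right side the
  derivative of a bounded function minus a positive constant.
\<close>
lemma decaying_jacobi_exponential:
  assumes k: "jacobi_coeff K k" and j: "decaying_jacobi k j j'"
    and \<beta>: "\<And>t. (\<beta> has_real_derivative \<beta>' t) (at t)" "\<And>t. \<bar>\<beta> t\<bar> \<le> b"
    and lower: "\<And>t. c + \<beta>' t \<le> k t" and t: "t \<ge> 0"
  shows "j t \<le> exp (1 + 2 * b / (1 + K)) * exp (- (c / (1 + K)) * t)"
proof -
  define M where "M = 1 + K"
  have M: "M > 0" using k unfolding jacobi_coeff_def M_def
    by (metis add.commute add_pos_nonneg order_trans zero_less_one)
  note J = j[unfolded decaying_jacobi_def]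
  have dj: "(j has_real_derivative j' t) (at t)" "(j' has_real_derivative k t * j t) (at t)" for t
    using J by (auto intro: jacobiD)
  define U where "U = (\<lambda>t. - j' t / j t)"
  have U: "0 \<le> U s" "U s \<le> M" for s
    using stable_slope_bounds[OF jacobi_coeff_shift[OF k, of s]] stable_slope_shift[OF k j, of s]
    by (simp_all add: U_def M_def)
  have pos: "j s > 0" "j s \<noteq> 0" for s using J by (auto simp: less_imp_neq[symmetric])
  define \<Lambda> where "\<Lambda> = (\<lambda>s. ln (j s) + (U s + c * s + \<beta> s) / M)"
  have "\<Lambda> t \<le> \<Lambda> 0"
  proof (rule DERIV_nonpos_imp_nonincreasing[OF t])
    fix s :: real
    have dU: "(U has_real_derivative (U s)\<^sup>2 - k s) (at s)"
      unfolding U_def using pos[of s]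
      by (auto intro!: derivative_eq_intros dj simp: power2_eq_square field_simps)
    have dln: "((\<lambda>s. ln (j s)) has_real_derivative - U s) (at s)"
      using pos[of s] unfolding U_def by (auto intro!: derivative_eq_intros dj)
    then have "(\<Lambda> has_real_derivative - U s + ((U s)\<^sup>2 - k s + c + \<beta>' s) / M) (at s)"
      unfolding \<Lambda>_def using M
      by (intro DERIV_add[OF dln] DERIV_cdivide) (auto intro!: derivative_eq_intros dU \<beta>)
    moreover have "((U s)\<^sup>2 - k s + c + \<beta>' s) / M \<le> U s"
    proof -
      have "(U s)\<^sup>2 \<le> U s * M" unfolding power2_eq_square using U[of s] by (intro mult_left_mono) auto
      with lower[of s] M show ?thesis by (simp add: divide_simps)
    qed
    ultimately show "\<exists>y. (\<Lambda> has_real_derivative y) (at s) \<and> y \<le> 0" by fastforce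
  qed
  then have "ln (j t) \<le> (U 0 + \<beta> 0) / M - (U t + c * t + \<beta> t) / M"
    using J by (simp add: \<Lambda>_def)
  also have "\<dots> = (U 0 - U t + \<beta> 0 - \<beta> t) / M - c / M * t"
    by (simp add: diff_divide_distrib add_divide_distrib)
  also have "\<dots> \<le> (M + 2 * b) / M - c / M * t"
    using U[of 0] U[of t] \<beta>(2)[of 0] \<beta>(2)[of t] M by (intro diff_right_mono divide_right_mono) auto
  also have "\<dots> = (1 + 2 * b / M) + (- (c / M) * t)" using M by (simp add: field_simps)
  finally have "exp (ln (j t)) \<le> exp ((1 + 2 * b / M) + (- (c / M) * t))" by simp
  then show ?thesis using pos unfolding exp_add by (simp add: M_def)
qed

text \<open>
  A convex solution with slope \<open>0\<close> at \<open>0\<close> never falls below \<open>1\<close>, against exponential decay.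
\<close>
lemma stable_slope_pos:
  assumes k: "jacobi_coeff K k"
    and \<beta>: "\<And>t. (\<beta> has_real_derivative \<beta>' t) (at t)" "\<And>t. \<bar>\<beta> t\<bar> \<le> b"
    and lower: "\<And>t. c + \<beta>' t \<le> k t" and c: "c > 0"
  shows "stable_slope k > 0"
proof (rule ccontr)
  assume "\<not> stable_slope k > 0"
  then have 0: "stable_slope k = 0" using stable_slope_bounds(1)[OF k] by simp
  obtain j j' where j: "decaying_jacobi k j j'" using decaying_jacobi_exists[OF k] by blast
  have j0: "j' 0 = 0" "j 0 = 1" "jacobi k j j'"
    using 0 stable_slope_eq[OF k j] j by (auto simp: decaying_jacobi_def)
  have ge: "j t \<ge> 1" if "t \<ge> 0" for t
    using jacobi_growth(2)[OF k j0(3) _ _ that] j0 by simp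
  have K: "1 + K > 0" using k unfolding jacobi_coeff_def
    by (metis add.commute add_pos_nonneg order_trans zero_less_one)
  \<comment> \<open>At this time the exponential bound equals \<open>exp (-1)\<close>.\<close>
  define t where "t = (2 + 2 * b / (1 + K)) / (c / (1 + K))"
  have b: "b \<ge> 0" using \<beta>(2)[of 0] by linarith
  have t: "t \<ge> 0" using b c K by (simp add: t_def)
  have "1 \<le> exp (1 + 2 * b / (1 + K)) * exp (- (c / (1 + K)) * t)"
    using ge[OF t] decaying_jacobi_exponential[OF k j \<beta> lower t] by simp
  also have "(c / (1 + K)) * t = 2 + 2 * b / (1 + K)" unfolding t_def using c K by simp
  then have "exp (1 + 2 * b / (1 + K)) * exp (- (c / (1 + K)) * t) = exp (-1)"
    by (simp flip: exp_add)
  finally show False by simp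
qed

section \<open>The geodesic equation in an orthonormal frame\<close>

text \<open>
  A phase \<open>((x, y), (s, w))\<close> is a tangent vector of \<open>\<real> \<times> \<real>\<^sup>n\<close> at \<open>(x, y)\<close>, with coefficients \<open>(s, w)\<close> in the
  orthonormal frame \<open>\<partial>\<^sub>x, f\<^sup>-\<^sup>1 \<partial>\<^sub>y\<close>. The Riemannian norm is then the product norm, and the unit vectors form a set
  that does not depend on \<open>x\<close>.
\<close>
type_synonym 'n phase = "(real \<times> (real ^ 'n)) \<times> (real \<times> (real ^ 'n))"
type_synonym 'n tangent = "(real \<times> (complex ^ 'n)) \<times> (real \<times> (complex ^ 'n))"

abbreviation px :: "('a \<times> 'b) \<times> 'c \<Rightarrow> 'a" where "px p \<equiv> fst (fst p)"
abbreviation py :: "('a \<times> 'b) \<times> 'c \<Rightarrow> 'b" where "py p \<equiv> snd (fst p)"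
abbreviation ps :: "'a \<times> ('b \<times> 'c) \<Rightarrow> 'b" where "ps p \<equiv> fst (snd p)"
abbreviation pw :: "'a \<times> ('b \<times> 'c) \<Rightarrow> 'c" where "pw p \<equiv> snd (snd p)"

text \<open>
  The functions \<open>g1\<close> and \<open>g2\<close> are the first two derivatives of \<open>g\<close>, and \<open>g2 + g1\<^sup>2\<close> is \<open>f'' / f\<close> for \<open>f = exp g\<close>.
\<close>
locale warping =
  fixes g g1 g2 :: "real \<Rightarrow> real" and H c0 c1 :: real
  assumes g: "\<And>x. (g has_real_derivative g1 x) (at x)"
    and g1: "\<And>x. (g1 has_real_derivative g2 x) (at x)"
    and g2_cont: "continuous_on UNIV g2"
    and h_bounds: "\<And>x. 0 \<le> g2 x + (g1 x)\<^sup>2" "\<And>x. g2 x + (g1 x)\<^sup>2 \<le> H"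
    and c0: "0 < c0" and g1_bounds: "\<And>x. c0 \<le> g1 x" "\<And>x. g1 x \<le> c1"
begin

definition geodesic_field :: "'n::finite phase \<Rightarrow> 'n phase" where
  "geodesic_field q = ((ps q, exp (- g (px q)) *\<^sub>R pw q),
     (g1 (px q) * (pw q \<bullet> pw q),
      - (g1 (px q) * ps q) *\<^sub>R pw q))"

definition d_geodesic_field :: "'n::finite phase \<Rightarrow> 'n phase \<Rightarrow> 'n phase" where
  "d_geodesic_field q \<xi> = ((ps \<xi>,
      exp (- g (px q)) *\<^sub>R (pw \<xi> - (g1 (px q) * px \<xi>) *\<^sub>R pw q)),
     (g2 (px q) * px \<xi> * (pw q \<bullet> pw q)
        + 2 * g1 (px q) * (pw q \<bullet> pw \<xi>),
      - (g2 (px q) * px \<xi> * ps q + g1 (px q) * ps \<xi>) *\<^sub>R pw q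
        - (g1 (px q) * ps q) *\<^sub>R pw \<xi>))"

lemma g_cont: "continuous_on A g" and g1_cont: "continuous_on A g1"
  using g g1 by (meson DERIV_isCont continuous_at_imp_continuous_on)+

lemma g_has_derivative_comp:
  assumes "(f has_derivative f') (at q within S)"
  shows "((\<lambda>q. g (f q)) has_derivative (\<lambda>\<xi>. g1 (f q) * f' \<xi>)) (at q within S)"
  using has_derivative_compose[OF assms g[unfolded has_field_derivative_def]] .

lemma g1_has_derivative_comp:
  assumes "(f has_derivative f') (at q within S)"
  shows "((\<lambda>q. g1 (f q)) has_derivative (\<lambda>\<xi>. g2 (f q) * f' \<xi>)) (at q within S)"
  using has_derivative_compose[OF assms g1[unfolded has_field_derivative_def]] .

lemma geodesic_field_has_derivative: "(geodesic_field has_derivative d_geodesic_field q) (at q)"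
  unfolding geodesic_field_def
  by (rule has_derivative_eq_rhs)
     (rule derivative_intros g_has_derivative_comp g1_has_derivative_comp
       bounded_linear_imp_has_derivative bounded_linear_fst bounded_linear_snd |
      simp add: d_geodesic_field_def fun_eq_iff algebra_simps inner_commute)+

definition geodesic_field_blinfun :: "'n::finite phase \<Rightarrow> 'n phase \<Rightarrow>\<^sub>L 'n phase" where
  "geodesic_field_blinfun q = Blinfun (d_geodesic_field q)"

lemma geodesic_field_blinfun_apply: "blinfun_apply (geodesic_field_blinfun q) = d_geodesic_field q"
  unfolding geodesic_field_blinfun_def
  by (rule bounded_linear_Blinfun_apply[OF has_derivative_bounded_linear[OF geodesic_field_has_derivative]])

lemma C1_geodesic_field: "C1_field geodesic_field geodesic_field_blinfun"
  unfolding C1_field_def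
proof (intro conjI allI)
  show "continuous_on UNIV (geodesic_field_blinfun :: 'a phase \<Rightarrow> _)"
  proof (rule continuous_on_blinfun_componentwise)
    show "continuous_on UNIV (\<lambda>q. geodesic_field_blinfun q i)" for i :: "'a phase"
      unfolding geodesic_field_blinfun_apply d_geodesic_field_def
      by (intro continuous_intros continuous_on_compose2[OF g_cont[of UNIV]]
          continuous_on_compose2[OF g1_cont[of UNIV]] continuous_on_compose2[OF g2_cont]) auto
  qed
qed (simp add: geodesic_field_blinfun_apply geodesic_field_has_derivative)

definition unit_phase :: "'n::finite phase set" where
  "unit_phase = {q. norm (snd q) = 1}"

lemma unit_phase_iff: "q \<in> unit_phase \<longleftrightarrow> (ps q)\<^sup>2 + pw q \<bullet> pw q = 1"
proof -
  have "norm (snd q) = 1 \<longleftrightarrow> snd q \<bullet> snd q = 1"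
    by (simp add: norm_eq_1)
  then show ?thesis
    by (simp add: unit_phase_def inner_prod_def power2_eq_square)
qed

lemma phase_components:
  assumes "(u has_vector_derivative u') F"
  shows "((\<lambda>t. px (u t)) has_vector_derivative px u') F"
    "((\<lambda>t. py (u t)) has_vector_derivative py u') F"
    "((\<lambda>t. ps (u t)) has_vector_derivative ps u') F"
    "((\<lambda>t. pw (u t)) has_vector_derivative pw u') F"
  using assms
  by (auto intro!: bounded_linear.has_vector_derivative[of "\<lambda>q. px q"]
      bounded_linear.has_vector_derivative[of "\<lambda>q. py q"]
      bounded_linear.has_vector_derivative[of "\<lambda>q. ps q"]
      bounded_linear.has_vector_derivative[of "\<lambda>q. pw q"]
      bounded_linear_compose[of fst fst] bounded_linear_compose[of fst snd]
      bounded_linear_compose[of snd fst] bounded_linear_compose[of snd snd]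
      bounded_linear_fst bounded_linear_snd)

lemma curve_components:
  assumes "integral_curve geodesic_field u"
  shows "((\<lambda>t. px (u t)) has_real_derivative ps (u t)) (at t)"
    "((\<lambda>t. py (u t)) has_vector_derivative exp (- g (px (u t))) *\<^sub>R pw (u t)) (at t)"
    "((\<lambda>t. ps (u t)) has_real_derivative
       g1 (px (u t)) * (pw (u t) \<bullet> pw (u t))) (at t)"
    "((\<lambda>t. pw (u t)) has_vector_derivative
       - (g1 (px (u t)) * ps (u t)) *\<^sub>R pw (u t)) (at t)"
  using phase_components[OF assms[unfolded integral_curve_def, rule_format, of t]]
  by (auto simp: has_real_derivative_iff_has_vector_derivative geodesic_field_def)

lemma integral_curve_unit:
  assumes u: "integral_curve geodesic_field u" and 0: "u 0 \<in> unit_phase"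
  shows "u t \<in> unit_phase"
proof -
  let ?E = "\<lambda>t. (ps (u t))\<^sup>2 + pw (u t) \<bullet> pw (u t)"
  have "(?E has_real_derivative 0) (at t)" for t
    by (rule derivative_eq_intros inner_has_real_derivative curve_components[OF u] refl)+
       (simp add: algebra_simps power2_eq_square)
  then have "?E t = ?E 0" by (rule DERIV_isconst_all[rule_format])
  with 0 show ?thesis by (simp add: unit_phase_iff)
qed

text \<open>
  This is the geodesic equation for \<open>x\<close> and the angle \<open>\<phi>\<close> with \<open>s = sin \<phi>\<close>. In contrast to the equation in \<open>(x, s)\<close> it
  is globally Lipschitz, since \<open>g2\<close> is bounded.
\<close>
lemma angle_flow_exists:
  "\<exists>x \<phi> :: real \<Rightarrow> real. x 0 = x0 \<and> \<phi> 0 = \<phi>0 \<and>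
    (\<forall>t. (x has_real_derivative sin (\<phi> t)) (at t) \<and>
         (\<phi> has_real_derivative g1 (x t) * cos (\<phi> t)) (at t))"
proof -
  define F :: "real \<Rightarrow> real \<times> real \<Rightarrow> real \<times> real"
    where "F = (\<lambda>t z. (sin (snd z), g1 (fst z) * cos (snd z)))"
  have c1: "c1 > 0" using g1_bounds[of 0] c0 by linarith
  have H0: "H \<ge> 0" using h_bounds[of 0] by linarith
  have g2_bound: "\<bar>g2 x\<bar> \<le> H + c1\<^sup>2" for x
  proof -
    have "(g1 x)\<^sup>2 \<le> c1\<^sup>2" using g1_bounds[of x] c0 by (intro power_mono) auto
    moreover have "(g1 x)\<^sup>2 \<ge> 0" by simp
    ultimately show ?thesis unfolding abs_le_iff using h_bounds[of x] H0 by linarith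
  qed
  have "\<exists>u. u 0 = (x0, \<phi>0) \<and> (\<forall>t. (u has_vector_derivative F t (u t)) (at t))"
  proof (rule picard_lindeloef)
    have "continuous_on UNIV (\<lambda>p. F (fst p) (snd p))" unfolding F_def
      by (intro continuous_intros continuous_on_compose2[OF g1_cont[of UNIV]]) auto
    then show "continuous_on UNIV (\<lambda>(t, x). F t x)" by (simp add: case_prod_unfold)
    show "norm (F t a - F t b) \<le> (1 + (H + c1\<^sup>2) + c1) * norm (a - b)" for t a b
    proof -
      have "\<bar>sin (snd a) - sin (snd b)\<bar> \<le> 1 * \<bar>snd a - snd b\<bar>"
        by (rule real_lipschitz) (auto intro!: derivative_eq_intros)
      moreover have "\<bar>cos (snd a) - cos (snd b)\<bar> \<le> 1 * \<bar>snd a - snd b\<bar>"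
        by (rule real_lipschitz[where f' = "\<lambda>x. - sin x"]) (auto intro!: derivative_eq_intros)
      moreover have "\<bar>g1 (fst a) - g1 (fst b)\<bar> \<le> (H + c1\<^sup>2) * \<bar>fst a - fst b\<bar>"
        by (rule real_lipschitz[OF g1 g2_bound])
      moreover have "\<bar>fst a - fst b\<bar> \<le> norm (a - b)" "\<bar>snd a - snd b\<bar> \<le> norm (a - b)"
        using norm_fst_snd[of "a - b"] by simp_all
      moreover have "\<bar>g1 (fst a) * cos (snd a) - g1 (fst b) * cos (snd b)\<bar>
          \<le> \<bar>(g1 (fst a) - g1 (fst b)) * cos (snd a)\<bar> + \<bar>g1 (fst b) * (cos (snd a) - cos (snd b))\<bar>"
        using abs_triangle_ineq[of "(g1 (fst a) - g1 (fst b)) * cos (snd a)"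
            "g1 (fst b) * (cos (snd a) - cos (snd b))"]
        by (simp add: algebra_simps)
      moreover have "\<bar>(g1 (fst a) - g1 (fst b)) * cos (snd a)\<bar> \<le> ((H + c1\<^sup>2) * norm (a - b)) * 1"
        unfolding abs_mult
      proof (rule mult_mono)
        have "(H + c1\<^sup>2) * \<bar>fst a - fst b\<bar> \<le> (H + c1\<^sup>2) * norm (a - b)"
          using H0 calculation by (intro mult_left_mono) auto
        then show "\<bar>g1 (fst a) - g1 (fst b)\<bar> \<le> (H + c1\<^sup>2) * norm (a - b)"
          using calculation by linarith
      qed (use H0 in auto)
      moreover have "\<bar>g1 (fst b) * (cos (snd a) - cos (snd b))\<bar> \<le> c1 * norm (a - b)"
        unfolding abs_mult
        by (rule mult_mono) (use g1_bounds[of "fst b"] c0 calculation in linarith)+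
      moreover have "norm (F t a - F t b) \<le> \<bar>sin (snd a) - sin (snd b)\<bar>
          + \<bar>g1 (fst a) * cos (snd a) - g1 (fst b) * cos (snd b)\<bar>"
        unfolding F_def using norm_Pair_le by (metis diff_Pair real_norm_def)
      ultimately show ?thesis unfolding distrib_right by linarith
    qed
  qed
  then obtain u where u: "u 0 = (x0, \<phi>0)" "\<And>t. (u has_vector_derivative F t (u t)) (at t)" by blast
  have "((\<lambda>t. fst (u t)) has_vector_derivative fst (F t (u t))) (at t)"
    "((\<lambda>t. snd (u t)) has_vector_derivative snd (F t (u t))) (at t)" for t
    using bounded_linear.has_vector_derivative[OF bounded_linear_fst u(2)]
      bounded_linear.has_vector_derivative[OF bounded_linear_snd u(2)] by auto
  with u(1) show ?thesis
    by (intro exI[of _ "\<lambda>t. fst (u t)"] exI[of _ "\<lambda>t. snd (u t)"])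
       (simp add: has_real_derivative_iff_has_vector_derivative F_def)
qed

text \<open>
  The quantity \<open>f w\<close> is conserved (Clairaut's relation), so \<open>w\<close> is given by \<open>x\<close>, and \<open>y\<close> by an integral.
\<close>
lemma orbit_exists:
  fixes q :: "'n::finite phase"
  assumes q: "q \<in> unit_phase"
  shows "\<exists>u. u 0 = q \<and> integral_curve geodesic_field u"
proof -
  obtain x0 Y0 s0 w0 where q_eq: "q = ((x0, Y0), (s0, w0))" by (metis prod.exhaust)
  have sw: "s0\<^sup>2 + w0 \<bullet> w0 = 1" using q by (simp add: unit_phase_iff q_eq)
  then have "s0\<^sup>2 \<le> 1" using inner_ge_zero[of w0] by linarith
  then have s0: "- 1 \<le> s0" "s0 \<le> 1" by (auto simp: abs_square_le_1 abs_le_iff)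
  obtain x \<phi> where 0: "x 0 = x0" "\<phi> 0 = arcsin s0"
    and dx: "\<And>t. (x has_real_derivative sin (\<phi> t)) (at t)"
    and d\<phi>: "\<And>t. (\<phi> has_real_derivative g1 (x t) * cos (\<phi> t)) (at t)"
    using angle_flow_exists by metis
  have dgx: "((\<lambda>t. g (x t)) has_real_derivative g1 (x t) * sin (\<phi> t)) (at t)" for t
    using DERIV_chain2[OF g dx] .
  define E where "E = (\<lambda>t. exp (g x0 - g (x t)))"
  have dE: "(E has_real_derivative - (g1 (x t) * sin (\<phi> t)) * E t) (at t)" for t
    unfolding E_def by (auto intro!: derivative_eq_intros dgx)
  have cosE: "cos (\<phi> t) = E t * cos (\<phi> 0)" for t
  proof -
    have "((\<lambda>t. cos (\<phi> t) * exp (g (x t))) has_real_derivative 0) (at t)" for t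
      by (auto intro!: derivative_eq_intros dgx d\<phi> simp: algebra_simps)
    then have "cos (\<phi> t) * exp (g (x t)) = cos (\<phi> 0) * exp (g (x 0))"
      by (rule DERIV_isconst_all[rule_format])
    then show ?thesis by (simp add: E_def 0 exp_diff field_simps)
  qed
  have w2: "(E t *\<^sub>R w0) \<bullet> (E t *\<^sub>R w0) = (cos (\<phi> t))\<^sup>2" for t
  proof -
    have "(cos (\<phi> 0))\<^sup>2 = w0 \<bullet> w0"
      using sw s0 sin_squared_eq[of "\<phi> 0"] by (simp add: 0)
    then show ?thesis by (simp add: cosE[of t] power_mult_distrib power2_eq_square)
  qed
  have "continuous_on UNIV (\<lambda>t. exp (- g (x t)) *\<^sub>R (E t *\<^sub>R w0))"
    using DERIV_isCont[OF dgx] DERIV_isCont[OF dE]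
    by (intro continuous_intros continuous_at_imp_continuous_on) auto
  from antiderivative_exists[OF this] obtain G where G: "G 0 = 0"
    "\<And>t. (G has_vector_derivative exp (- g (x t)) *\<^sub>R (E t *\<^sub>R w0)) (at t)" by blast
  define u where "u = (\<lambda>t. ((x t, Y0 + G t), (sin (\<phi> t), E t *\<^sub>R w0)))"
  have "u 0 = q" using s0 by (simp add: u_def q_eq G 0 E_def)
  moreover have "integral_curve geodesic_field u"
    unfolding integral_curve_def
  proof
    fix t
    have "(u has_vector_derivative ((sin (\<phi> t), exp (- g (x t)) *\<^sub>R (E t *\<^sub>R w0)),
        (cos (\<phi> t) * (g1 (x t) * cos (\<phi> t)), (- (g1 (x t) * sin (\<phi> t)) * E t) *\<^sub>R w0))) (at t)"
      unfolding u_def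
    proof (intro has_vector_derivative_Pair)
      show "(x has_vector_derivative sin (\<phi> t)) (at t)"
        using dx by (simp add: has_real_derivative_iff_has_vector_derivative)
      show "((\<lambda>t. sin (\<phi> t)) has_vector_derivative cos (\<phi> t) * (g1 (x t) * cos (\<phi> t))) (at t)"
        unfolding has_real_derivative_iff_has_vector_derivative[symmetric]
        by (auto intro!: derivative_eq_intros d\<phi>)
      show "((\<lambda>t. Y0 + G t) has_vector_derivative exp (- g (x t)) *\<^sub>R (E t *\<^sub>R w0)) (at t)"
        by (auto intro!: derivative_eq_intros G)
      show "((\<lambda>t. E t *\<^sub>R w0) has_vector_derivative (- (g1 (x t) * sin (\<phi> t)) * E t) *\<^sub>R w0) (at t)"
        using has_vector_derivative_scaleR[OF dE has_vector_derivative_const[of w0]] by simp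
    qed
    then show "(u has_vector_derivative geodesic_field (u t)) (at t)"
      using w2[of t] by (simp add: geodesic_field_def u_def power2_eq_square mult.left_commute)
  qed
  ultimately show ?thesis by blast
qed

definition orbit :: "'n::finite phase \<Rightarrow> real \<Rightarrow> 'n phase" where
  "orbit q = (SOME u. u 0 = q \<and> integral_curve geodesic_field u)"

lemma orbit:
  assumes "q \<in> unit_phase"
  shows "orbit q 0 = q" "integral_curve geodesic_field (orbit q)" "orbit q t \<in> unit_phase"
proof -
  show "orbit q 0 = q" "integral_curve geodesic_field (orbit q)"
    using someI_ex[OF orbit_exists[OF assms]] by (simp_all add: orbit_def)
  with assms show "orbit q t \<in> unit_phase" by (simp add: integral_curve_unit)
qed

lemma orbit_unique:
  assumes "integral_curve geodesic_field u" "u 0 \<in> unit_phase"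
  shows "u = orbit (u 0)"
  by (rule integral_curve_unique[OF C1_geodesic_field assms(1)]) (simp_all add: orbit assms)

lemma integral_curve_shift: "integral_curve geodesic_field u \<Longrightarrow> integral_curve geodesic_field (\<lambda>t. u (t + s))"
  unfolding integral_curve_def
proof
  fix t assume u: "\<forall>t. (u has_vector_derivative geodesic_field (u t)) (at t)"
  have "(u \<circ> (\<lambda>t. t + s) has_vector_derivative 1 *\<^sub>R geodesic_field (u (t + s))) (at t)"
    by (rule vector_diff_chain_at) (use u in \<open>auto intro!: derivative_eq_intros\<close>)
  then show "((\<lambda>t. u (t + s)) has_vector_derivative geodesic_field (u (t + s))) (at t)" by (simp add: o_def)
qed

lemma orbit_add:
  assumes "q \<in> unit_phase"
  shows "orbit (orbit q s) t = orbit q (t + s)"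
  using orbit_unique[OF integral_curve_shift[OF orbit(2)[OF assms], of s]] orbit(3)[OF assms]
  by (metis add_0)

text \<open>
  The speed is \<open>1\<close>, so \<open>x\<close> stays in a bounded interval for bounded times; \<open>g\<close> is increasing, so \<open>1 / f\<close> is at most its
  value at the left end of that interval.
\<close>
lemma orbit_stays:
  fixes q0 :: "'n::finite phase"
  obtains K :: "'n phase set" where "compact K" "convex K"
    "\<And>q t. q \<in> unit_phase \<Longrightarrow> norm (q - q0) < 1 \<Longrightarrow> \<bar>t\<bar> \<le> R \<Longrightarrow> orbit q t \<in> K"
proof -
  define x0 where "x0 = px q0"
  define B where "B = exp (- g (x0 - 1 - R))"
  define K :: "'n phase set" where
    "K = ({x0 - 1 - R..x0 + 1 + R} \<times> cball (py q0) (1 + B * R)) \<times> cball 0 1"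
  have "compact K" "convex K"
    unfolding K_def by (auto intro!: compact_Times convex_Times)
  moreover have "orbit q t \<in> K" if q: "q \<in> unit_phase" "norm (q - q0) < 1" and t: "\<bar>t\<bar> \<le> R" for q t
  proof -
    note u = orbit(2)[OF q(1)] and v = orbit(3)[OF q(1)] and 0 = orbit(1)[OF q(1)]
    note d = curve_components[OF u]
    have s1: "norm (ps (orbit q t)) \<le> 1" "norm (pw (orbit q t)) \<le> 1" for t
      using v[of t] norm_fst_snd[of "snd (orbit q t)"] unfolding unit_phase_def by auto
    have d0: "norm (px q - x0) \<le> 1" "norm (py q - py q0) \<le> 1"
    proof -
      have "norm (fst (q - q0)) < 1"
        using q(2) norm_fst_snd(1)[of "q - q0"] by simp
      then show "norm (px q - x0) \<le> 1" "norm (py q - py q0) \<le> 1"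
        using norm_fst_snd[of "fst (q - q0)"] by (simp_all add: x0_def)
    qed
    have x_move: "\<bar>px (orbit q t) - px q\<bar> \<le> \<bar>t\<bar>" for t
    proof -
      have "norm (px (orbit q t) - px q) \<le> 1 * \<bar>t\<bar> ^ Suc 0 / real (Suc 0)"
        by (rule norm_growth[where R = "\<bar>t\<bar>" and f = "\<lambda>t. ps (orbit q t)"])
           (use s1 d(1) in \<open>auto simp: 0 has_real_derivative_iff_has_vector_derivative[symmetric]
              intro!: derivative_eq_intros\<close>)
      then show ?thesis by simp
    qed
    have x_in: "px (orbit q t) \<in> {x0 - 1 - R..x0 + 1 + R}" if "\<bar>t\<bar> \<le> R" for t
      using x_move[of t] d0(1) that by (auto simp: abs_le_iff)
    have expB: "exp (- g (px (orbit q t))) \<le> B" if "\<bar>t\<bar> \<le> R" for t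
    proof -
      have "g (x0 - 1 - R) \<le> g (px (orbit q t))"
        by (rule DERIV_nonneg_imp_nondecreasing)
           (use x_in[OF that] g g1_bounds(1) c0 in \<open>auto, meson less_imp_le order_trans\<close>)
      then show ?thesis by (simp add: B_def)
    qed
    have "norm (py (orbit q t) - py q) \<le> B * \<bar>t\<bar> ^ Suc 0 / real (Suc 0)"
    proof (rule norm_growth[OF _ _ _ t])
      show "((\<lambda>t. py (orbit q t) - py q) has_vector_derivative
          exp (- g (px (orbit q t))) *\<^sub>R pw (orbit q t)) (at t)" for t
        using d(2)[of t] by (auto intro!: derivative_eq_intros)
      show "norm (exp (- g (px (orbit q t))) *\<^sub>R pw (orbit q t)) \<le> B * \<bar>t\<bar> ^ 0"
        if "\<bar>t\<bar> \<le> R" for t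
        using mult_mono[OF expB[OF that] s1(2)[of t]] by (simp add: B_def)
    qed (simp add: 0)
    moreover have "B * \<bar>t\<bar> \<le> B * R" using t by (intro mult_left_mono) (auto simp: B_def)
    ultimately have "norm (py (orbit q t) - py q0) \<le> 1 + B * R"
      using d0(2) norm_triangle_ineq[of "py (orbit q t) - py q" "py q - py q0"]
      by simp
    then show ?thesis
      using x_in[OF t] v[of t]
      by (auto simp: K_def mem_Times_iff dist_norm norm_minus_commute unit_phase_def)
  qed
  ultimately show ?thesis using that by blast
qed

lemma orbit_differentiable:
  assumes q: "q \<in> unit_phase"
  shows "\<exists>D. ((\<lambda>a. orbit a t) has_derivative D) (at q within unit_phase) \<and>
    (\<forall>\<delta>. (\<forall>\<tau>. (\<delta> has_vector_derivative d_geodesic_field (orbit q \<tau>) (\<delta> \<tau>)) (at \<tau>)) \<longrightarrow> D (\<delta> 0) = \<delta> t)"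
proof -
  obtain K where K: "compact K" "convex K" "\<And>a \<tau>. a \<in> unit_phase \<Longrightarrow> norm (a - q) < 1 \<Longrightarrow>
      \<bar>\<tau>\<bar> \<le> \<bar>t\<bar> \<Longrightarrow> orbit a \<tau> \<in> K"
    using orbit_stays[of q "\<bar>t\<bar>"] by blast
  show ?thesis
    using flow_differentiable[OF C1_geodesic_field K(1,2) zero_less_one orbit(2,1) K(3) q order_refl]
    by (simp add: geodesic_field_blinfun_apply)
qed

lemma stable_slope_continuous:
  fixes \<kappa> :: "'n::finite phase \<Rightarrow> real"
  assumes \<kappa>: "continuous_on UNIV \<kappa>" and coeff: "\<And>q. q \<in> unit_phase \<Longrightarrow> jacobi_coeff M (\<lambda>t. \<kappa> (orbit q t))"
  shows "continuous_on unit_phase (\<lambda>q. stable_slope (\<lambda>t. \<kappa> (orbit q t)))"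
  unfolding continuous_on_iff
proof (intro ballI allI impI)
  fix q0 :: "'n phase" and e :: real assume q0: "q0 \<in> unit_phase" and e: "e > 0"
  \<comment> \<open>With this \<open>T\<close>, and \<open>e / (4 T)\<close> for the distance of the coefficients, the Wronskian bound is \<open>e / 4 + e / 4\<close>.\<close>
  define T where "T = 8 / e"
  have T: "T > 0" using e by (simp add: T_def)
  obtain K :: "'n phase set" where K: "compact K" "convex K"
    "\<And>a \<tau>. a \<in> unit_phase \<Longrightarrow> norm (a - q0) < 1 \<Longrightarrow> \<bar>\<tau>\<bar> \<le> T \<Longrightarrow> orbit a \<tau> \<in> K"
    using orbit_stays[of q0 T] by blast
  obtain L where L: "L \<ge> 0" "\<And>b. b \<in> K \<Longrightarrow> norm (geodesic_field_blinfun b) \<le> L"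
    using C1_field_bounded_derivative[OF C1_geodesic_field K(1)] by blast
  have "uniformly_continuous_on K \<kappa>"
    using K(1) \<kappa> by (metis compact_uniformly_continuous continuous_on_subset subset_UNIV)
  moreover have "e / (4 * T) > 0" using e T by simp
  ultimately obtain d where d: "d > 0"
    "\<And>x y. x \<in> K \<Longrightarrow> y \<in> K \<Longrightarrow> dist y x < d \<Longrightarrow> dist (\<kappa> y) (\<kappa> x) < e / (4 * T)"
    unfolding uniformly_continuous_on_def by metis
  define d' where "d' = min 1 (d / exp ((L + 1) * T))"
  have "dist (stable_slope (\<lambda>t. \<kappa> (orbit q t))) (stable_slope (\<lambda>t. \<kappa> (orbit q0 t))) < e"
    if q: "q \<in> unit_phase" "dist q q0 < d'" for q
  proof -
    have q1: "norm (q - q0) < 1" "norm (q - q0) * exp ((L + 1) * T) < d"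
      using q(2) by (auto simp: d'_def dist_norm field_simps)
    have "\<bar>\<kappa> (orbit q t) - \<kappa> (orbit q0 t)\<bar> \<le> e / (4 * T)" if t: "0 \<le> t" "t \<le> T" for t
    proof -
      have "norm (orbit q t - orbit q0 t) \<le> norm (orbit q 0 - orbit q0 0) * exp ((L + 1) * T)"
        by (rule integral_curve_dependence[OF C1_geodesic_field K(2) L(2,1) orbit(2)[OF q(1)] _ orbit(2)[OF q0]])
           (use K(3) q q1 q0 t in auto)
      then have "dist (orbit q t) (orbit q0 t) < d"
        using q1 by (simp add: orbit(1) q q0 dist_norm)
      with d(2)[of "orbit q0 t" "orbit q t"] K(3) q q1 q0 t show ?thesis
        by (auto simp: dist_real_def)
    qed
    from stable_slope_continuity[OF coeff[OF q(1)] coeff[OF q0] T this]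
    have "\<bar>stable_slope (\<lambda>t. \<kappa> (orbit q t)) - stable_slope (\<lambda>t. \<kappa> (orbit q0 t))\<bar> \<le> 2 / T + T * (e / (4 * T))"
      by simp
    also have "\<dots> = e / 2" using T e by (simp add: T_def)
    finally show ?thesis using e by (simp add: dist_real_def)
  qed
  moreover have "d' > 0" using d by (simp add: d'_def)
  ultimately show "\<exists>d>0. \<forall>q\<in>unit_phase. dist q q0 < d \<longrightarrow>
      dist (stable_slope (\<lambda>t. \<kappa> (orbit q t))) (stable_slope (\<lambda>t. \<kappa> (orbit q0 t))) < e" by blast
qed

end

section \<open>Stable Jacobi fields along a geodesic\<close>

text \<open>
  For a unit vector \<open>n\<close> this operator multiplies \<open>n\<close> by \<open>\<alpha>\<close> and its orthogonal complement by \<open>\<beta>\<close>. For \<open>n = 0\<close> it is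
  multiplication by \<open>\<beta>\<close>; this occurs for vertical geodesics, on which both factors agree.
\<close>
definition aniso :: "'a::real_inner \<Rightarrow> real \<Rightarrow> real \<Rightarrow> 'a \<Rightarrow> 'a" where
  "aniso n \<alpha> \<beta> u = \<beta> *\<^sub>R u + ((\<alpha> - \<beta>) * (n \<bullet> u)) *\<^sub>R n"

lemma aniso_linear: "linear (aniso n \<alpha> \<beta>)"
  by (rule linearI) (simp_all add: aniso_def inner_add_right algebra_simps)

lemma aniso_compose:
  assumes "n \<bullet> n = 1 \<or> n = 0"
  shows "aniso n \<alpha> \<beta> (aniso n \<alpha>' \<beta>' u) = aniso n (\<alpha> * \<alpha>') (\<beta> * \<beta>') u"
  using assms by (auto simp: aniso_def inner_add_right algebra_simps)

lemma aniso_add: "aniso n \<alpha> \<beta> u + aniso n \<alpha>' \<beta>' u = aniso n (\<alpha> + \<alpha>') (\<beta> + \<beta>') u"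
  by (simp add: aniso_def algebra_simps)

lemma aniso_1: "aniso n 1 1 u = u"
  by (simp add: aniso_def)

lemma aniso_orthogonal: "n \<bullet> v = 0 \<Longrightarrow> u \<bullet> v = 0 \<Longrightarrow> aniso n \<alpha> \<beta> u \<bullet> v = 0"
  by (simp add: aniso_def inner_add_left)

lemma aniso_inj:
  assumes "n \<bullet> n = 1 \<or> n = 0" "\<alpha> > 0" "\<beta> > 0" "aniso n \<alpha> \<beta> u = 0"
  shows "u = 0"
proof -
  have "u = aniso n (1 / \<alpha>) (1 / \<beta>) (aniso n \<alpha> \<beta> u)"
    using assms(1-3) by (simp add: aniso_compose aniso_1)
  then show ?thesis unfolding assms(4) by (simp add: aniso_def)
qed

context warping
begin

definition warp_curv :: "real \<Rightarrow> real" where "warp_curv x = g2 x + (g1 x)\<^sup>2"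

text \<open>
  Minus the sectional curvature of the planes spanned by the velocity and a normal vector, the latter in the plane
  of \<open>\<partial>\<^sub>x\<close> and \<open>w\<close> or orthogonal to it.
\<close>
definition neg_curv_par :: "'n::finite phase \<Rightarrow> real" where
  "neg_curv_par q = warp_curv (px q)"

definition neg_curv_perp :: "'n::finite phase \<Rightarrow> real" where
  "neg_curv_perp q = (ps q)\<^sup>2 * warp_curv (px q) + (1 - (ps q)\<^sup>2) * (g1 (px q))\<^sup>2"

definition slope_par :: "'n::finite phase \<Rightarrow> real" where
  "slope_par q = stable_slope (\<lambda>t. neg_curv_par (orbit q t))"

definition slope_perp :: "'n::finite phase \<Rightarrow> real" where
  "slope_perp q = stable_slope (\<lambda>t. neg_curv_perp (orbit q t))"

definition neg_curv_max :: real where "neg_curv_max = H + c1\<^sup>2"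

lemma neg_curv_max_nonneg: "neg_curv_max \<ge> 0"
  using h_bounds[of 0] by (simp add: neg_curv_max_def)

lemma g1_sq_bounds: "c0\<^sup>2 \<le> (g1 x)\<^sup>2" "(g1 x)\<^sup>2 \<le> c1\<^sup>2"
  using g1_bounds[of x] c0 by (auto intro!: power_mono)

lemma neg_curv_par_cont: "continuous_on UNIV neg_curv_par" and neg_curv_perp_cont: "continuous_on UNIV neg_curv_perp"
  unfolding neg_curv_par_def neg_curv_perp_def warp_curv_def
  by (intro continuous_intros continuous_on_compose2[OF g1_cont[of UNIV]]
      continuous_on_compose2[OF g2_cont]; simp)+

lemma unit_s_sq: "q \<in> unit_phase \<Longrightarrow> (ps q)\<^sup>2 \<le> 1"
  using inner_ge_zero[of "pw q"] unfolding unit_phase_iff by linarith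

lemma k_bounds:
  assumes "q \<in> unit_phase"
  shows "0 \<le> neg_curv_par q" "neg_curv_par q \<le> neg_curv_max" "0 \<le> neg_curv_perp q" "neg_curv_perp q \<le> neg_curv_max"
proof -
  have s: "(ps q)\<^sup>2 \<le> 1" "(ps q)\<^sup>2 \<ge> 0" using unit_s_sq[OF assms] by auto
  have h: "0 \<le> warp_curv x" "warp_curv x \<le> H" for x using h_bounds by (auto simp: warp_curv_def)
  show "0 \<le> neg_curv_par q" "neg_curv_par q \<le> neg_curv_max"
    using h[of "px q"] by (auto simp: neg_curv_par_def neg_curv_max_def add_increasing2)
  show "0 \<le> neg_curv_perp q" unfolding neg_curv_perp_def using s h by (intro add_nonneg_nonneg mult_nonneg_nonneg) auto
  have "(ps q)\<^sup>2 * warp_curv (px q) \<le> 1 * H"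
    using s h by (intro mult_mono) auto
  moreover have "(1 - (ps q)\<^sup>2) * (g1 (px q))\<^sup>2 \<le> 1 * c1\<^sup>2"
    using s g1_sq_bounds by (intro mult_mono) auto
  ultimately show "neg_curv_perp q \<le> neg_curv_max" by (simp add: neg_curv_perp_def neg_curv_max_def)
qed

lemma k_coeff:
  assumes "q \<in> unit_phase"
  shows "jacobi_coeff neg_curv_max (\<lambda>t. neg_curv_par (orbit q t))" "jacobi_coeff neg_curv_max (\<lambda>t. neg_curv_perp (orbit q t))"
  unfolding jacobi_coeff_def
  using k_bounds[OF orbit(3)[OF assms]] integral_curve_continuous[OF orbit(2)[OF assms]]
  by (auto intro!: continuous_on_compose2[OF neg_curv_par_cont] continuous_on_compose2[OF neg_curv_perp_cont])

lemma slope_cont: "continuous_on unit_phase slope_par" "continuous_on unit_phase slope_perp"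
  unfolding slope_par_def[abs_def] slope_perp_def[abs_def]
  by (rule stable_slope_continuous[OF neg_curv_par_cont k_coeff(1)], assumption)
     (rule stable_slope_continuous[OF neg_curv_perp_cont k_coeff(2)], assumption)

lemma slope_bounds:
  assumes "q \<in> unit_phase"
  shows "0 \<le> slope_par q" "slope_par q \<le> 1 + neg_curv_max" "0 \<le> slope_perp q" "slope_perp q \<le> 1 + neg_curv_max"
  unfolding slope_par_def slope_perp_def
  using stable_slope_bounds k_coeff[OF assms] by blast+

text \<open>
  The bounded function whose derivative along geodesics compensates the places where the curvature degenerates.
\<close>
definition potential :: "'n::finite phase \<Rightarrow> real" where
  "potential q = ps q * (g1 (px q) - 2 * c1)"

lemma potential_bound: "q \<in> unit_phase \<Longrightarrow> \<bar>potential q\<bar> \<le> 2 * c1"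
proof -
  assume "q \<in> unit_phase"
  then have "\<bar>ps q\<bar> \<le> 1" using unit_s_sq[of q] by (simp add: abs_square_le_1)
  moreover have "\<bar>g1 (px q) - 2 * c1\<bar> \<le> 2 * c1"
    using g1_bounds[of "px q"] c0 by linarith
  ultimately have "\<bar>ps q\<bar> * \<bar>g1 (px q) - 2 * c1\<bar> \<le> 1 * (2 * c1)"
    by (intro mult_mono) auto
  then show ?thesis by (simp add: potential_def abs_mult)
qed

text \<open>
  With \<open>c = |w|\<^sup>2 = 1 - s\<^sup>2\<close> one has \<open>s\<^sup>2 h - p = s\<^sup>2 g1\<^sup>2 + c g1 (2 c1 - g1)\<close>, which is at least \<open>g1\<^sup>2\<close> as \<open>g1 \<le> c1\<close>.
\<close>
lemma potential_derivative:
  assumes q: "q \<in> unit_phase"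
  obtains p where "\<And>t. ((\<lambda>t. potential (orbit q t)) has_real_derivative p t) (at t)"
    "\<And>t. c0\<^sup>2 + p t \<le> neg_curv_par (orbit q t)" "\<And>t. c0\<^sup>2 + p t \<le> neg_curv_perp (orbit q t)"
proof -
  note d = curve_components[OF orbit(2)[OF q]]
  define x s c where "x = (\<lambda>t. px (orbit q t))" and "s = (\<lambda>t. ps (orbit q t))"
    and "c = (\<lambda>t. pw (orbit q t) \<bullet> pw (orbit q t))"
  have dx: "(x has_real_derivative s t) (at t)" and ds: "(s has_real_derivative g1 (x t) * c t) (at t)" for t
    using d(1,3)[of t] by (simp_all add: x_def s_def c_def)
  have sc: "(s t)\<^sup>2 + c t = 1" for t using orbit(3)[OF q, of t] by (simp add: unit_phase_iff s_def c_def)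
  have c: "c t \<ge> 0" for t by (simp add: c_def)
  define p where "p = (\<lambda>t. g1 (x t) * c t * (g1 (x t) - 2 * c1) + s t * (g2 (x t) * s t))"
  show ?thesis
  proof
    show "((\<lambda>t. potential (orbit q t)) has_real_derivative p t) (at t)" for t
    proof -
      have "((\<lambda>t. s t * (g1 (x t) - 2 * c1)) has_real_derivative p t) (at t)"
        unfolding p_def
        by (auto intro!: derivative_eq_intros ds DERIV_chain2[OF g1 dx])
      then show ?thesis by (simp add: potential_def s_def x_def)
    qed
    fix t
    have "(s t)\<^sup>2 * warp_curv (x t) - p t = (s t)\<^sup>2 * (g1 (x t))\<^sup>2 + c t * (g1 (x t) * (2 * c1 - g1 (x t)))"
      by (simp add: p_def warp_curv_def algebra_simps power2_eq_square)
    moreover have "(g1 (x t))\<^sup>2 \<le> g1 (x t) * (2 * c1 - g1 (x t))"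
      unfolding power2_eq_square using g1_bounds[of "x t"] c0 by (intro mult_left_mono) auto
    then have "c t * (g1 (x t))\<^sup>2 \<le> c t * (g1 (x t) * (2 * c1 - g1 (x t)))"
      using c by (rule mult_left_mono)
    moreover have "(s t)\<^sup>2 * (g1 (x t))\<^sup>2 + c t * (g1 (x t))\<^sup>2 = (g1 (x t))\<^sup>2"
      using sc[of t] by (simp flip: distrib_right)
    ultimately have *: "c0\<^sup>2 + p t \<le> (s t)\<^sup>2 * warp_curv (x t)"
      using g1_sq_bounds(1)[of "x t"] by linarith
    have h: "warp_curv (x t) \<ge> 0" using h_bounds by (simp add: warp_curv_def)
    have s1: "(s t)\<^sup>2 \<le> 1" using sc[of t] c[of t] by linarith
    have "(s t)\<^sup>2 * warp_curv (x t) \<le> 1 * warp_curv (x t)" using h s1 by (rule mult_right_mono[rotated])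
    with * show "c0\<^sup>2 + p t \<le> neg_curv_par (orbit q t)" by (simp add: neg_curv_par_def x_def)
    have "(1 - (s t)\<^sup>2) * (g1 (x t))\<^sup>2 \<ge> 0" using s1 by simp
    with * show "c0\<^sup>2 + p t \<le> neg_curv_perp (orbit q t)" by (simp add: neg_curv_perp_def x_def s_def)
  qed
qed

lemma slope_pos:
  assumes q: "q \<in> unit_phase"
  shows "slope_par q > 0" "slope_perp q > 0"
proof -
  obtain p where p: "\<And>t. ((\<lambda>t. potential (orbit q t)) has_real_derivative p t) (at t)"
    "\<And>t. c0\<^sup>2 + p t \<le> neg_curv_par (orbit q t)" "\<And>t. c0\<^sup>2 + p t \<le> neg_curv_perp (orbit q t)"
    using potential_derivative[OF q] by blast
  have b: "\<bar>potential (orbit q t)\<bar> \<le> 2 * c1" for t by (intro potential_bound orbit q)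
  show "slope_par q > 0" "slope_perp q > 0"
    unfolding slope_par_def slope_perp_def
    using stable_slope_pos[OF k_coeff(1)[OF q] p(1) b p(2)]
      stable_slope_pos[OF k_coeff(2)[OF q] p(1) b p(3)] c0 by simp_all
qed

definition contraction_rate :: real where "contraction_rate = exp (- (c0\<^sup>2 / (1 + neg_curv_max)))"
definition decay_const :: real where "decay_const = exp (1 + 2 * (2 * c1) / (1 + neg_curv_max))"

lemma decay:
  assumes q: "q \<in> unit_phase" and t: "t \<ge> 0"
    and j: "decaying_jacobi (\<lambda>t. neg_curv_par (orbit q t)) j j' \<or> decaying_jacobi (\<lambda>t. neg_curv_perp (orbit q t)) j j'"
  shows "j t \<le> decay_const * contraction_rate powr t"
proof -
  obtain p where p: "\<And>t. ((\<lambda>t. potential (orbit q t)) has_real_derivative p t) (at t)"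
    "\<And>t. c0\<^sup>2 + p t \<le> neg_curv_par (orbit q t)" "\<And>t. c0\<^sup>2 + p t \<le> neg_curv_perp (orbit q t)"
    using potential_derivative[OF q] by blast
  have b: "\<bar>potential (orbit q t)\<bar> \<le> 2 * c1" for t by (intro potential_bound orbit q)
  have "contraction_rate powr t = exp (- (c0\<^sup>2 / (1 + neg_curv_max)) * t)"
    by (simp add: contraction_rate_def powr_def)
  then show ?thesis
    using j decaying_jacobi_exponential[OF k_coeff(1)[OF q] _ p(1) b p(2) t]
      decaying_jacobi_exponential[OF k_coeff(2)[OF q] _ p(1) b p(3) t]
    unfolding decay_const_def by metis
qed

lemma slope_along_orbit:
  assumes q: "q \<in> unit_phase"
  shows "decaying_jacobi (\<lambda>t. neg_curv_par (orbit q t)) j j' \<Longrightarrow> j' t = - slope_par (orbit q t) * j t"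
    "decaying_jacobi (\<lambda>t. neg_curv_perp (orbit q t)) j j' \<Longrightarrow> j' t = - slope_perp (orbit q t) * j t"
proof -
  have *: "stable_slope (\<lambda>\<tau>. \<kappa> (orbit (orbit q t) \<tau>)) = - j' t / j t"
    if "jacobi_coeff neg_curv_max (\<lambda>t. \<kappa> (orbit q t))" "decaying_jacobi (\<lambda>t. \<kappa> (orbit q t)) j j'" for \<kappa>
    using stable_slope_shift[OF that, of t] by (simp add: orbit_add[OF q])
  have "j t \<noteq> 0" if "decaying_jacobi k j j'" for k
    using that unfolding decaying_jacobi_def by (metis less_irrefl)
  then show "decaying_jacobi (\<lambda>t. neg_curv_par (orbit q t)) j j' \<Longrightarrow> j' t = - slope_par (orbit q t) * j t"
    "decaying_jacobi (\<lambda>t. neg_curv_perp (orbit q t)) j j' \<Longrightarrow> j' t = - slope_perp (orbit q t) * j t"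
    using *[of neg_curv_par] *[of neg_curv_perp] k_coeff[OF q] by (auto simp: slope_par_def slope_perp_def)
qed

lemma orbit_direction:
  assumes q: "q \<in> unit_phase"
  shows "pw (orbit q t) = exp (g (px q) - g (px (orbit q t))) *\<^sub>R pw q"
proof -
  note d = curve_components[OF orbit(2)[OF q]]
  let ?E = "\<lambda>t. exp (g (px (orbit q t))) *\<^sub>R pw (orbit q t)"
  have "((\<lambda>t. exp (g (px (orbit q t)))) has_real_derivative
      exp (g (px (orbit q t))) * (g1 (px (orbit q t)) * ps (orbit q t))) (at t)" for t
    by (auto intro!: derivative_eq_intros DERIV_chain2[OF g d(1)])
  from has_vector_derivative_scaleR[OF this d(4)]
  have dE: "(?E has_vector_derivative 0) (at t within UNIV)" for t
    by (simp add: algebra_simps)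
  obtain k where k: "\<And>t. t \<in> UNIV \<Longrightarrow> ?E t = k"
    using has_vector_derivative_zero_constant[OF convex_UNIV dE] by blast
  have "exp (- g (px (orbit q t))) *\<^sub>R ?E t = pw (orbit q t)"
    by (simp add: exp_add[symmetric])
  then have "pw (orbit q t) = exp (- g (px (orbit q t))) *\<^sub>R ?E 0"
    using k[of t] k[of 0] by simp
  then show ?thesis by (simp add: orbit(1)[OF q] exp_add[symmetric])
qed

text \<open>
  The unit normal of the velocity in the plane of \<open>\<partial>\<^sub>x\<close> and \<open>w\<close>. It is \<open>0\<close> if \<open>w = 0\<close>, where that plane degenerates
  and where no continuous choice exists.
\<close>
definition plane_normal :: "'n::finite phase \<Rightarrow> real \<times> (real ^ 'n)" where
  "plane_normal q = (- norm (pw q), ps q *\<^sub>R sgn (pw q))"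

lemma plane_normal_zero: "pw q = 0 \<Longrightarrow> plane_normal q = 0"
  by (simp add: plane_normal_def zero_prod_def)

lemma plane_normal_unit:
  assumes "q \<in> unit_phase"
  shows "plane_normal q \<bullet> plane_normal q = 1 \<or> plane_normal q = 0"
proof (cases "pw q = 0")
  case False
  then have n: "sgn (pw q) \<bullet> sgn (pw q) = 1"
    by (simp add: norm_sgn dot_square_norm)
  have "plane_normal q \<bullet> plane_normal q = (norm (pw q))\<^sup>2 + (ps q)\<^sup>2 * (sgn (pw q) \<bullet> sgn (pw q))"
    by (simp add: plane_normal_def inner_prod_def power2_eq_square)
  then show ?thesis using assms n by (simp add: unit_phase_iff dot_square_norm)
qed (simp add: plane_normal_zero)

lemma inner_sgn_self: "sgn w \<bullet> w = norm w" for w :: "'a::real_inner"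
  by (cases "w = 0") (simp_all add: sgn_div_norm dot_square_norm power2_eq_square)

lemma plane_normal_orthogonal: "plane_normal q \<bullet> snd q = 0"
  by (simp add: plane_normal_def inner_prod_def inner_sgn_self)

lemma plane_normal_norm_le: "q \<in> unit_phase \<Longrightarrow> norm (plane_normal q) \<le> 1"
  using plane_normal_unit[of q] norm_eq_1[of "plane_normal q"] by auto

text \<open>
  The remaining component of a vector orthogonal to the velocity is tangent to the fibre and orthogonal to \<open>w\<close>.
\<close>
lemma residual_horizontal:
  assumes q: "q \<in> unit_phase" and u: "u \<bullet> snd q = 0"
  shows "fst (u - (plane_normal q \<bullet> u) *\<^sub>R plane_normal q) = 0"
    "snd (u - (plane_normal q \<bullet> u) *\<^sub>R plane_normal q) \<bullet> pw q = 0"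
proof -
  define s w where "s = ps q" and "w = pw q"
  have sw: "s\<^sup>2 + (norm w)\<^sup>2 = 1" using q by (simp add: unit_phase_iff s_def w_def dot_square_norm)
  have uv: "fst u * s + snd u \<bullet> w = 0" using u by (simp add: inner_prod_def s_def w_def)
  define k where "k = sgn w \<bullet> snd u"
  have ck: "norm w * k = snd u \<bullet> w"
    by (cases "w = 0") (simp_all add: k_def sgn_div_norm inner_commute)
  have n: "plane_normal q \<bullet> u = - norm w * fst u + s * k"
    by (simp add: plane_normal_def s_def w_def k_def inner_prod_def)
  have "(plane_normal q \<bullet> u) * norm w = - (norm w)\<^sup>2 * fst u + s * (snd u \<bullet> w)"
    unfolding n ck[symmetric] by (simp add: algebra_simps power2_eq_square)
  also have "s * (snd u \<bullet> w) = - (s\<^sup>2 * fst u)"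
    using uv by (simp add: power2_eq_square eq_neg_iff_add_eq_0 algebra_simps)
      (metis add.commute distrib_left mult.commute mult_zero_right)
  also have "- (norm w)\<^sup>2 * fst u + - (s\<^sup>2 * fst u) = - ((s\<^sup>2 + (norm w)\<^sup>2) * fst u)"
    by (simp add: algebra_simps)
  finally show 1: "fst (u - (plane_normal q \<bullet> u) *\<^sub>R plane_normal q) = 0"
    unfolding sw by (simp add: plane_normal_def w_def)
  have "(u - (plane_normal q \<bullet> u) *\<^sub>R plane_normal q) \<bullet> snd q = 0"
    using u by (simp add: inner_diff_left plane_normal_orthogonal)
  with 1 show "snd (u - (plane_normal q \<bullet> u) *\<^sub>R plane_normal q) \<bullet> pw q = 0"
    by (simp add: inner_prod_def)
qed

text \<open>
  The shape operator of the stable horosphere.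
\<close>
definition stable_shape :: "'n::finite phase \<Rightarrow> real \<times> (real ^ 'n) \<Rightarrow> real \<times> (real ^ 'n)" where
  "stable_shape q = aniso (plane_normal q) (slope_par q) (slope_perp q)"

text \<open>
  The tangent vector of the phase space with horizontal part \<open>u\<close> and vertical part \<open>\<nu>\<close>, both expressed in the
  orthonormal frame; the terms with \<open>g1\<close> are the connection coefficients of that frame.
\<close>
definition frame_lift :: "'n::finite phase \<Rightarrow> real \<times> (real ^ 'n) \<Rightarrow> real \<times> (real ^ 'n) \<Rightarrow> 'n phase" where
  "frame_lift q u \<nu> = ((fst u, exp (- g (px q)) *\<^sub>R snd u),
     (fst \<nu> + g1 (px q) * (snd u \<bullet> pw q),
      snd \<nu> - (g1 (px q) * ps q) *\<^sub>R snd u))"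

definition contraction_const :: real where "contraction_const = sqrt (1 + (1 + neg_curv_max)\<^sup>2) * decay_const"

text \<open>
  With \<open>a = n \<bullet> u\<close> and \<open>e = u - a n\<close>, and decaying solutions \<open>j, k\<close> of the two scalar equations, the field is
  \<open>U = a j n + k e\<close>. Here \<open>n\<close> moves along the geodesic, while \<open>e\<close> is constant in the frame and the direction
  \<open>\<omega>\<close> of \<open>w\<close> is constant too. This makes the variational equation a set of identities between scalar functions.
\<close>
theorem stable_jacobi_field:
  fixes q :: "'n::finite phase"
  assumes q: "q \<in> unit_phase" and u: "u \<bullet> snd q = 0"
  shows "\<exists>U. U 0 = u \<and> (\<forall>t. U t \<bullet> snd (orbit q t) = 0) \<and>
    (\<forall>t. ((\<lambda>t. frame_lift (orbit q t) (U t) (- stable_shape (orbit q t) (U t))) has_vector_derivative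
       d_geodesic_field (orbit q t) (frame_lift (orbit q t) (U t) (- stable_shape (orbit q t) (U t)))) (at t)) \<and>
    (\<forall>t\<ge>0. (norm (U t))\<^sup>2 + (norm (stable_shape (orbit q t) (U t)))\<^sup>2
       \<le> (contraction_const * contraction_rate powr t)\<^sup>2 * (norm u)\<^sup>2)"
proof -
  obtain j j' where j: "decaying_jacobi (\<lambda>t. neg_curv_par (orbit q t)) j j'"
    using decaying_jacobi_exists[OF k_coeff(1)[OF q]] by blast
  obtain k k' where k: "decaying_jacobi (\<lambda>t. neg_curv_perp (orbit q t)) k k'"
    using decaying_jacobi_exists[OF k_coeff(2)[OF q]] by blast
  note J = j[unfolded decaying_jacobi_def] and K = k[unfolded decaying_jacobi_def]
  define x s E where "x = (\<lambda>t. px (orbit q t))" and "s = (\<lambda>t. ps (orbit q t))"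
    and "E = (\<lambda>t. exp (g (px q) - g (x t)))"
  define w0 \<omega> c where "w0 = pw q" and "\<omega> = sgn w0" and "c = (\<lambda>t. E t * norm w0)"
  define a where "a = plane_normal q \<bullet> u"
  define e where "e = u - a *\<^sub>R plane_normal q"
  note d = curve_components[OF orbit(2)[OF q]]
  have xs: "px (orbit q t) = x t" "ps (orbit q t) = s t" for t
    by (simp_all add: x_def s_def)
  have dj: "(j has_real_derivative j' t) (at t)"
    "(j' has_real_derivative warp_curv (x t) * j t) (at t)" for t
    using J jacobiD[of _ j j' t] by (auto simp: neg_curv_par_def x_def)
  have dk: "(k has_real_derivative k' t) (at t)"
    "(k' has_real_derivative ((s t)\<^sup>2 * warp_curv (x t) + (1 - (s t)\<^sup>2) * (g1 (x t))\<^sup>2) * k t) (at t)" for t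
    using K jacobiD[of _ k k' t] by (auto simp: neg_curv_perp_def x_def s_def)
  have w: "pw (orbit q t) = c t *\<^sub>R \<omega>" for t
    using orbit_direction[OF q, of t]
    by (cases "w0 = 0") (simp_all add: c_def E_def x_def w0_def \<omega>_def sgn_div_norm)
  have \<omega>: "c t * (\<omega> \<bullet> \<omega>) = c t" for t
    by (cases "w0 = 0") (simp_all add: c_def \<omega>_def dot_square_norm norm_sgn)
  have a\<omega>: "a * (\<omega> \<bullet> \<omega>) = a"
    by (cases "w0 = 0") (simp_all add: a_def plane_normal_zero w0_def \<omega>_def dot_square_norm norm_sgn)
  have ww: "pw (orbit q t) \<bullet> pw (orbit q t) = (c t)\<^sup>2" for t
    unfolding w using \<omega>[of t] by (simp add: power2_eq_square mult.assoc)
  have sc: "(c t)\<^sup>2 = 1 - (s t)\<^sup>2" for t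
    using orbit(3)[OF q, of t] by (simp add: unit_phase_iff ww s_def)
  have n: "plane_normal (orbit q t) = (- c t, s t *\<^sub>R \<omega>)" for t
  proof -
    have "E t > 0" by (simp add: E_def)
    have "sgn \<omega> = \<omega>"
      by (cases "w0 = 0") (simp_all add: \<omega>_def sgn_div_norm[of "sgn w0"] norm_sgn)
    then have "sgn (c t *\<^sub>R \<omega>) = \<omega>"
      using \<open>E t > 0\<close> by (cases "w0 = 0") (auto simp: c_def sgn_scaleR \<omega>_def)
    moreover have "norm (c t *\<^sub>R \<omega>) = c t"
      using \<open>E t > 0\<close> by (cases "w0 = 0") (auto simp: c_def \<omega>_def norm_sgn)
    ultimately show ?thesis by (simp add: plane_normal_def w s_def)
  qed
  have q0: "orbit q 0 = q" by (rule orbit(1)[OF q])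
  have e0: "fst e = 0" "snd e \<bullet> \<omega> = 0"
  proof -
    show "fst e = 0" unfolding e_def a_def by (rule residual_horizontal(1)[OF q u])
    have "snd e \<bullet> w0 = 0" unfolding e_def a_def w0_def by (rule residual_horizontal(2)[OF q u])
    then show "snd e \<bullet> \<omega> = 0" by (simp add: \<omega>_def sgn_div_norm)
  qed
  have u_eq: "u = a *\<^sub>R plane_normal q + e" by (simp add: e_def)
  define U where "U = (\<lambda>t. (a * j t) *\<^sub>R plane_normal (orbit q t) + k t *\<^sub>R e)"
  define N where "N = (\<lambda>t. (a * j' t) *\<^sub>R plane_normal (orbit q t) + k' t *\<^sub>R e)"
  have ne: "plane_normal (orbit q t) \<bullet> e = 0" for t
    using e0 by (simp add: n inner_prod_def inner_commute)
  have ann: "a * (plane_normal (orbit q t) \<bullet> plane_normal (orbit q t)) = a" for t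
  proof -
    have "a * (plane_normal (orbit q t) \<bullet> plane_normal (orbit q t)) = a * (c t)\<^sup>2 + (s t)\<^sup>2 * (a * (\<omega> \<bullet> \<omega>))"
      by (simp add: n inner_prod_def power2_eq_square algebra_simps)
    then show ?thesis by (simp add: a\<omega> sc algebra_simps)
  qed
  have nU: "plane_normal (orbit q t) \<bullet> U t = a * j t" for t
  proof -
    have "plane_normal (orbit q t) \<bullet> U t = j t * (a * (plane_normal (orbit q t) \<bullet> plane_normal (orbit q t)))"
      using ne by (simp add: U_def inner_add_right)
    then show ?thesis by (simp add: ann)
  qed
  have stabU: "- stable_shape (orbit q t) (U t) = N t" for t
  proof -
    have "stable_shape (orbit q t) (U t) = (a * (slope_par (orbit q t) * j t)) *\<^sub>R plane_normal (orbit q t)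
        + (slope_perp (orbit q t) * k t) *\<^sub>R e"
      by (simp add: stable_shape_def aniso_def nU) (simp add: U_def algebra_simps)
    then show ?thesis
      using slope_along_orbit(1)[OF q j, of t] slope_along_orbit(2)[OF q k, of t] by (simp add: N_def)
  qed
  have Uv: "U t \<bullet> snd (orbit q t) = 0" for t
  proof -
    have "e \<bullet> snd (orbit q t) = 0" using e0 by (simp add: inner_prod_def w)
    then show ?thesis by (simp add: U_def inner_add_left plane_normal_orthogonal)
  qed
  define \<delta>x \<delta>s where "\<delta>x = (\<lambda>t. - (a * j t * c t))"
    and "\<delta>s = (\<lambda>t. - (a * j' t * c t) + g1 (x t) * (a * j t * s t * c t))"
  define y1 y2 w1 w2 where "y1 = (\<lambda>t. exp (- g (x t)) * (a * j t * s t))"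
    and "y2 = (\<lambda>t. exp (- g (x t)) * k t)"
    and "w1 = (\<lambda>t. a * j' t * s t - g1 (x t) * s t * (a * j t * s t))"
    and "w2 = (\<lambda>t. k' t - g1 (x t) * s t * k t)"
  have frame_lift_eq: "frame_lift (orbit q t) (U t) (N t)
      = ((\<delta>x t, y1 t *\<^sub>R \<omega> + y2 t *\<^sub>R snd e), (\<delta>s t, w1 t *\<^sub>R \<omega> + w2 t *\<^sub>R snd e))" for t
  proof -
    have "snd (U t) \<bullet> pw (orbit q t) = a * j t * s t * (c t * (\<omega> \<bullet> \<omega>))"
      using e0(2) by (simp add: U_def n w inner_add_left)
    then have "snd (U t) \<bullet> pw (orbit q t) = a * j t * s t * c t" by (simp only: \<omega>)
    then show ?thesis
      using e0(1)
      by (simp add: frame_lift_def U_def N_def n \<delta>x_def \<delta>s_def y1_def y2_def w1_def w2_def xs) (simp add: algebra_simps)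
  qed
  have dx: "(x has_real_derivative s t) (at t)" and ds: "(s has_real_derivative g1 (x t) * (c t)\<^sup>2) (at t)" for t
    using d(1,3)[of t] by (simp_all add: x_def s_def ww)
  have dgx: "((\<lambda>t. g (x t)) has_real_derivative g1 (x t) * s t) (at t)"
    and dg1x: "((\<lambda>t. g1 (x t)) has_real_derivative g2 (x t) * s t) (at t)" for t
    using DERIV_chain2[OF g dx] DERIV_chain2[OF g1 dx] by auto
  have dc: "(c has_real_derivative - (g1 (x t) * s t * c t)) (at t)" for t
    unfolding c_def E_def by (auto intro!: derivative_eq_intros dgx)
  have field: "((\<lambda>t. frame_lift (orbit q t) (U t) (N t)) has_vector_derivative
      d_geodesic_field (orbit q t) (frame_lift (orbit q t) (U t) (N t))) (at t)" for t
  proof -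
    have "d_geodesic_field (orbit q t) (frame_lift (orbit q t) (U t) (N t)) =
      ((\<delta>s t, (exp (- g (x t)) * (w1 t - g1 (x t) * \<delta>x t * c t)) *\<^sub>R \<omega> + (exp (- g (x t)) * w2 t) *\<^sub>R snd e),
       (g2 (x t) * \<delta>x t * (c t)\<^sup>2 + 2 * g1 (x t) * (w1 t * c t),
        (- (g2 (x t) * \<delta>x t * s t + g1 (x t) * \<delta>s t) * c t - g1 (x t) * s t * w1 t) *\<^sub>R \<omega>
        + (- (g1 (x t) * s t * w2 t)) *\<^sub>R snd e))"
    proof -
      have "pw (orbit q t) \<bullet> (w1 t *\<^sub>R \<omega> + w2 t *\<^sub>R snd e) = w1 t * (c t * (\<omega> \<bullet> \<omega>))"
        using e0(2) by (simp add: w inner_add_right inner_commute)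
      then have "pw (orbit q t) \<bullet> (w1 t *\<^sub>R \<omega> + w2 t *\<^sub>R snd e) = w1 t * c t" by (simp only: \<omega>)
      then show ?thesis
        unfolding frame_lift_eq d_geodesic_field_def ww
        by (simp add: w xs) (simp add: algebra_simps)
    qed
    moreover have "((\<lambda>t. frame_lift (orbit q t) (U t) (N t)) has_vector_derivative
      ((\<delta>s t, (exp (- g (x t)) * (w1 t - g1 (x t) * \<delta>x t * c t)) *\<^sub>R \<omega> + (exp (- g (x t)) * w2 t) *\<^sub>R snd e),
       (g2 (x t) * \<delta>x t * (c t)\<^sup>2 + 2 * g1 (x t) * (w1 t * c t),
        (- (g2 (x t) * \<delta>x t * s t + g1 (x t) * \<delta>s t) * c t - g1 (x t) * s t * w1 t) *\<^sub>R \<omega>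
        + (- (g1 (x t) * s t * w2 t)) *\<^sub>R snd e))) (at t)"
      unfolding frame_lift_eq
    proof (intro has_vector_derivative_Pair)
      have comb: "((\<lambda>t. f1 t *\<^sub>R p1 + f2 t *\<^sub>R p2) has_vector_derivative f1' *\<^sub>R p1 + f2' *\<^sub>R p2) (at t)"
        if "(f1 has_real_derivative f1') (at t)" "(f2 has_real_derivative f2') (at t)"
        for f1 f2 f1' f2' and p1 p2 :: "real ^ 'n"
        using has_vector_derivative_add[OF
            has_vector_derivative_scaleR[OF that(1) has_vector_derivative_const[of p1]]
            has_vector_derivative_scaleR[OF that(2) has_vector_derivative_const[of p2]]] by simp
      show "(\<delta>x has_vector_derivative \<delta>s t) (at t)"
        unfolding has_real_derivative_iff_has_vector_derivative[symmetric] \<delta>x_def \<delta>s_def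
        by (auto intro!: derivative_eq_intros dj dc simp: algebra_simps)
      have "(\<delta>s has_real_derivative g2 (x t) * \<delta>x t * (c t)\<^sup>2 + 2 * g1 (x t) * (w1 t * c t)) (at t)"
      proof -
        have "(\<delta>s has_real_derivative
            - (a * (warp_curv (x t) * j t) * c t + a * j' t * - (g1 (x t) * s t * c t))
            + (g2 (x t) * s t * (a * j t * s t * c t)
            + g1 (x t) * (a * j' t * s t * c t + a * j t * (g1 (x t) * (c t)\<^sup>2) * c t
               + a * j t * s t * - (g1 (x t) * s t * c t)))) (at t)"
          unfolding \<delta>s_def
          by (auto intro!: derivative_eq_intros dj dc dg1x ds simp: algebra_simps)
        moreover have "- (a * (warp_curv (x t) * j t) * c t + a * j' t * - (g1 (x t) * s t * c t))
            + (g2 (x t) * s t * (a * j t * s t * c t)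
            + g1 (x t) * (a * j' t * s t * c t + a * j t * (g1 (x t) * (c t)\<^sup>2) * c t
               + a * j t * s t * - (g1 (x t) * s t * c t)))
            = g2 (x t) * \<delta>x t * (c t)\<^sup>2 + 2 * g1 (x t) * (w1 t * c t)"
          unfolding \<delta>x_def w1_def warp_curv_def using sc[of t] by algebra
        ultimately show ?thesis by simp
      qed
      then show "(\<delta>s has_vector_derivative g2 (x t) * \<delta>x t * (c t)\<^sup>2 + 2 * g1 (x t) * (w1 t * c t)) (at t)"
        by (simp add: has_real_derivative_iff_has_vector_derivative)
      show "((\<lambda>t. y1 t *\<^sub>R \<omega> + y2 t *\<^sub>R snd e) has_vector_derivative
          (exp (- g (x t)) * (w1 t - g1 (x t) * \<delta>x t * c t)) *\<^sub>R \<omega> + (exp (- g (x t)) * w2 t) *\<^sub>R snd e) (at t)"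
        unfolding y1_def y2_def w1_def w2_def \<delta>x_def
        by (rule comb)
           (auto intro!: derivative_eq_intros dj dk dc dgx ds simp: algebra_simps power2_eq_square)
      show "((\<lambda>t. w1 t *\<^sub>R \<omega> + w2 t *\<^sub>R snd e) has_vector_derivative
          (- (g2 (x t) * \<delta>x t * s t + g1 (x t) * \<delta>s t) * c t - g1 (x t) * s t * w1 t) *\<^sub>R \<omega>
          + (- (g1 (x t) * s t * w2 t)) *\<^sub>R snd e) (at t)"
      proof (rule comb)
        have "(w1 has_real_derivative
            a * (warp_curv (x t) * j t) * s t + a * j' t * (g1 (x t) * (c t)\<^sup>2)
            - (g2 (x t) * s t * s t * (a * j t * s t) + g1 (x t) * (g1 (x t) * (c t)\<^sup>2) * (a * j t * s t)
              + g1 (x t) * s t * (a * j' t * s t + a * j t * (g1 (x t) * (c t)\<^sup>2)))) (at t)"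
          unfolding w1_def
          by (auto intro!: derivative_eq_intros dj dg1x ds simp: algebra_simps)
        moreover have "a * (warp_curv (x t) * j t) * s t + a * j' t * (g1 (x t) * (c t)\<^sup>2)
            - (g2 (x t) * s t * s t * (a * j t * s t) + g1 (x t) * (g1 (x t) * (c t)\<^sup>2) * (a * j t * s t)
              + g1 (x t) * s t * (a * j' t * s t + a * j t * (g1 (x t) * (c t)\<^sup>2)))
            = - (g2 (x t) * \<delta>x t * s t + g1 (x t) * \<delta>s t) * c t - g1 (x t) * s t * w1 t"
          unfolding \<delta>x_def \<delta>s_def w1_def warp_curv_def using sc[of t] by algebra
        ultimately show "(w1 has_real_derivative
            - (g2 (x t) * \<delta>x t * s t + g1 (x t) * \<delta>s t) * c t - g1 (x t) * s t * w1 t) (at t)" by simp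
        have "(w2 has_real_derivative
            ((s t)\<^sup>2 * warp_curv (x t) + (1 - (s t)\<^sup>2) * (g1 (x t))\<^sup>2) * k t
            - (g2 (x t) * s t * s t * k t + g1 (x t) * (g1 (x t) * (c t)\<^sup>2) * k t + g1 (x t) * s t * k' t)) (at t)"
          unfolding w2_def
          by (auto intro!: derivative_eq_intros dk dg1x ds simp: algebra_simps)
        moreover have "((s t)\<^sup>2 * warp_curv (x t) + (1 - (s t)\<^sup>2) * (g1 (x t))\<^sup>2) * k t
            - (g2 (x t) * s t * s t * k t + g1 (x t) * (g1 (x t) * (c t)\<^sup>2) * k t + g1 (x t) * s t * k' t)
            = - (g1 (x t) * s t * w2 t)"
          unfolding w2_def warp_curv_def using sc[of t] by algebra
        ultimately show "(w2 has_real_derivative - (g1 (x t) * s t * w2 t)) (at t)" by simp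
      qed
    qed
    ultimately show ?thesis by simp
  qed
  have norms: "(norm (f *\<^sub>R (a *\<^sub>R plane_normal (orbit q t)) + h *\<^sub>R e))\<^sup>2 = f\<^sup>2 * a\<^sup>2 + h\<^sup>2 * (norm e)\<^sup>2" for f h t
  proof -
    have "(norm (f *\<^sub>R (a *\<^sub>R plane_normal (orbit q t)) + h *\<^sub>R e))\<^sup>2
      = f\<^sup>2 * (a * (a * (plane_normal (orbit q t) \<bullet> plane_normal (orbit q t)))) + h\<^sup>2 * (norm e)\<^sup>2"
      unfolding power2_norm_eq_inner using ne[of t]
      by (simp add: inner_add_left inner_add_right inner_commute power2_eq_square algebra_simps)
    then show ?thesis by (simp add: ann power2_eq_square)
  qed
  have u2: "(norm u)\<^sup>2 = a\<^sup>2 + (norm e)\<^sup>2"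
    using norms[of 1 0 1] by (simp add: q0 flip: u_eq)
  have decr: "(norm (U t))\<^sup>2 + (norm (stable_shape (orbit q t) (U t)))\<^sup>2 \<le> (contraction_const * contraction_rate powr t)\<^sup>2 * (norm u)\<^sup>2"
    if t: "t \<ge> 0" for t
  proof -
    define m where "m = 1 + (1 + neg_curv_max)\<^sup>2"
    define D where "D = (decay_const * contraction_rate powr t)\<^sup>2"
    have est: "i\<^sup>2 + i'\<^sup>2 \<le> m * D" if i: "0 < i" "i \<le> decay_const * contraction_rate powr t" "i' = - \<sigma> * i" "0 \<le> \<sigma>" "\<sigma> \<le> 1 + neg_curv_max"
      for i i' \<sigma>
    proof -
      have "i\<^sup>2 + i'\<^sup>2 = (1 + \<sigma>\<^sup>2) * i\<^sup>2" using i(3) by (simp add: power_mult_distrib algebra_simps)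
      also have "\<dots> \<le> m * D"
        unfolding m_def D_def using i neg_curv_max_nonneg by (intro mult_mono add_mono power_mono) auto
      finally show ?thesis .
    qed
    have uo: "orbit q t \<in> unit_phase" by (rule orbit(3)[OF q])
    have 1: "(j t)\<^sup>2 + (j' t)\<^sup>2 \<le> m * D"
      using est[OF _ _ slope_along_orbit(1)[OF q j]] J decay[OF q t] j slope_bounds[OF uo] by blast
    have 2: "(k t)\<^sup>2 + (k' t)\<^sup>2 \<le> m * D"
      using est[OF _ _ slope_along_orbit(2)[OF q k]] K decay[OF q t] k slope_bounds[OF uo] by blast
    have "(norm (U t))\<^sup>2 + (norm (stable_shape (orbit q t) (U t)))\<^sup>2 = (norm (U t))\<^sup>2 + (norm (N t))\<^sup>2"
      by (simp flip: stabU)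
    also have "\<dots> = ((j t)\<^sup>2 + (j' t)\<^sup>2) * a\<^sup>2 + ((k t)\<^sup>2 + (k' t)\<^sup>2) * (norm e)\<^sup>2"
      using norms[of "j t" t "k t"] norms[of "j' t" t "k' t"]
      by (simp add: U_def N_def mult.commute algebra_simps)
    also have "\<dots> \<le> m * D * a\<^sup>2 + m * D * (norm e)\<^sup>2"
      using 1 2 by (intro add_mono mult_right_mono) auto
    also have "\<dots> = (contraction_const * contraction_rate powr t)\<^sup>2 * (norm u)\<^sup>2"
      by (simp add: u2 contraction_const_def m_def D_def power_mult_distrib algebra_simps)
    finally show ?thesis .
  qed
  have "U 0 = u" using J K by (simp add: U_def q0 flip: u_eq)
  with Uv decr field show ?thesis unfolding stabU[symmetric] by blast
qed

text \<open>
  The normal \<open>n\<close> is discontinuous at \<open>w = 0\<close>, but there the two curvature functions agree along the whole orbit, so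
  the coefficient of the rank one part tends to zero.
\<close>
lemma stable_shape_continuous:
  assumes f: "continuous_on S f" and p: "continuous_on S p" and S: "\<And>x. x \<in> S \<Longrightarrow> p x \<in> unit_phase"
  shows "continuous_on S (\<lambda>x. stable_shape (p x) (f x))"
proof -
  have sl: "continuous_on S (\<lambda>x. slope_par (p x))" "continuous_on S (\<lambda>x. slope_perp (p x))"
    using continuous_on_compose2[OF slope_cont(1) p] continuous_on_compose2[OF slope_cont(2) p] S by blast+
  define R where "R = (\<lambda>x. ((slope_par (p x) - slope_perp (p x)) * (plane_normal (p x) \<bullet> f x)) *\<^sub>R plane_normal (p x))"
  have "continuous_on S R"
    unfolding continuous_on_def
  proof
    fix x assume x: "x \<in> S"
    note lims = sl[unfolded continuous_on_def, rule_format, OF x]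
      f[unfolded continuous_on_def, rule_format, OF x] p[unfolded continuous_on_def, rule_format, OF x]
    show "(R \<longlongrightarrow> R x) (at x within S)"
    proof (cases "pw (p x) = 0")
      case False
      then have "((\<lambda>x. plane_normal (p x)) \<longlongrightarrow> plane_normal (p x)) (at x within S)"
        unfolding plane_normal_def by (intro tendsto_intros lims) auto
      then show ?thesis unfolding R_def by (intro tendsto_intros lims)
    next
      case True
      have eq: "slope_par (p x) = slope_perp (p x)"
      proof -
        have w: "pw (orbit (p x) t) = 0" for t
          using orbit_direction[OF S[OF x], of t] True by simp
        then have "(ps (orbit (p x) t))\<^sup>2 = 1" for t
          using orbit(3)[OF S[OF x], of t] by (simp add: unit_phase_iff)
        then have "neg_curv_par (orbit (p x) t) = neg_curv_perp (orbit (p x) t)" for t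
          by (simp add: neg_curv_par_def neg_curv_perp_def)
        then show ?thesis by (simp add: slope_par_def slope_perp_def)
      qed
      have "(R \<longlongrightarrow> 0) (at x within S)"
      proof (rule Lim_null_comparison)
        show "\<forall>\<^sub>F y in at x within S. norm (R y) \<le> \<bar>slope_par (p y) - slope_perp (p y)\<bar> * norm (f y)"
        proof (rule eventually_at_topological[THEN iffD2], intro exI[of _ UNIV] conjI ballI impI)
          fix y assume "y \<in> S"
          have n: "norm (plane_normal (p y)) \<le> 1" by (intro plane_normal_norm_le S \<open>y \<in> S\<close>)
          have "\<bar>plane_normal (p y) \<bullet> f y\<bar> * norm (plane_normal (p y)) \<le> (1 * norm (f y)) * 1"
            using n by (intro mult_mono order_trans[OF Cauchy_Schwarz_ineq2]) (auto intro: mult_mono)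
          then show "norm (R y) \<le> \<bar>slope_par (p y) - slope_perp (p y)\<bar> * norm (f y)"
            unfolding R_def by (simp add: abs_mult mult.assoc mult_left_mono)
        qed auto
        have "((\<lambda>y. \<bar>slope_par (p y) - slope_perp (p y)\<bar> * norm (f y)) \<longlongrightarrow>
            \<bar>slope_par (p x) - slope_perp (p x)\<bar> * norm (f x)) (at x within S)"
          by (intro tendsto_intros lims)
        then show "((\<lambda>y. \<bar>slope_par (p y) - slope_perp (p y)\<bar> * norm (f y)) \<longlongrightarrow> 0) (at x within S)"
          by (simp add: eq)
      qed
      moreover have "R x = 0" by (simp add: R_def eq)
      ultimately show ?thesis by simp
    qed
  qed
  then have "continuous_on S (\<lambda>x. slope_perp (p x) *\<^sub>R f x + R x)"
    by (intro continuous_intros sl f)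
  then show ?thesis by (simp add: stable_shape_def aniso_def R_def)
qed

end

section \<open>Connection and curvature of the warped product\<close>

lemma has_derivative_vecI:
  fixes f :: "'a::real_normed_vector \<Rightarrow> 'b::euclidean_space ^ 'n::finite"
  assumes "\<And>i. ((\<lambda>r. f r $ i) has_derivative (\<lambda>z. f' z $ i)) (at x within S)"
  shows "(f has_derivative f') (at x within S)"
  by (subst has_derivative_componentwise_within)
     (auto simp: Basis_vec_def inner_axis intro!: has_derivative_inner_left assms)

lemma differentiable_vecI:
  fixes f :: "'a::real_normed_vector \<Rightarrow> 'b::euclidean_space ^ 'n::finite"
  assumes "\<And>i. (\<lambda>r. f r $ i) differentiable (at x within S)"
  shows "f differentiable (at x within S)"
proof -
  obtain D where D: "\<And>i. ((\<lambda>r. f r $ i) has_derivative D i) (at x within S)"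
    using assms unfolding differentiable_def by metis
  have "(f has_derivative (\<lambda>z. \<chi> i. D i z)) (at x within S)"
    by (rule has_derivative_vecI) (simp add: D)
  then show ?thesis unfolding differentiable_def by blast
qed

definition dparam :: "real \<times> (real ^ 'n::finite) \<Rightarrow> real \<times> (real ^ 'n) \<Rightarrow> real \<times> (complex ^ 'n)" where
  "dparam q w = (fst w, \<chi> i. of_real (snd w $ i) * (\<i> * cis (snd q $ i)))"

definition dtparam :: "'n::finite phase \<Rightarrow>
    'n phase \<Rightarrow> 'n tangent" where
  "dtparam z z' = (dparam (fst z) (fst z'),
     (ps z', \<chi> i. of_real (pw z' $ i) * (\<i> * cis (py z $ i))
        - of_real (pw z $ i * py z' $ i) * cis (py z $ i)))"

lemma angular_param_derivative: "(angular_param has_derivative dparam q) (at q)"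
  using has_derivative_angular_param[of q] by (simp add: dparam_def[abs_def] case_prod_unfold)

lemma frechet_angular_param: "frechet_derivative angular_param (at q) = dparam q"
  by (rule frechet_derivative_at[OF angular_param_derivative, symmetric])

lemma tangent_map_param: "tangent_map angular_param z = (angular_param (fst z), dparam (fst z) (snd z))"
  by (simp add: tangent_map_def case_prod_unfold frechet_angular_param)

lemma cis_has_derivative:
  assumes "(f has_derivative f') (at x within S)"
  shows "((\<lambda>r. cis (f r)) has_derivative (\<lambda>z. of_real (f' z) * (\<i> * cis (f x)))) (at x within S)"
  using has_derivative_cis[OF assms] by (simp add: scaleR_conv_of_real)

lemma vec_nth_has_derivative:
  assumes "(f has_derivative f') F"
  shows "((\<lambda>r. f r $ i) has_derivative (\<lambda>z. f' z $ i)) F"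
  by (rule bounded_linear.has_derivative[OF bounded_linear_vec_nth assms])

lemma tangent_map_derivative:
  fixes z :: "'n::finite phase"
  shows "(tangent_map angular_param has_derivative dtparam z) (at z)"
proof -
  have "((\<lambda>z. (angular_param (fst z), ps z,
          \<chi> i. of_real (pw z $ i) * (\<i> * cis (py z $ i))))
      has_derivative (\<lambda>z'. (dparam (fst z) (fst z'), ps z',
        \<chi> i. of_real (pw z' $ i) * (\<i> * cis (py z $ i))
        - of_real (pw z $ i * py z' $ i) * cis (py z $ i)))) (at z)"
  proof (intro has_derivative_Pair)
    show "((\<lambda>z. angular_param (fst z)) has_derivative (\<lambda>z'. dparam (fst z) (fst z'))) (at z)"
      by (rule has_derivative_compose[OF _ angular_param_derivative])
         (intro derivative_intros)
    show "((\<lambda>z :: 'n phase.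
        \<chi> i. of_real (pw z $ i) * (\<i> * cis (py z $ i)))
      has_derivative (\<lambda>z'. \<chi> i. of_real (pw z' $ i) * (\<i> * cis (py z $ i))
        - of_real (pw z $ i * py z' $ i) * cis (py z $ i))) (at z)"
    proof (rule has_derivative_vecI)
      fix i
      have "((\<lambda>z :: 'n phase.
          complex_of_real (pw z $ i)) has_derivative (\<lambda>z'. of_real (pw z' $ i))) (at z)"
        by (intro has_derivative_of_real vec_nth_has_derivative has_derivative_snd has_derivative_ident)
      moreover have "((\<lambda>z :: 'n phase. \<i> * cis (py z $ i))
          has_derivative (\<lambda>z'. \<i> * (of_real (py z' $ i) * (\<i> * cis (py z $ i))))) (at z)"
        by (intro has_derivative_mult_right cis_has_derivative vec_nth_has_derivative has_derivative_snd
            has_derivative_fst has_derivative_ident)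
      ultimately have "((\<lambda>z :: 'n phase.
          complex_of_real (pw z $ i) * (\<i> * cis (py z $ i))) has_derivative
          (\<lambda>z'. of_real (pw z $ i) * (\<i> * (of_real (py z' $ i) * (\<i> * cis (py z $ i))))
            + of_real (pw z' $ i) * (\<i> * cis (py z $ i)))) (at z)"
        by (rule has_derivative_mult)
      then show "((\<lambda>z :: 'n phase.
          (\<chi> i. of_real (pw z $ i) * (\<i> * cis (py z $ i))) $ i) has_derivative
        (\<lambda>z'. (\<chi> i. of_real (pw z' $ i) * (\<i> * cis (py z $ i))
        - of_real (pw z $ i * py z' $ i) * cis (py z $ i)) $ i)) (at z)"
        unfolding vec_lambda_beta by (rule has_derivative_eq_rhs) (simp add: fun_eq_iff algebra_simps)
    qed
  qed (intro derivative_intros)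
  moreover have "tangent_map angular_param = (\<lambda>z :: 'n phase.
      (angular_param (fst z), ps z, \<chi> i. of_real (pw z $ i) * (\<i> * cis (py z $ i))))"
    by (simp add: fun_eq_iff tangent_map_param dparam_def)
  ultimately show ?thesis by (simp add: dtparam_def[abs_def])
qed

lemma frechet_tangent_map: "frechet_derivative (tangent_map angular_param) (at z) = dtparam z"
  by (rule frechet_derivative_at[OF tangent_map_derivative, symmetric])

lemma dparam_inj: "dparam q w = dparam q w' \<Longrightarrow> w = w'"
  by (auto simp: dparam_def vec_eq_iff prod_eq_iff)

lemma dtparam_inj: "dtparam z z1 = dtparam z z2 \<Longrightarrow> z1 = z2"
proof -
  assume eq: "dtparam z z1 = dtparam z z2"
  then have 1: "fst z1 = fst z2" by (auto simp: dtparam_def dest: dparam_inj)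
  with eq have "snd z1 = snd z2"
    by (auto simp: dtparam_def vec_eq_iff prod_eq_iff)
  with 1 show ?thesis by (simp add: prod_eq_iff)
qed

lemma exp_cancel:
  "(exp y)\<^sup>2 * (exp (- y) * exp (- y)) = (1 :: real)"
  "exp (- y) * (exp (- y) * (exp y)\<^sup>2) = (1 :: real)"
  by (simp_all add: power2_eq_square exp_minus field_simps)

context warping
begin

definition warp_metric :: "(real \<times> (complex ^ 'n::finite)) metric" where
  "warp_metric = warped_metric flat_metric (\<lambda>x. exp (g x)) flat_metric"

definition coord_metric :: "(real \<times> (real ^ 'n::finite)) metric" where
  "coord_metric = pullback_metric angular_param warp_metric"

lemma coord_metric_eq: "coord_metric q u v = fst u * fst v + (exp (g (fst q)))\<^sup>2 * (snd u \<bullet> snd v)"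
  by (simp add: coord_metric_def warp_metric_def pullback_warped_metric inner_vec_def)

lemma warp_metric_dparam: "warp_metric (angular_param q) (dparam q u) (dparam q v) = coord_metric q u v"
  by (simp add: coord_metric_def pullback_metric_def frechet_angular_param)

lemma coord_metric_derivative:
  "((\<lambda>r. coord_metric r u v) has_derivative (\<lambda>\<xi>. 2 * g1 (fst q) * (exp (g (fst q)))\<^sup>2 * fst \<xi> * (snd u \<bullet> snd v))) (at q)"
  unfolding coord_metric_eq
  by (rule has_derivative_eq_rhs)
     (rule derivative_intros g_has_derivative_comp bounded_linear_imp_has_derivative bounded_linear_fst |
      simp add: fun_eq_iff power2_eq_square algebra_simps)+

lemma coord_metric_frechet:
  "frechet_derivative (\<lambda>r. coord_metric r u v) (at q) = (\<lambda>\<xi>. 2 * g1 (fst q) * (exp (g (fst q)))\<^sup>2 * fst \<xi> * (snd u \<bullet> snd v))"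
  by (rule frechet_derivative_at[OF coord_metric_derivative, symmetric])

lemma christoffel_coord_metric:
  "christoffel coord_metric q u v = (- (g1 (fst q) * (exp (g (fst q)))\<^sup>2 * (snd u \<bullet> snd v)),
     g1 (fst q) *\<^sub>R (fst u *\<^sub>R snd v + fst v *\<^sub>R snd u))" (is "_ = ?z")
  unfolding christoffel_def coord_metric_frechet
proof (rule the_equality)
  show "\<forall>w. coord_metric q ?z w = (2 * g1 (fst q) * (exp (g (fst q)))\<^sup>2 * fst u * (snd v \<bullet> snd w)
      + 2 * g1 (fst q) * (exp (g (fst q)))\<^sup>2 * fst v * (snd u \<bullet> snd w)
      - 2 * g1 (fst q) * (exp (g (fst q)))\<^sup>2 * fst w * (snd u \<bullet> snd v)) / 2"
    by (simp add: coord_metric_eq inner_add_left algebra_simps add_divide_distrib diff_divide_distrib)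
  fix z
  assume z: "\<forall>w. coord_metric q z w = (2 * g1 (fst q) * (exp (g (fst q)))\<^sup>2 * fst u * (snd v \<bullet> snd w)
      + 2 * g1 (fst q) * (exp (g (fst q)))\<^sup>2 * fst v * (snd u \<bullet> snd w)
      - 2 * g1 (fst q) * (exp (g (fst q)))\<^sup>2 * fst w * (snd u \<bullet> snd v)) / 2"
  have eq: "coord_metric q z w = coord_metric q ?z w" for w
    unfolding z[rule_format] by (simp add: coord_metric_eq inner_add_left algebra_simps add_divide_distrib diff_divide_distrib)
  define d where "d = z - ?z"
  have "coord_metric q d d = coord_metric q z d - coord_metric q ?z d"
    by (simp add: coord_metric_eq d_def inner_diff_left algebra_simps)
  then have "coord_metric q d d = 0" using eq[of d] by simp
  moreover have "coord_metric q d d = (fst d)\<^sup>2 + (exp (g (fst q)))\<^sup>2 * (norm (snd d))\<^sup>2"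
    by (simp add: coord_metric_eq power2_eq_square dot_square_norm)
  ultimately have "(fst d)\<^sup>2 + (exp (g (fst q)) * norm (snd d))\<^sup>2 = 0" by (simp add: power_mult_distrib)
  then have "fst d = 0" "exp (g (fst q)) * norm (snd d) = 0" unfolding sum_power2_eq_zero_iff by auto
  then have "d = 0" by (simp add: prod_eq_iff)
  then show "z = ?z" by (simp add: d_def)
qed

lemma christoffel_derivative:
  "((\<lambda>r. christoffel coord_metric r v w) has_derivative
     (\<lambda>\<xi>. (- ((g2 (fst q) + 2 * (g1 (fst q))\<^sup>2) * (exp (g (fst q)))\<^sup>2 * fst \<xi> * (snd v \<bullet> snd w)),
       (g2 (fst q) * fst \<xi>) *\<^sub>R (fst v *\<^sub>R snd w + fst w *\<^sub>R snd v)))) (at q)"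
  unfolding christoffel_coord_metric
  by (rule has_derivative_eq_rhs)
     (rule derivative_intros g_has_derivative_comp g1_has_derivative_comp
       bounded_linear_imp_has_derivative bounded_linear_fst |
      simp add: fun_eq_iff power2_eq_square algebra_simps)+

text \<open>
  The coefficients are \<open>f f''\<close> and \<open>(f f')\<^sup>2\<close> for \<open>f = exp g\<close>.
\<close>
lemma curvature_coord_metric:
  fixes q u v :: "real \<times> (real ^ 'n::finite)"
  shows "coord_metric q (curvature_tensor coord_metric q u v v) u =
     - ((exp (g (fst q)))\<^sup>2 * (g2 (fst q) + (g1 (fst q))\<^sup>2) * (norm (fst u *\<^sub>R snd v - fst v *\<^sub>R snd u))\<^sup>2)
     - ((exp (g (fst q)))\<^sup>2 * g1 (fst q))\<^sup>2 *
         ((norm (snd u))\<^sup>2 * (norm (snd v))\<^sup>2 - (snd u \<bullet> snd v)\<^sup>2)"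
proof -
  have fd: "frechet_derivative (\<lambda>r. christoffel coord_metric r v w) (at q) =
     (\<lambda>\<xi>. (- ((g2 (fst q) + 2 * (g1 (fst q))\<^sup>2) * (exp (g (fst q)))\<^sup>2 * fst \<xi> * (snd v \<bullet> snd w)),
       (g2 (fst q) * fst \<xi>) *\<^sub>R (fst v *\<^sub>R snd w + fst w *\<^sub>R snd v)))" for v w :: "real \<times> (real ^ 'n)"
    by (rule frechet_derivative_at[OF christoffel_derivative, symmetric])
  obtain u0 u1 v0 v1 where uv: "u = (u0, u1)" "v = (v0, v1)" by (metis prod.exhaust)
  define F k k' where "F = (exp (g (fst q)))\<^sup>2" and "k = g1 (fst q)" and "k' = g2 (fst q)"
  define p r t where "p = u1 \<bullet> u1" and "r = u1 \<bullet> v1" and "t = v1 \<bullet> v1"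
  have ip: "u1 \<bullet> u1 = p" "u1 \<bullet> v1 = r" "v1 \<bullet> u1 = r" "v1 \<bullet> v1 = t"
    by (simp_all add: p_def r_def t_def inner_commute)
  show ?thesis
    unfolding curvature_tensor_def fd
    unfolding christoffel_coord_metric coord_metric_eq power2_norm_eq_inner
    unfolding uv fst_conv snd_conv fst_add snd_add fst_diff snd_diff F_def[symmetric] k_def[symmetric] k'_def[symmetric]
    unfolding inner_add_left inner_add_right inner_diff_left inner_diff_right inner_scaleR_left inner_scaleR_right ip
    by (simp add: algebra_simps power2_eq_square)
qed

lemma sectional_curvature_nonpos: "coord_sectional_curvature coord_metric q u v \<le> 0"
proof -
  have num: "coord_metric q (curvature_tensor coord_metric q u v v) u \<le> 0"
  proof -
    have "(snd u \<bullet> snd v)\<^sup>2 \<le> (norm (snd u))\<^sup>2 * (norm (snd v))\<^sup>2"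
      using Cauchy_Schwarz_ineq[of "snd u" "snd v"] by (simp add: dot_square_norm)
    moreover have "g2 (fst q) + (g1 (fst q))\<^sup>2 \<ge> 0" using h_bounds by simp
    ultimately have "(exp (g (fst q)))\<^sup>2 * (g2 (fst q) + (g1 (fst q))\<^sup>2)
          * (norm (fst u *\<^sub>R snd v - fst v *\<^sub>R snd u))\<^sup>2 \<ge> 0"
      "((exp (g (fst q)))\<^sup>2 * g1 (fst q))\<^sup>2 *
         ((norm (snd u))\<^sup>2 * (norm (snd v))\<^sup>2 - (snd u \<bullet> snd v)\<^sup>2) \<ge> 0"
      by (auto intro!: mult_nonneg_nonneg)
    then show ?thesis unfolding curvature_coord_metric by linarith
  qed
  define f where "f = exp (g (fst q))"
  \<comment> \<open>In the orthonormal frame the denominator is a Gram determinant.\<close>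
  define a b where "a = (fst u, f *\<^sub>R snd u)" and "b = (fst v, f *\<^sub>R snd v)"
  have "(a \<bullet> b)\<^sup>2 \<le> (a \<bullet> a) * (b \<bullet> b)" by (rule Cauchy_Schwarz_ineq)
  moreover have "a \<bullet> b = coord_metric q u v" "a \<bullet> a = coord_metric q u u" "b \<bullet> b = coord_metric q v v"
    by (simp_all add: a_def b_def coord_metric_eq inner_prod_def f_def power2_eq_square algebra_simps)
  ultimately have den: "coord_metric q u u * coord_metric q v v - (coord_metric q u v)\<^sup>2 \<ge> 0" by simp
  show ?thesis unfolding coord_sectional_curvature_def
    using num den by (rule divide_nonpos_nonneg)
qed

text \<open>
  Two parameters of the same tangent vector differ by a translation of the angles by multiples of \<open>2 \<pi>\<close>, and the
  derivative of the parametrization and the Christoffel symbols are invariant under it.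
\<close>
lemma connection_map_param:
  "connection_map angular_param warp_metric (tangent_map angular_param z) (dtparam z z')
    = dparam (fst z) (snd z' + christoffel coord_metric (fst z) (fst z') (snd z))"
proof -
  obtain q w where qw: "(SOME y. tangent_map angular_param y = tangent_map angular_param z) = (q, w)"
    by (metis prod.exhaust)
  have "tangent_map angular_param (q, w) = tangent_map angular_param z"
    unfolding qw[symmetric] by (rule someI) (rule refl)
  then have a: "angular_param q = angular_param (fst z)" and d: "dparam q w = dparam (fst z) (snd z)"
    by (simp_all add: tangent_map_param)
  from a have x: "fst q = px z" and c: "cis (snd q $ i) = cis (py z $ i)" for i
    by (auto simp: angular_param_def case_prod_unfold vec_eq_iff)
  have dp: "dparam q = dparam (fst z)" by (simp add: dparam_def fun_eq_iff c)
  with d have w: "w = snd z" by (auto dest: dparam_inj)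
  have dt: "dtparam (q, w) = dtparam z"
    by (simp add: dtparam_def fun_eq_iff c dp w)
  have "(THE y. dtparam z y = dtparam z z') = z'"
    by (rule the_equality) (auto dest: dtparam_inj)
  then show ?thesis
    unfolding connection_map_def qw
    using dt by (simp add: frechet_tangent_map case_prod_unfold frechet_angular_param dp w christoffel_coord_metric x
        flip: coord_metric_def)
qed

text \<open>
  The parametrization of the tangent bundle by phases.
\<close>
definition Theta :: "'n::finite phase \<Rightarrow> 'n tangent" where
  "Theta p = tangent_map angular_param (fst p, (ps p, exp (- g (px p)) *\<^sub>R pw p))"

definition dTheta :: "'n::finite phase \<Rightarrow> 'n phase \<Rightarrow> 'n tangent" where
  "dTheta p \<delta> = dtparam (fst p, (ps p, exp (- g (px p)) *\<^sub>R pw p))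
     (fst \<delta>, (ps \<delta>,
        exp (- g (px p)) *\<^sub>R (pw \<delta> - (g1 (px p) * px \<delta>) *\<^sub>R pw p)))"

lemma Theta_derivative:
  fixes p :: "'n::finite phase"
  shows "(Theta has_derivative dTheta p) (at p)"
  unfolding Theta_def[abs_def]
proof (rule has_derivative_eq_rhs)
  have 1: "((\<lambda>p :: 'n phase. (fst p, (ps p, exp (- g (px p)) *\<^sub>R pw p))) has_derivative
     (\<lambda>\<delta>. (fst \<delta>, (ps \<delta>,
        exp (- g (px p)) *\<^sub>R (pw \<delta> - (g1 (px p) * px \<delta>) *\<^sub>R pw p))))) (at p)"
    by (rule has_derivative_eq_rhs)
       (rule derivative_intros g_has_derivative_comp bounded_linear_imp_has_derivative
         bounded_linear_fst bounded_linear_snd |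
        simp add: fun_eq_iff algebra_simps)+
  from has_derivative_compose[OF this tangent_map_derivative]
  show "((\<lambda>p :: 'n phase. tangent_map angular_param (fst p, (ps p, exp (- g (px p)) *\<^sub>R pw p)))
    has_derivative dTheta p) (at p)"
    by (simp add: dTheta_def[abs_def])
qed simp

lemma connection_map_Theta:
  "connection_map angular_param warp_metric (Theta p) (dTheta p (frame_lift p u \<nu>))
    = dparam (fst p) (fst \<nu>, exp (- g (px p)) *\<^sub>R snd \<nu>)"
  unfolding Theta_def dTheta_def connection_map_param
  by (simp add: frame_lift_def christoffel_coord_metric algebra_simps inner_commute exp_cancel)

abbreviation sasaki :: "'n::finite tangent \<Rightarrow> 'n tangent \<Rightarrow> 'n tangent \<Rightarrow> real" where
  "sasaki \<equiv> sasaki_metric angular_param warp_metric"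

lemma sasaki_Theta:
  fixes p :: "'n::finite phase"
  shows "sasaki (Theta p) (dTheta p (frame_lift p u \<nu>)) (dTheta p (frame_lift p u \<nu>))
    = (norm u)\<^sup>2 + (norm \<nu>)\<^sup>2"
proof -
  have m: "coord_metric (fst p) (fst u, exp (- g (px p)) *\<^sub>R snd u) (fst u, exp (- g (px p)) *\<^sub>R snd u)
      = (norm u)\<^sup>2" for u :: "real \<times> (real ^ 'n)"
    by (simp add: coord_metric_eq power2_norm_eq_inner inner_prod_def exp_cancel)
  have 1: "fst (Theta p) = angular_param (fst p)" by (simp add: Theta_def tangent_map_param)
  have 2: "fst (dTheta p (frame_lift p u \<nu>)) = dparam (fst p) (fst u, exp (- g (px p)) *\<^sub>R snd u)"
    by (simp add: dTheta_def dtparam_def frame_lift_def)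
  show ?thesis
    unfolding sasaki_metric_def connection_map_Theta 1 2 warp_metric_dparam m ..
qed

end

section \<open>Geodesics and the geodesic flow\<close>

lemma has_vector_derivative_compose:
  assumes "(F has_derivative D) (at (\<gamma> t))" "(\<gamma> has_vector_derivative \<tau>) (at t)"
  shows "((\<lambda>t. F (\<gamma> t)) has_vector_derivative D \<tau>) (at t)"
  using vector_derivative_diff_chain_within[OF assms(2) has_derivative_at_withinI[OF assms(1)]]
  by (simp add: o_def)

lemma has_vector_derivative_compose_within:
  assumes F: "(F has_derivative D) (at (\<gamma> t) within S)" and \<gamma>: "(\<gamma> has_vector_derivative \<tau>) (at t)"
    and S: "\<And>t. \<gamma> t \<in> S"
  shows "((\<lambda>t. F (\<gamma> t)) has_vector_derivative D \<tau>) (at t)"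
proof -
  have "(F has_derivative D) (at (\<gamma> t) within \<gamma> ` UNIV)"
    by (rule has_derivative_subset[OF F]) (use S in auto)
  from vector_derivative_diff_chain_within[OF \<gamma> this] show ?thesis by (simp add: o_def)
qed

lemma differential_on_curve:
  assumes F: "F differentiable (at x within S)" and c: "\<And>t. c t \<in> S" "c 0 = x"
    "(c has_vector_derivative \<xi>) (at 0)" and Fc: "((\<lambda>t. F (c t)) has_vector_derivative \<eta>) (at 0)"
  shows "differential_on S F x \<xi> = \<eta>"
proof -
  have "(F has_derivative differential_on S F x) (at (c 0) within S)"
    using F unfolding differential_on_def c(2) by (rule frechet_derivative_works[THEN iffD1])
  from has_vector_derivative_compose_within[OF this c(3,1)] Fc show ?thesis
    by (rule vector_derivative_unique_at)
qed

text \<open>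
  The imaginary part of the logarithm serves as the angle because it is differentiable off the negative half line.
\<close>
lemma cis_Im_Ln: "norm u = 1 \<Longrightarrow> cis (Im (Ln u)) = u"
proof -
  assume u: "norm u = 1"
  then have nz: "u \<noteq> 0" by auto
  then have "u = exp (Ln u)" by simp
  also have "Ln u = \<i> * of_real (Im (Ln u))"
    using u nz by (simp add: complex_eq_iff)
  finally show ?thesis by (simp add: cis_conv_exp)
qed

lemma circle_velocity:
  assumes c: "\<And>t. norm (c t) = 1" and d: "(c has_vector_derivative v) (at t)"
  shows "v = of_real (Im (cnj (c t) * v)) * (\<i> * c t)"
proof -
  have "((\<lambda>t. c t \<bullet> c t) has_real_derivative 2 * (c t \<bullet> v)) (at t)"
    using inner_has_real_derivative[OF d d] by (simp add: inner_commute)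
  moreover have "((\<lambda>t. c t \<bullet> c t) has_real_derivative 0) (at t)"
    using c by (simp add: dot_square_norm)
  ultimately have "c t \<bullet> v = 0" using DERIV_unique by fastforce
  then have "Re (cnj (c t) * v) = 0" by (simp add: inner_complex_def)
  then have "cnj (c t) * v = of_real (Im (cnj (c t) * v)) * \<i>" by (simp add: complex_eq_iff)
  moreover have "v = (c t * cnj (c t)) * v"
    using c[of t] by (simp add: complex_norm_square[symmetric])
  ultimately show ?thesis by (metis mult.assoc mult.commute)
qed

lemma torus_cis: "(\<chi> i. cis (y $ i)) \<in> torus"
  by (simp add: torus_def)

lemma manifold_param: "p \<in> UNIV \<times> torus \<Longrightarrow> \<exists>q. p = angular_param q"
  using range_angular_param by (metis image_iff)

lemma angular_param_in: "angular_param q \<in> UNIV \<times> torus"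
  by (simp add: angular_param_def case_prod_unfold torus_cis)

definition angular_velocity :: "real \<times> (complex ^ 'n::finite) \<Rightarrow> real \<times> (complex ^ 'n) \<Rightarrow> real ^ 'n" where
  "angular_velocity p v = (\<chi> i. Im (cnj (snd p $ i) * (snd v $ i)))"

lemma velocity_dparam:
  assumes c: "\<And>t. c t \<in> UNIV \<times> torus" and d: "(c has_vector_derivative v) (at t)" and q: "c t = angular_param q"
  shows "v = dparam q (fst v, angular_velocity (c t) v)"
proof -
  have "snd v $ i = of_real (Im (cnj (snd (c t) $ i) * (snd v $ i))) * (\<i> * (snd (c t) $ i))" for i
  proof (rule circle_velocity[of "\<lambda>t. snd (c t) $ i"])
    show "norm (snd (c t) $ i) = 1" for t using c[of t] by (auto simp: torus_def)
    show "((\<lambda>t. snd (c t) $ i) has_vector_derivative snd v $ i) (at t)"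
      by (rule bounded_linear.has_vector_derivative[OF bounded_linear_vec_nth])
         (rule bounded_linear.has_vector_derivative[OF bounded_linear_snd d])
  qed
  then show ?thesis
    by (simp add: prod_eq_iff dparam_def vec_eq_iff angular_velocity_def q angular_param_def case_prod_unfold)
qed

lemma angular_velocity_dparam: "angular_velocity (angular_param q) (dparam q w) = snd w"
proof -
  have im: "Im (cnj (cis y) * (of_real b * (\<i> * cis y))) = b" for y b
  proof -
    have "cnj (cis y) * (of_real b * (\<i> * cis y)) = (cnj (cis y) * cis y) * (of_real b * \<i>)"
      by (simp only: ac_simps)
    also have "cnj (cis y) * cis y = 1" by (simp add: cis_cnj cis_mult)
    finally have e: "cnj (cis y) * (of_real b * (\<i> * cis y)) = 1 * (of_real b * \<i>)" .
    show ?thesis unfolding e by simp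
  qed
  show ?thesis
    unfolding angular_velocity_def dparam_def angular_param_def case_prod_unfold fst_conv snd_conv
      vec_lambda_beta im by simp
qed

context warping
begin

lemma geodesic_field_frame_lift: "geodesic_field q = frame_lift q (snd q) 0"
  by (simp add: geodesic_field_def frame_lift_def)

lemma frame_lift_cases:
  obtains u \<nu> where "\<tau> = frame_lift p u \<nu>"
proof
  define u where "u = (px \<tau>, exp (g (px p)) *\<^sub>R py \<tau>)"
  show "\<tau> = frame_lift p u (ps \<tau> - g1 (px p) * (snd u \<bullet> pw p),
      pw \<tau> + (g1 (px p) * ps p) *\<^sub>R snd u)"
    by (simp add: frame_lift_def u_def prod_eq_iff exp_add[symmetric])
qed

lemma frame_lift_tangent: "snd (frame_lift p u \<nu>) \<bullet> snd p = \<nu> \<bullet> snd p"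
  by (simp add: frame_lift_def inner_prod_def inner_diff_left algebra_simps)

definition unit_bundle :: "'n::finite tangent set" where
  "unit_bundle = unit_tangent_bundle (UNIV \<times> torus) warp_metric"

lemma Theta_eq: "Theta p = (angular_param (fst p), dparam (fst p) (ps p, exp (- g (px p)) *\<^sub>R pw p))"
  by (simp add: Theta_def tangent_map_param)

lemma dparam_tangent: "dparam q w \<in> tangent_space (UNIV \<times> torus) (angular_param q)"
  unfolding tangent_space_def
proof (intro CollectI exI[of _ "\<lambda>t. angular_param (q + t *\<^sub>R w)"] conjI allI)
  have "((\<lambda>t. q + t *\<^sub>R w) has_vector_derivative w) (at 0)"
    by (auto intro!: derivative_eq_intros)
  from has_vector_derivative_compose[OF _ this, of angular_param "dparam q"]
  show "((\<lambda>t. angular_param (q + t *\<^sub>R w)) has_vector_derivative dparam q w) (at 0)"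
    by (simp add: angular_param_derivative)
qed (simp_all only: angular_param_in scale_zero_left add_0_right)

lemma unit_bundle_eq: "unit_bundle = Theta ` unit_phase"
proof (intro equalityI subsetI)
  fix \<theta> :: "'n::finite tangent" assume "\<theta> \<in> unit_bundle"
  then obtain p v where \<theta>: "\<theta> = (p, v)" and p: "p \<in> UNIV \<times> torus"
    and v: "v \<in> tangent_space (UNIV \<times> torus) p" and 1: "warp_metric p v v = 1"
    by (auto simp: unit_bundle_def unit_tangent_bundle_def)
  obtain q where q: "p = angular_param q" using manifold_param[OF p] by blast
  obtain c where c: "c 0 = p" "\<And>t. c t \<in> UNIV \<times> torus" "(c has_vector_derivative v) (at 0)"
    using v by (auto simp: tangent_space_def)
  obtain w where w: "v = dparam q w"
    using velocity_dparam[OF c(2,3), of q] c(1) q by blast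
  \<comment> \<open>The coefficients of the vector in the orthonormal frame.\<close>
  define \<pi> where "\<pi> = (q, (fst w, exp (g (fst q)) *\<^sub>R snd w))"
  have "Theta \<pi> = \<theta>" by (simp add: Theta_eq \<pi>_def \<theta> q w exp_add[symmetric])
  moreover have "\<pi> \<in> unit_phase"
    using 1 by (simp add: w q warp_metric_dparam coord_metric_eq unit_phase_iff \<pi>_def power2_eq_square mult.assoc)
  ultimately show "\<theta> \<in> Theta ` unit_phase" by blast
next
  fix \<theta> :: "'n::finite tangent" assume "\<theta> \<in> Theta ` unit_phase"
  then obtain p where p: "p \<in> unit_phase" "\<theta> = Theta p" by blast
  have "coord_metric (fst p) (ps p, exp (- g (px p)) *\<^sub>R pw p)
      (ps p, exp (- g (px p)) *\<^sub>R pw p) = 1"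
    using p(1) by (simp add: coord_metric_eq unit_phase_iff power2_eq_square mult.assoc[symmetric] exp_add[symmetric])
  then show "\<theta> \<in> unit_bundle"
    unfolding unit_bundle_def unit_tangent_bundle_def p(2) Theta_eq
    by (simp only: case_prod_conv mem_Collect_eq warp_metric_dparam dparam_tangent angular_param_in simp_thms)
qed

text \<open>
  A right inverse of \<open>Theta\<close> on the unit tangent bundle. The branch of the angles is centred at \<open>Y\<close>, so that it is
  differentiable at the phases with torus coordinate \<open>Y\<close>.
\<close>
definition chart :: "real ^ 'n::finite \<Rightarrow> 'n tangent \<Rightarrow> 'n phase" where
  "chart Y \<theta> = ((px \<theta>, \<chi> i. Y $ i + Im (Ln (py \<theta> $ i * cis (- (Y $ i))))),
     (ps \<theta>, exp (g (px \<theta>)) *\<^sub>R angular_velocity (fst \<theta>) (snd \<theta>)))"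

lemma chart_snd: "snd (chart Y (Theta p)) = snd p"
  unfolding chart_def Theta_eq fst_conv snd_conv angular_velocity_dparam
  by (simp add: angular_param_def dparam_def case_prod_unfold exp_add[symmetric] prod_eq_iff)

lemma chart_fst: "px (chart Y (Theta p)) = px p"
  by (simp add: chart_def Theta_eq angular_param_def case_prod_unfold)

lemma chart_cis: "cis (py (chart Y (Theta p)) $ i) = cis (py p $ i)"
proof -
  have "cis (Im (Ln (cis (py p $ i) * cis (- (Y $ i))))) = cis (py p $ i) * cis (- (Y $ i))"
    by (rule cis_Im_Ln) (simp add: norm_mult)
  then show ?thesis
    by (simp add: chart_def Theta_eq angular_param_def case_prod_unfold flip: cis_mult)
       (simp add: cis_mult)
qed

lemma Theta_cong:
  assumes "px p = px p'" "\<And>i. cis (py p $ i) = cis (py p' $ i)" "snd p = snd p'"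
  shows "Theta p = Theta p'"
  using assms by (simp add: Theta_eq angular_param_def dparam_def case_prod_unfold)

lemma Theta_chart: "Theta (chart Y (Theta p)) = Theta p"
  by (rule Theta_cong) (simp_all add: chart_snd chart_fst chart_cis)

lemma chart_Theta: "chart (py p) (Theta p) = p"
proof -
  have "py (chart (py p) (Theta p)) = py p"
    by (simp add: chart_def Theta_eq angular_param_def case_prod_unfold vec_eq_iff cis_mult)
  then show ?thesis using chart_snd[of "py p" p] chart_fst[of "py p" p]
    by (simp add: prod_eq_iff)
qed

lemma chart_unit: "p \<in> unit_phase \<Longrightarrow> chart Y (Theta p) \<in> unit_phase"
  by (simp add: unit_phase_def chart_snd)

lemma chart_differentiable: "chart (py p) differentiable (at (Theta p))"
proof -
  let ?\<theta> = "Theta p" and ?Y = "py p"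
  have z: "py ?\<theta> $ i * cis (- (?Y $ i)) = 1" for i
    by (simp add: Theta_eq angular_param_def case_prod_unfold cis_mult)
  have coord: "((\<lambda>\<theta>. py \<theta> $ i) has_derivative (\<lambda>\<xi>. py \<xi> $ i)) (at ?\<theta>)"
    "((\<lambda>\<theta>. pw \<theta> $ i) has_derivative (\<lambda>\<xi>. pw \<xi> $ i)) (at ?\<theta>)" for i
    by (intro vec_nth_has_derivative has_derivative_snd has_derivative_fst has_derivative_ident)+
  have "((\<lambda>\<theta>. py \<theta> $ i * cis (- (?Y $ i))) has_derivative (\<lambda>\<xi>. py \<xi> $ i * cis (- (?Y $ i)))) (at ?\<theta>)" for i
    by (intro has_derivative_mult_left coord)
  moreover have "(Ln has_derivative (*) (inverse 1)) (at (py ?\<theta> $ i * cis (- (?Y $ i))))" for i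
    unfolding z has_field_derivative_def[symmetric] by (rule has_field_derivative_Ln) simp
  ultimately have "((\<lambda>\<theta>. Ln (py \<theta> $ i * cis (- (?Y $ i)))) has_derivative
      (\<lambda>\<xi>. inverse 1 * (py \<xi> $ i * cis (- (?Y $ i))))) (at ?\<theta>)" for i
    by (rule has_derivative_compose)
  then have "(\<lambda>\<theta>. Im (Ln (py \<theta> $ i * cis (- (?Y $ i))))) differentiable (at ?\<theta>)" for i
    by (intro differentiableI[OF has_derivative_Im])
  then have 1: "(\<lambda>\<theta>. ?Y $ i + Im (Ln (py \<theta> $ i * cis (- (?Y $ i))))) differentiable (at ?\<theta>)" for i
    by (intro differentiable_add differentiable_const)
  have "((\<lambda>\<theta>. cnj (py \<theta> $ i)) has_derivative (\<lambda>\<xi>. cnj (py \<xi> $ i))) (at ?\<theta>)" for i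
    by (intro has_derivative_cnj coord)
  from differentiableI[OF has_derivative_Im[OF has_derivative_mult[OF this coord(2)]]]
  have 2: "(\<lambda>\<theta>. Im (cnj (py \<theta> $ i) * (pw \<theta> $ i))) differentiable (at ?\<theta>)" for i .
  have "((\<lambda>\<theta>. px \<theta>) has_derivative (\<lambda>\<xi>. px \<xi>)) (at ?\<theta>)"
    by (intro has_derivative_fst has_derivative_ident)
  from g_has_derivative_comp[OF this]
  have 3: "(\<lambda>\<theta>. exp (g (px \<theta>))) differentiable (at ?\<theta>)"
    by (intro differentiableI[OF has_derivative_exp])
  have 4: "(\<lambda>\<theta>. px \<theta>) differentiable (at ?\<theta>)" "(\<lambda>\<theta>. ps \<theta>) differentiable (at ?\<theta>)"
    by (rule differentiableI, (rule has_derivative_fst has_derivative_snd has_derivative_ident)+)+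
  have pair: "(\<lambda>\<theta>. (a \<theta>, b \<theta>)) differentiable (at ?\<theta>)"
    if "a differentiable (at ?\<theta>)" "b differentiable (at ?\<theta>)"
    for a :: "_ \<Rightarrow> 'x::real_normed_vector" and b :: "_ \<Rightarrow> 'y::real_normed_vector"
    using that unfolding differentiable_def by (blast intro: has_derivative_Pair)
  show ?thesis
    unfolding chart_def[abs_def] angular_velocity_def
    by (rule pair, rule pair, rule 4, rule differentiable_vecI, simp only: vec_lambda_beta 1,
        rule pair, rule 4, rule differentiable_scaleR, rule 3, rule differentiable_vecI,
        simp only: vec_lambda_beta 2)
qed

lemma unit_phase_curve:
  assumes p: "p \<in> unit_phase" and \<tau>: "snd \<tau> \<bullet> snd p = 0"
  obtains \<gamma> where "\<gamma> 0 = p" "\<And>s. \<gamma> s \<in> unit_phase" "(\<gamma> has_vector_derivative \<tau>) (at 0)"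
proof
  define c where "c = (norm (snd \<tau>))\<^sup>2"
  define k where "k = (\<lambda>s. inverse (sqrt (1 + s\<^sup>2 * c)))"
  define \<gamma> where "\<gamma> = (\<lambda>s. (fst p + s *\<^sub>R fst \<tau>, k s *\<^sub>R (snd p + s *\<^sub>R snd \<tau>)))"
  have c: "c \<ge> 0" by (simp add: c_def)
  then have pos: "1 + s\<^sup>2 * c > 0" for s
    by (metis add_pos_nonneg mult_nonneg_nonneg zero_le_power2 zero_less_one)
  have k0: "k 0 = 1" by (simp add: k_def)
  show "\<gamma> 0 = p" by (simp add: \<gamma>_def k0)
  show "\<gamma> s \<in> unit_phase" for s
  proof -
    have "(norm (snd p + s *\<^sub>R snd \<tau>))\<^sup>2 = 1 + s\<^sup>2 * c"
      using p \<tau> unfolding power2_norm_eq_inner c_def unit_phase_def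
      by (simp add: inner_add_left inner_add_right inner_commute power2_eq_square norm_eq_1)
    then have "norm (snd p + s *\<^sub>R snd \<tau>) = sqrt (1 + s\<^sup>2 * c)"
      by (metis norm_ge_zero real_sqrt_unique)
    moreover have "sqrt (1 + s\<^sup>2 * c) > 0" using pos by simp
    ultimately show ?thesis by (simp add: unit_phase_def \<gamma>_def k_def)
  qed
  have dk: "(k has_real_derivative 0) (at 0)"
    unfolding k_def by (rule derivative_eq_intros refl | simp)+
  show "(\<gamma> has_vector_derivative \<tau>) (at 0)"
  proof -
    have "((\<lambda>s. k s *\<^sub>R (snd p + s *\<^sub>R snd \<tau>)) has_vector_derivative
        k 0 *\<^sub>R snd \<tau> + 0 *\<^sub>R (snd p + 0 *\<^sub>R snd \<tau>)) (at 0)"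
      by (rule has_vector_derivative_scaleR[OF dk]) (auto intro!: derivative_eq_intros)
    moreover have "((\<lambda>s. fst p + s *\<^sub>R fst \<tau>) has_vector_derivative fst \<tau>) (at 0)"
      by (auto intro!: derivative_eq_intros)
    ultimately have "(\<gamma> has_vector_derivative (fst \<tau>, k 0 *\<^sub>R snd \<tau> + 0 *\<^sub>R (snd p + 0 *\<^sub>R snd \<tau>))) (at 0)"
      unfolding \<gamma>_def by (intro has_vector_derivative_Pair)
    then show ?thesis by (simp add: k0)
  qed
qed

text \<open>
  Curves in the bundle are pushed to phases by \<open>chart\<close>, and unit speed becomes orthogonality to the velocity.
\<close>
lemma tangent_space_unit_bundle:
  assumes p: "p \<in> unit_phase"
  shows "tangent_space unit_bundle (Theta p) = {dTheta p (frame_lift p u \<nu>) | u \<nu>. \<nu> \<bullet> snd p = 0}"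
proof (intro equalityI subsetI)
  fix \<xi> assume "\<xi> \<in> tangent_space unit_bundle (Theta p)"
  then obtain c where c: "c 0 = Theta p" "\<And>t. c t \<in> unit_bundle" "(c has_vector_derivative \<xi>) (at 0)"
    by (auto simp: tangent_space_def)
  obtain D where D: "(chart (py p) has_derivative D) (at (c 0))"
    using chart_differentiable[of p] c(1) by (auto simp: differentiable_def)
  define \<gamma> where "\<gamma> = (\<lambda>t. chart (py p) (c t))"
  have \<gamma>0: "\<gamma> 0 = p" by (simp add: \<gamma>_def c chart_Theta)
  have \<gamma>u: "\<gamma> t \<in> unit_phase" and \<gamma>c: "Theta (\<gamma> t) = c t" for t
    using c(2)[of t] by (auto simp: \<gamma>_def unit_bundle_eq chart_unit Theta_chart)
  have d\<gamma>: "(\<gamma> has_vector_derivative D \<xi>) (at 0)"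
    unfolding \<gamma>_def by (rule has_vector_derivative_compose[OF D c(3)])
  have "((\<lambda>t. Theta (\<gamma> t)) has_vector_derivative dTheta p (D \<xi>)) (at 0)"
    by (rule has_vector_derivative_compose[OF _ d\<gamma>]) (simp add: \<gamma>0 Theta_derivative)
  then have \<xi>: "\<xi> = dTheta p (D \<xi>)"
    using c(3) unfolding \<gamma>c by (metis vector_derivative_unique_at)
  obtain u \<nu> where l: "D \<xi> = frame_lift p u \<nu>" using frame_lift_cases by blast
  have "((\<lambda>t. snd (\<gamma> t) \<bullet> snd (\<gamma> t)) has_real_derivative 2 * (snd (D \<xi>) \<bullet> snd p)) (at 0)"
    using inner_has_real_derivative[OF bounded_linear.has_vector_derivative[OF bounded_linear_snd d\<gamma>]
        bounded_linear.has_vector_derivative[OF bounded_linear_snd d\<gamma>]]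
    by (simp add: inner_commute \<gamma>0)
  moreover have "snd (\<gamma> t) \<bullet> snd (\<gamma> t) = 1" for t
    using \<gamma>u[of t] by (simp add: unit_phase_def norm_eq_1)
  ultimately have "snd (D \<xi>) \<bullet> snd p = 0"
    using DERIV_unique[OF _ DERIV_const] by fastforce
  then have "\<nu> \<bullet> snd p = 0" by (simp add: l frame_lift_tangent)
  then show "\<xi> \<in> {dTheta p (frame_lift p u \<nu>) | u \<nu>. \<nu> \<bullet> snd p = 0}" using \<xi> unfolding l by blast
next
  fix \<xi> assume "\<xi> \<in> {dTheta p (frame_lift p u \<nu>) | u \<nu>. \<nu> \<bullet> snd p = 0}"
  then obtain u \<nu> where \<xi>: "\<xi> = dTheta p (frame_lift p u \<nu>)" "\<nu> \<bullet> snd p = 0" by blast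
  obtain \<gamma> where \<gamma>: "\<gamma> 0 = p" "\<And>s. \<gamma> s \<in> unit_phase" "(\<gamma> has_vector_derivative frame_lift p u \<nu>) (at 0)"
    using unit_phase_curve[OF p, of "frame_lift p u \<nu>"] \<xi>(2) by (auto simp: frame_lift_tangent)
  have "((\<lambda>t. Theta (\<gamma> t)) has_vector_derivative \<xi>) (at 0)"
    unfolding \<xi> by (rule has_vector_derivative_compose[OF _ \<gamma>(3)]) (simp add: \<gamma>(1) Theta_derivative)
  then show "\<xi> \<in> tangent_space unit_bundle (Theta p)"
    unfolding tangent_space_def using \<gamma> by (auto simp: unit_bundle_eq intro!: exI[of _ "\<lambda>t. Theta (\<gamma> t)"])
qed

lemma Theta_curve:
  assumes "integral_curve geodesic_field u"
  shows "((\<lambda>t. Theta (u t)) has_vector_derivative dTheta (u t) (geodesic_field (u t))) (at t)"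
  by (rule has_vector_derivative_compose[OF Theta_derivative assms[unfolded integral_curve_def, rule_format]])

lemma fst_dTheta_geodesic_field: "fst (dTheta p (geodesic_field p)) = snd (Theta p)"
  by (simp add: dTheta_def dtparam_def Theta_eq geodesic_field_def)

lemma dTheta_zero_frame_lift: "dparam (fst p) (fst \<nu>, exp (- g (px p)) *\<^sub>R snd \<nu>) = 0 \<Longrightarrow> \<nu> = 0"
  by (auto simp: dparam_def prod_eq_iff vec_eq_iff)

lemma orbit_geodesic:
  assumes p: "p \<in> unit_phase"
  shows "geodesic_from (UNIV \<times> torus) angular_param warp_metric (Theta p) (\<lambda>t. fst (Theta (orbit p t)))"
    "((\<lambda>t. fst (Theta (orbit p t))) has_vector_derivative snd (Theta (orbit p t))) (at t)"
proof -
  note d = Theta_curve[OF orbit(2)[OF p]]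
  have 1: "((\<lambda>t. fst (Theta (orbit p t))) has_vector_derivative snd (Theta (orbit p t))) (at t)" for t
    using bounded_linear.has_vector_derivative[OF bounded_linear_fst d, of t] by (simp add: fst_dTheta_geodesic_field)
  then show "((\<lambda>t. fst (Theta (orbit p t))) has_vector_derivative snd (Theta (orbit p t))) (at t)" .
  have 2: "((\<lambda>t. snd (Theta (orbit p t))) has_vector_derivative
      snd (dTheta (orbit p t) (geodesic_field (orbit p t)))) (at t)" for t
    by (rule bounded_linear.has_vector_derivative[OF bounded_linear_snd d])
  have 3: "connection_map angular_param warp_metric (fst (Theta (orbit p t)), snd (Theta (orbit p t)))
      (snd (Theta (orbit p t)), snd (dTheta (orbit p t) (geodesic_field (orbit p t)))) = 0" for t
  proof -
    have eq: "(snd (Theta (orbit p t)), snd (dTheta (orbit p t) (geodesic_field (orbit p t))))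
        = dTheta (orbit p t) (frame_lift (orbit p t) (snd (orbit p t)) 0)"
      unfolding geodesic_field_frame_lift[symmetric] by (simp add: prod_eq_iff fst_dTheta_geodesic_field)
    show ?thesis
      unfolding eq prod.collapse connection_map_Theta by (simp add: dparam_def prod_eq_iff vec_eq_iff)
  qed
  have 4: "fst (Theta (orbit p t)) \<in> UNIV \<times> torus" for t
    by (simp only: Theta_eq fst_conv angular_param_in)
  have "geodesic (UNIV \<times> torus) angular_param warp_metric (\<lambda>t. fst (Theta (orbit p t)))"
    unfolding geodesic_def
    by (rule exI[of _ "\<lambda>t. snd (Theta (orbit p t))"],
        rule exI[of _ "\<lambda>t. snd (dTheta (orbit p t) (geodesic_field (orbit p t)))"], intro allI conjI 1 2 3 4)
  then show "geodesic_from (UNIV \<times> torus) angular_param warp_metric (Theta p) (\<lambda>t. fst (Theta (orbit p t)))"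
    unfolding geodesic_from_def using vector_derivative_at[OF 1[of 0]] by (simp add: orbit(1)[OF p])
qed

text \<open>
  A geodesic is lifted to phases by integrating its angular velocities. The lifted curve satisfies the geodesic equation in
  the frame, because the connection map vanishes exactly if the vertical part does; uniqueness of integral curves
  applies to it.
\<close>
lemma geodesic_is_orbit:
  fixes p :: "'n::finite phase"
  assumes p: "p \<in> unit_phase" and c: "geodesic_from (UNIV \<times> torus) angular_param warp_metric (Theta p) c"
  shows "c = (\<lambda>t. fst (Theta (orbit p t)))"
proof -
  obtain c' c'' where cP: "\<And>t. c t \<in> UNIV \<times> torus"
    and dc: "\<And>t. (c has_vector_derivative c' t) (at t)"
    and dc': "\<And>t. (c' has_vector_derivative c'' t) (at t)"
    and conn: "\<And>t. connection_map angular_param warp_metric (c t, c' t) (c' t, c'' t) = 0"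
    and c0: "c 0 = fst (Theta p)" and "vector_derivative c (at 0) = snd (Theta p)"
    using c unfolding geodesic_from_def geodesic_def by blast
  then have c'0: "c' 0 = snd (Theta p)" using vector_derivative_at by metis
  have dz: "((\<lambda>t. snd (c t) $ i) has_vector_derivative snd (c' t) $ i) (at t)"
    and dz': "((\<lambda>t. snd (c' t) $ i) has_vector_derivative snd (c'' t) $ i) (at t)" for i t
    using bounded_linear.has_vector_derivative[OF bounded_linear_vec_nth
        bounded_linear.has_vector_derivative[OF bounded_linear_snd dc]]
      bounded_linear.has_vector_derivative[OF bounded_linear_vec_nth
        bounded_linear.has_vector_derivative[OF bounded_linear_snd dc']] by auto
  define \<eta> where "\<eta> = (\<lambda>t. angular_velocity (c t) (c' t))"
  define \<eta>' where "\<eta>' = (\<lambda>t. \<chi> i. Im (cnj (snd (c t) $ i) * (snd (c'' t) $ i) + cnj (snd (c' t) $ i) * (snd (c' t) $ i)))"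
  have d\<eta>: "(\<eta> has_vector_derivative \<eta>' t) (at t)" for t
    unfolding has_vector_derivative_def
  proof (rule has_derivative_vecI)
    fix i
    have "((\<lambda>t. Im (cnj (snd (c t) $ i) * (snd (c' t) $ i))) has_vector_derivative
        Im (cnj (snd (c t) $ i) * (snd (c'' t) $ i) + cnj (snd (c' t) $ i) * (snd (c' t) $ i))) (at t)"
      by (intro bounded_linear.has_vector_derivative[OF bounded_linear_Im] has_vector_derivative_mult
          has_vector_derivative_cnj dz dz')
    then show "((\<lambda>r. \<eta> r $ i) has_derivative (\<lambda>z. (z *\<^sub>R \<eta>' t) $ i)) (at t)"
      by (simp add: \<eta>_def \<eta>'_def angular_velocity_def has_vector_derivative_def)
  qed
  have "continuous_on UNIV \<eta>"
    using d\<eta> has_vector_derivative_continuous by (fastforce simp: continuous_on_eq_continuous_at)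
  from antiderivative_exists[OF this] obtain G where G: "G 0 = 0" "\<And>t. (G has_vector_derivative \<eta> t) (at t)"
    by blast
  define Y where "Y = (\<lambda>t. py p + G t)"
  have dY: "(Y has_vector_derivative \<eta> t) (at t)" for t
    unfolding Y_def using G(2) by (auto intro!: derivative_eq_intros)
  have z_eq: "snd (c t) $ i = cis (Y t $ i)" for t i
  proof -
    let ?k = "\<lambda>t. snd (c t) $ i * cis (- (Y t $ i))"
    have norm1: "norm (snd (c t) $ i) = 1" for t using cP[of t] by (auto simp: torus_def)
    have dYi: "((\<lambda>t. - (Y t $ i)) has_derivative (\<lambda>s. - (s * \<eta> t $ i))) (at t)" for t
      using bounded_linear.has_vector_derivative[OF bounded_linear_vec_nth dY[of t], of i]
      by (auto simp: has_vector_derivative_def intro!: derivative_eq_intros)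
    have dcis: "((\<lambda>t. cis (- (Y t $ i))) has_vector_derivative - (of_real (\<eta> t $ i) * (\<i> * cis (- (Y t $ i))))) (at t)" for t
      using cis_has_derivative[OF dYi[of t]]
      by (simp add: has_vector_derivative_def scaleR_conv_of_real algebra_simps)
    have "(?k has_vector_derivative 0) (at t within UNIV)" for t
    proof -
      have v: "snd (c' t) $ i = of_real (\<eta> t $ i) * (\<i> * (snd (c t) $ i))"
        using circle_velocity[of "\<lambda>t. snd (c t) $ i", OF norm1 dz]
        by (simp add: \<eta>_def angular_velocity_def)
      have "(?k has_vector_derivative snd (c t) $ i * - (of_real (\<eta> t $ i) * (\<i> * cis (- (Y t $ i))))
          + snd (c' t) $ i * cis (- (Y t $ i))) (at t)"
        by (intro has_vector_derivative_mult dz dcis)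
      then show ?thesis unfolding v by (simp add: algebra_simps)
    qed
    then obtain k where k: "\<And>t. t \<in> UNIV \<Longrightarrow> ?k t = k"
      using has_vector_derivative_zero_constant[OF convex_UNIV, of ?k] by blast
    have "?k 0 = 1" by (simp add: c0 Theta_eq angular_param_def case_prod_unfold Y_def G cis_mult)
    then have "?k t = 1" using k[of t] k[of 0] by simp
    then have "?k t * cis (Y t $ i) = cis (Y t $ i)" by simp
    then show ?thesis by (simp add: mult.assoc cis_mult)
  qed
  have c_param: "c t = angular_param (fst (c t), Y t)" for t
    by (simp add: angular_param_def prod_eq_iff vec_eq_iff z_eq)
  have c'_param: "c' t = dparam (fst (c t), Y t) (fst (c' t), \<eta> t)" for t
    unfolding \<eta>_def by (rule velocity_dparam[OF cP dc c_param])
  define u where "u = (\<lambda>t. ((fst (c t), Y t), (fst (c' t), exp (g (fst (c t))) *\<^sub>R \<eta> t)))"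
  have Theta_u: "Theta (u t) = (c t, c' t)" for t
    using c_param[of t] c'_param[of t] by (simp add: Theta_eq u_def exp_add[symmetric])
  have dx: "((\<lambda>t. fst (c t)) has_vector_derivative fst (c' t)) (at t)"
    and dx': "((\<lambda>t. fst (c' t)) has_vector_derivative fst (c'' t)) (at t)" for t
    by (rule bounded_linear.has_vector_derivative[OF bounded_linear_fst] dc dc')+
  have "\<exists>u'. (u has_vector_derivative u') (at t)" for t
  proof -
    have "((\<lambda>t. exp (g (fst (c t)))) has_real_derivative exp (g (fst (c t))) * (g1 (fst (c t)) * fst (c' t))) (at t)"
      using dx[of t] unfolding has_real_derivative_iff_has_vector_derivative[symmetric]
      by (auto intro!: derivative_eq_intros DERIV_chain2[OF g])
    from has_vector_derivative_Pair[OF has_vector_derivative_Pair[OF dx dY]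
        has_vector_derivative_Pair[OF dx' has_vector_derivative_scaleR[OF this d\<eta>]]]
    show ?thesis unfolding u_def by blast
  qed
  then obtain u' where du: "\<And>t. (u has_vector_derivative u' t) (at t)" by metis
  have "u' t = geodesic_field (u t)" for t
  proof -
    have "((\<lambda>t. Theta (u t)) has_vector_derivative dTheta (u t) (u' t)) (at t)"
      by (rule has_vector_derivative_compose[OF Theta_derivative du])
    moreover have "((\<lambda>t. Theta (u t)) has_vector_derivative (c' t, c'' t)) (at t)"
      unfolding Theta_u by (intro has_vector_derivative_Pair dc dc')
    ultimately have eq: "dTheta (u t) (u' t) = (c' t, c'' t)" by (rule vector_derivative_unique_at)
    obtain a \<nu> where l: "u' t = frame_lift (u t) a \<nu>" using frame_lift_cases by blast
    have "dparam (fst (u t)) (fst \<nu>, exp (- g (px (u t))) *\<^sub>R snd \<nu>) = 0"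
      using conn[of t] connection_map_Theta[of "u t" a \<nu>] by (simp add: Theta_u flip: l) (simp add: eq)
    then have "\<nu> = 0" by (rule dTheta_zero_frame_lift)
    have "fst (dTheta (u t) (u' t)) = snd (Theta (u t))" by (simp add: eq Theta_u)
    then have "dparam (fst (u t)) (fst a, exp (- g (px (u t))) *\<^sub>R snd a)
        = dparam (fst (u t)) (ps (u t), exp (- g (px (u t))) *\<^sub>R pw (u t))"
      unfolding l by (simp add: dTheta_def dtparam_def frame_lift_def Theta_eq)
    from dparam_inj[OF this] have "a = snd (u t)" by (simp add: prod_eq_iff)
    with \<open>\<nu> = 0\<close> show ?thesis by (simp add: l geodesic_field_frame_lift)
  qed
  then have ic: "integral_curve geodesic_field u" using du by (simp add: integral_curve_def)
  have u0: "u 0 = p"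
  proof -
    have "snd (chart (py p) (Theta (u 0))) = snd (u 0)" "px (chart (py p) (Theta (u 0))) = px (u 0)"
      by (rule chart_snd chart_fst)+
    moreover have "Theta (u 0) = Theta p" by (simp add: Theta_u c0 c'0)
    ultimately show ?thesis by (simp add: chart_snd chart_fst prod_eq_iff) (simp add: u_def Y_def G)
  qed
  have "u = orbit p" using orbit_unique[OF ic] u0 p by simp
  then show ?thesis using Theta_u by (metis fst_conv)
qed

definition flow :: "real \<Rightarrow> 'n::finite tangent \<Rightarrow>
    'n tangent" where
  "flow = geodesic_flow (UNIV \<times> torus) angular_param warp_metric"

abbreviation Dflow :: "real \<Rightarrow> 'n::finite tangent \<Rightarrow> 'n tangent \<Rightarrow> 'n tangent" where
  "Dflow t \<equiv> differential_on unit_bundle (flow t)"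

lemma complete: "geodesically_complete (UNIV \<times> torus) angular_param (warp_metric :: (real \<times> (complex ^ 'n::finite)) metric)"
  unfolding geodesically_complete_def unit_bundle_def[symmetric] unit_bundle_eq
  using orbit_geodesic(1) geodesic_is_orbit by blast

lemma flow_Theta:
  assumes p: "p \<in> unit_phase"
  shows "flow t (Theta p) = Theta (orbit p t)"
proof -
  have "(THE c. geodesic_from (UNIV \<times> torus) angular_param warp_metric (Theta p) c) = (\<lambda>t. fst (Theta (orbit p t)))"
    by (rule the_equality, rule orbit_geodesic(1)[OF p], rule geodesic_is_orbit[OF p])
  then show ?thesis
    unfolding flow_def geodesic_flow_def Let_def
    using vector_derivative_at[OF orbit_geodesic(2)[OF p]] by simp
qed

text \<open>
  On the unit tangent bundle the flow is \<open>Theta\<close> after the orbit map after \<open>chart\<close>, for each choice of the branch.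
\<close>
lemma flow_differentiable_on: "flow t differentiable_on unit_bundle"
  unfolding differentiable_on_def unit_bundle_eq
proof
  fix \<theta> assume "\<theta> \<in> Theta ` (unit_phase :: 'a phase set)"
  then obtain p :: "'a phase" where p: "p \<in> unit_phase" "\<theta> = Theta p" by blast
  let ?Y = "py p"
  obtain DL where DL: "(chart ?Y has_derivative DL) (at (Theta p) within Theta ` unit_phase)"
    using chart_differentiable[of p] by (auto simp: differentiable_def intro: has_derivative_at_withinI)
  obtain Do where Do: "((\<lambda>a. orbit a t) has_derivative Do) (at p within unit_phase)"
    using orbit_differentiable[OF p(1)] by blast
  have "((\<lambda>a. orbit a t) has_derivative Do) (at (chart ?Y (Theta p)) within chart ?Y ` Theta ` unit_phase)"
    unfolding chart_Theta by (rule has_derivative_subset[OF Do]) (auto simp: chart_unit)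
  from has_derivative_in_compose[OF DL this]
  have "((\<lambda>x. orbit (chart ?Y x) t) has_derivative (\<lambda>x. Do (DL x))) (at (Theta p) within Theta ` unit_phase)" .
  from has_derivative_compose[OF this Theta_derivative]
  have "((\<lambda>x. Theta (orbit (chart ?Y x) t)) has_derivative
      (\<lambda>x. dTheta (orbit (chart ?Y (Theta p)) t) (Do (DL x)))) (at (Theta p) within Theta ` unit_phase)" .
  then have "(flow t has_derivative (\<lambda>x. dTheta (orbit (chart ?Y (Theta p)) t) (Do (DL x))))
      (at (Theta p) within Theta ` unit_phase)"
  proof (rule has_derivative_transform[rotated 2])
    fix x assume "x \<in> Theta ` (unit_phase :: 'a phase set)"
    then obtain a :: "'a phase" where a: "a \<in> unit_phase" "x = Theta a" by blast
    then show "flow t x = Theta (orbit (chart ?Y x) t)"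
      using flow_Theta[OF chart_unit[OF a(1)], of t ?Y] by (simp add: Theta_chart)
  qed (use p in auto)
  then show "flow t differentiable at \<theta> within Theta ` unit_phase"
    using p by (auto simp: differentiable_def)
qed

text \<open>
  Evaluated along a curve of unit phases with the given velocity, because \<open>chart\<close> inverts \<open>Theta\<close> only near one phase.
\<close>
lemma flow_differential:
  assumes p: "p \<in> unit_phase" and \<delta>: "\<And>\<tau>. (\<delta> has_vector_derivative d_geodesic_field (orbit p \<tau>) (\<delta> \<tau>)) (at \<tau>)"
    and 0: "snd (\<delta> 0) \<bullet> snd p = 0"
  shows "Dflow t (Theta p) (dTheta p (\<delta> 0)) = dTheta (orbit p t) (\<delta> t)"
proof -
  obtain \<gamma> where \<gamma>: "\<gamma> 0 = p" "\<And>s. \<gamma> s \<in> unit_phase" "(\<gamma> has_vector_derivative \<delta> 0) (at 0)"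
    using unit_phase_curve[OF p 0] by blast
  obtain D where D: "((\<lambda>a. orbit a t) has_derivative D) (at (\<gamma> 0) within unit_phase)" "D (\<delta> 0) = \<delta> t"
    using orbit_differentiable[OF p, of t] \<delta> unfolding \<gamma>(1) by blast
  show ?thesis
  proof (rule differential_on_curve[where c = "\<lambda>s. Theta (\<gamma> s)"])
    show "flow t differentiable at (Theta p) within unit_bundle"
      using flow_differentiable_on p by (auto simp: differentiable_on_def unit_bundle_eq)
    show "((\<lambda>s. Theta (\<gamma> s)) has_vector_derivative dTheta p (\<delta> 0)) (at 0)"
      by (rule has_vector_derivative_compose[OF _ \<gamma>(3)]) (simp add: \<gamma>(1) Theta_derivative)
    have "((\<lambda>s. orbit (\<gamma> s) t) has_vector_derivative \<delta> t) (at 0)"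
      using has_vector_derivative_compose_within[OF D(1) \<gamma>(3,2)] D(2) by simp
    from has_vector_derivative_compose[OF Theta_derivative this]
    show "((\<lambda>s. flow t (Theta (\<gamma> s))) has_vector_derivative dTheta (orbit p t) (\<delta> t)) (at 0)"
      by (simp add: flow_Theta[OF \<gamma>(2)] \<gamma>(1))
  qed (use \<gamma> in \<open>auto simp: unit_bundle_eq\<close>)
qed

end

section \<open>The Anosov splitting\<close>

text \<open>
  Near \<open>\<theta>0\<close> a frame is obtained from a fixed basis of the orthogonal complement of \<open>v0 = velocity \<theta>0\<close>: where \<open>velocity \<theta> \<bullet> v0 \<noteq> 0\<close>,
  projection along \<open>velocity \<theta>\<close> is an isomorphism of the complement of \<open>v0\<close> onto that of \<open>velocity \<theta>\<close>.
\<close>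
lemma continuous_subbundle_graph:
  fixes velocity :: "'b::euclidean_space \<Rightarrow> 'v::euclidean_space" and L :: "'b \<Rightarrow> 'v \<Rightarrow> 'b"
  assumes velocity: "continuous_on S velocity" "\<And>\<theta>. \<theta> \<in> S \<Longrightarrow> norm (velocity \<theta>) = 1"
    and lin: "\<And>\<theta>. \<theta> \<in> S \<Longrightarrow> linear (L \<theta>)" and inj: "\<And>\<theta> u. \<theta> \<in> S \<Longrightarrow> L \<theta> u = 0 \<Longrightarrow> u = 0"
    and cont: "\<And>u. continuous_on S (\<lambda>\<theta>. L \<theta> (u - (u \<bullet> velocity \<theta>) *\<^sub>R velocity \<theta>))"
    and E: "\<And>\<theta>. \<theta> \<in> S \<Longrightarrow> E \<theta> = L \<theta> ` {u. u \<bullet> velocity \<theta> = 0}"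
  shows "continuous_subbundle S E"
  unfolding continuous_subbundle_def
proof
  fix \<theta>0 assume \<theta>0: "\<theta>0 \<in> S"
  define v0 where "v0 = velocity \<theta>0"
  have v0: "v0 \<bullet> v0 = 1" using velocity(2)[OF \<theta>0] by (simp add: v0_def norm_eq_1)
  have "subspace {u. u \<bullet> v0 = 0}"
    by (simp add: subspace_def inner_add_left)
  then obtain B where B: "finite B" "independent B" "span B = {u. u \<bullet> v0 = 0}"
    by (metis basis_subspace_exists)
  obtain b where b: "bij_betw b {..<card B} B"
    using ex_bij_betw_nat_finite[OF B(1)] by (auto simp: atLeast0LessThan)
  have "continuous_on S (\<lambda>\<theta>. velocity \<theta> \<bullet> v0)" by (intro continuous_intros velocity)
  then obtain d where d: "d > 0" "\<And>\<eta>. \<eta> \<in> S \<Longrightarrow> dist \<eta> \<theta>0 < d \<Longrightarrow> dist (velocity \<eta> \<bullet> v0) (velocity \<theta>0 \<bullet> v0) < 1"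
    using \<theta>0 unfolding continuous_on_iff by (metis zero_less_one)
  define X where "X = (\<lambda>i \<eta>. L \<eta> (b i - (b i \<bullet> velocity \<eta>) *\<^sub>R velocity \<eta>))"
  have "inj_on (\<lambda>i. X i \<eta>) {..<card B} \<and> independent ((\<lambda>i. X i \<eta>) ` {..<card B}) \<and>
      span ((\<lambda>i. X i \<eta>) ` {..<card B}) = E \<eta>" if \<eta>: "\<eta> \<in> S \<inter> ball \<theta>0 d" for \<eta>
  proof -
    have \<eta>S: "\<eta> \<in> S" using \<eta> by simp
    define v where "v = velocity \<eta>"
    have v: "v \<bullet> v = 1" using velocity(2)[OF \<eta>S] by (simp add: v_def norm_eq_1)
    have vv0: "v \<bullet> v0 \<noteq> 0"
      using d(2)[of \<eta>] \<eta> v0 by (auto simp: v_def v0_def dist_commute dist_real_def)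
    define M where "M = (\<lambda>u. L \<eta> (u - (u \<bullet> v) *\<^sub>R v))"
    have linM: "linear M"
    proof -
      have "linear (\<lambda>u. u - (u \<bullet> v) *\<^sub>R v)"
        by (rule linearI) (simp_all add: inner_add_left algebra_simps)
      from linear_compose[OF this lin[OF \<eta>S]] show ?thesis by (simp add: M_def o_def)
    qed
    have injM: "inj_on M (span B)"
    proof (rule inj_onI)
      fix x y assume xy: "x \<in> span B" "y \<in> span B" "M x = M y"
      define u where "u = x - y"
      have "M u = 0" using xy(3) linear_diff[OF linM] by (simp add: u_def)
      then have u: "u = (u \<bullet> v) *\<^sub>R v" using inj[OF \<eta>S] by (fastforce simp: M_def)
      have "u \<bullet> v0 = 0" using xy unfolding B(3) by (simp add: u_def inner_diff_left)
      with u have "(u \<bullet> v) * (v \<bullet> v0) = 0" by (metis inner_scaleR_left)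
      with vv0 u show "x = y" by (simp add: u_def)
    qed
    have "(\<lambda>i. X i \<eta>) ` {..<card B} = M ` (b ` {..<card B})"
      unfolding image_image by (simp add: X_def M_def v_def)
    then have im: "(\<lambda>i. X i \<eta>) ` {..<card B} = M ` B"
      by (simp only: bij_betw_imp_surj_on[OF b])
    have "inj_on (M \<circ> b) {..<card B}"
      using b injM span_superset[of B] by (intro comp_inj_on) (auto simp: bij_betw_def inj_on_subset)
    then have 1: "inj_on (\<lambda>i. X i \<eta>) {..<card B}" by (simp add: o_def X_def M_def v_def)
    have 2: "independent (M ` B)" by (rule linear_independent_injective_image[OF linM B(2) injM])
    have "span (M ` B) = M ` {u. u \<bullet> v0 = 0}" using linear_span_image[OF linM] B(3) by simp
    also have "\<dots> = L \<eta> ` {u. u \<bullet> v = 0}"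
    proof (intro equalityI subsetI)
      fix x assume "x \<in> M ` {u. u \<bullet> v0 = 0}"
      then obtain u where "x = L \<eta> (u - (u \<bullet> v) *\<^sub>R v)" by (auto simp: M_def)
      moreover have "(u - (u \<bullet> v) *\<^sub>R v) \<bullet> v = 0" by (simp add: inner_diff_left v)
      ultimately show "x \<in> L \<eta> ` {u. u \<bullet> v = 0}" by blast
    next
      fix x assume "x \<in> L \<eta> ` {u. u \<bullet> v = 0}"
      then obtain u where u: "x = L \<eta> u" "u \<bullet> v = 0" by blast
      define u' where "u' = u - ((u \<bullet> v0) / (v \<bullet> v0)) *\<^sub>R v"
      have "u' \<bullet> v0 = 0" using vv0 by (simp add: u'_def inner_diff_left)
      moreover have "M u' = x" by (simp add: M_def u'_def inner_diff_left u v)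
      ultimately show "x \<in> M ` {u. u \<bullet> v0 = 0}" by blast
    qed
    also have "\<dots> = E \<eta>" by (simp add: E[OF \<eta>S] v_def)
    finally have 3: "span (M ` B) = E \<eta>" .
    show ?thesis unfolding im using 1 2 3 by blast
  qed
  moreover have "continuous_on (S \<inter> ball \<theta>0 d) (X i)" for i
    unfolding X_def by (rule continuous_on_subset[OF cont]) auto
  ultimately show "\<exists>U k. \<exists>X :: nat \<Rightarrow> 'b \<Rightarrow> 'b. open U \<and> \<theta>0 \<in> U \<and>
      (\<forall>i<k. continuous_on (S \<inter> U) (X i)) \<and>
      (\<forall>\<eta>\<in>S \<inter> U. inj_on (\<lambda>i. X i \<eta>) {..<k} \<and> independent ((\<lambda>i. X i \<eta>) ` {..<k}) \<and>
         span ((\<lambda>i. X i \<eta>) ` {..<k}) = E \<eta>)"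
    using d(1) by (intro exI[of _ "ball \<theta>0 d"] exI[of _ "card B"] exI[of _ X]) auto
qed

definition reverse :: "'a \<times> 'b::group_add \<Rightarrow> 'a \<times> 'b" where
  "reverse z = (fst z, - snd z)"

lemma reverse_reverse [simp]: "reverse (reverse z) = z"
  by (simp add: reverse_def)

lemma reverse_simps [simp]: "fst (reverse z) = fst z" "snd (reverse z) = - snd z"
  by (simp_all add: reverse_def)

lemma bounded_linear_reverse:
  "bounded_linear (reverse :: 'a::real_normed_vector \<times> 'b::real_normed_vector \<Rightarrow> _)"
  unfolding reverse_def[abs_def]
  by (intro bounded_linear_Pair bounded_linear_fst bounded_linear_minus bounded_linear_snd)

context warping
begin

definition velocity :: "'n::finite tangent \<Rightarrow> real \<times> (real ^ 'n)" where
  "velocity \<theta> = (ps \<theta>, exp (g (px \<theta>)) *\<^sub>R angular_velocity (fst \<theta>) (snd \<theta>))"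

text \<open>
  The torus coordinate is set to \<open>0\<close>: the operator \<open>stable_shape\<close> is invariant under translations of the torus, and a
  continuous choice of the angles does not exist globally.
\<close>
definition base_state :: "'n::finite tangent \<Rightarrow> 'n phase" where
  "base_state \<theta> = ((px \<theta>, 0), velocity \<theta>)"

text \<open>
  The tangent vector of the unit tangent bundle with horizontal part \<open>u\<close> and vertical part \<open>\<nu>\<close>. The formula uses only
  the point \<open>\<theta>\<close>, no parameter of it, which makes continuity in \<open>\<theta>\<close> evident.
\<close>
definition tangent_vec :: "'n::finite tangent \<Rightarrow>
    real \<times> (real ^ 'n) \<Rightarrow> real \<times> (real ^ 'n) \<Rightarrow> 'n tangent" where
  "tangent_vec \<theta> u \<nu> = (let x = px \<theta>; z = py \<theta>; w = snd (velocity \<theta>);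
      \<delta> = frame_lift (base_state \<theta>) u \<nu>
    in ((px \<delta>, \<chi> i. of_real (py \<delta> $ i) * (\<i> * z $ i)),
       (ps \<delta>,
        \<chi> i. of_real ((exp (- g x) *\<^sub>R (pw \<delta> - (g1 x * px \<delta>) *\<^sub>R w)) $ i) * (\<i> * z $ i)
          - of_real ((exp (- g x) *\<^sub>R w) $ i * py \<delta> $ i) * z $ i)))"

lemma velocity_Theta: "velocity (Theta p) = snd p"
  using chart_snd[of 0 p] by (simp add: chart_def velocity_def)

lemma base_state_Theta: "base_state (Theta p) = ((px p, 0), snd p)"
  by (simp add: base_state_def velocity_Theta) (simp add: Theta_eq angular_param_def case_prod_unfold)

lemma base_state_unit: "\<theta> \<in> unit_bundle \<Longrightarrow> base_state \<theta> \<in> unit_phase"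
  by (auto simp: unit_bundle_eq base_state_Theta unit_phase_def)

lemma velocity_norm: "\<theta> \<in> unit_bundle \<Longrightarrow> norm (velocity \<theta>) = 1"
  using base_state_unit[of \<theta>] by (simp add: base_state_def unit_phase_def)

lemma tangent_vec_Theta: "tangent_vec (Theta p) u \<nu> = dTheta p (frame_lift p u \<nu>)"
proof -
  have "frame_lift (base_state (Theta p)) u \<nu> = frame_lift p u \<nu>" by (simp add: frame_lift_def base_state_Theta)
  moreover have "px (Theta p) = px p" "py (Theta p) $ i = cis (py p $ i)" for i
    by (simp_all add: Theta_eq angular_param_def case_prod_unfold)
  ultimately show ?thesis
    by (simp add: tangent_vec_def dTheta_def dtparam_def dparam_def velocity_Theta Let_def)
qed

lemma tangent_vec_add: "tangent_vec \<theta> (u + u') (\<nu> + \<nu>') = tangent_vec \<theta> u \<nu> + tangent_vec \<theta> u' \<nu>'"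
  by (simp add: tangent_vec_def Let_def frame_lift_def prod_eq_iff vec_eq_iff algebra_simps inner_add_left)

lemma tangent_vec_scale: "tangent_vec \<theta> (c *\<^sub>R u) (c *\<^sub>R \<nu>) = c *\<^sub>R tangent_vec \<theta> u \<nu>"
  by (simp add: tangent_vec_def Let_def frame_lift_def prod_eq_iff vec_eq_iff algebra_simps
      scaleR_conv_of_real[where 'a = complex])

lemma tangent_vec_linear:
  assumes "linear A"
  shows "linear (\<lambda>u. tangent_vec \<theta> u (A u))" "linear (\<lambda>u. tangent_vec \<theta> u (- A u))"
proof -
  have *: "linear (\<lambda>u. tangent_vec \<theta> u (B u))" if "linear B" for B
    by (rule linearI) (simp_all only: linear_add[OF that] linear_cmul[OF that] tangent_vec_add tangent_vec_scale)
  show "linear (\<lambda>u. tangent_vec \<theta> u (A u))" "linear (\<lambda>u. tangent_vec \<theta> u (- A u))"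
    using *[OF assms] *[OF linear_compose_neg[OF assms]] .
qed

lemma sasaki_tangent_vec:
  assumes "\<theta> \<in> unit_bundle"
  shows "sasaki \<theta> (tangent_vec \<theta> u \<nu>) (tangent_vec \<theta> u \<nu>) = (norm u)\<^sup>2 + (norm \<nu>)\<^sup>2"
  using assms by (auto simp: unit_bundle_eq tangent_vec_Theta sasaki_Theta)

lemma tangent_vec_zero_iff:
  assumes "\<theta> \<in> unit_bundle" "tangent_vec \<theta> u \<nu> = 0"
  shows "u = 0" "\<nu> = 0"
proof -
  have "tangent_vec \<theta> (0 *\<^sub>R 0) (0 *\<^sub>R 0) = 0" unfolding tangent_vec_scale by simp
  then have "(norm u)\<^sup>2 + (norm \<nu>)\<^sup>2 = 0"
    using sasaki_tangent_vec[OF assms(1), of u \<nu>] sasaki_tangent_vec[OF assms(1), of 0 0] assms(2) by simp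
  then show "u = 0" "\<nu> = 0" by (simp_all add: sum_power2_eq_zero_iff)
qed

lemma tangent_space_tangent_vec:
  assumes "\<theta> \<in> unit_bundle"
  shows "tangent_space unit_bundle \<theta> = {tangent_vec \<theta> u \<nu> | u \<nu>. \<nu> \<bullet> velocity \<theta> = 0}"
  using assms by (auto simp: unit_bundle_eq[where 'a = 'a] velocity_Theta tangent_vec_Theta) (auto simp: tangent_space_unit_bundle simp flip: unit_bundle_eq)

lemma stable_shape_translate:
  fixes p p' :: "'n::finite phase"
  assumes p: "p \<in> unit_phase" and eq: "px p' = px p" "snd p' = snd p"
  shows "stable_shape p' = stable_shape p"
proof -
  define c where "c = ((0 :: real, py p' - py p), 0 :: real \<times> (real ^ 'n))"
  have geodesic_field_c: "geodesic_field (a + c) = geodesic_field a" for a by (simp add: geodesic_field_def c_def)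
  have "integral_curve geodesic_field (\<lambda>t. orbit p t + c)"
    using orbit(2)[OF p] unfolding integral_curve_def geodesic_field_c by (auto intro!: derivative_eq_intros)
  moreover have 0: "orbit p 0 + c = p'" using eq by (simp add: orbit(1)[OF p] c_def prod_eq_iff)
  moreover have p': "p' \<in> unit_phase" using p eq by (simp add: unit_phase_def)
  ultimately have "orbit p' = (\<lambda>t. orbit p t + c)" using orbit_unique by metis
  then have "neg_curv_par (orbit p' t) = neg_curv_par (orbit p t)" "neg_curv_perp (orbit p' t) = neg_curv_perp (orbit p t)" for t
    by (simp_all add: neg_curv_par_def neg_curv_perp_def c_def)
  then show ?thesis by (simp add: stable_shape_def plane_normal_def eq slope_par_def slope_perp_def)
qed

lemma stable_shape_base_state: "p \<in> unit_phase \<Longrightarrow> stable_shape (base_state (Theta p)) = stable_shape p"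
  by (rule stable_shape_translate) (simp_all add: base_state_Theta)

lemma stable_shape_linear: "linear (stable_shape p)"
  by (simp add: stable_shape_def aniso_linear)

lemma flow_unit_bundle: "\<theta> \<in> unit_bundle \<Longrightarrow> flow t \<theta> \<in> unit_bundle"
  by (auto simp: unit_bundle_eq flow_Theta orbit(3))

lemma flow_add: "\<theta> \<in> unit_bundle \<Longrightarrow> flow t (flow s \<theta>) = flow (t + s) \<theta>"
  by (auto simp: unit_bundle_eq flow_Theta orbit(3) orbit_add)

lemma flow_0: "\<theta> \<in> unit_bundle \<Longrightarrow> flow 0 \<theta> = \<theta>"
  by (auto simp: unit_bundle_eq flow_Theta orbit(1))

lemma Theta_reverse: "Theta (reverse p) = reverse (Theta p)"
  by (simp add: Theta_eq reverse_def dparam_def vec_eq_iff prod_eq_iff)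

lemma unit_reverse: "p \<in> unit_phase \<Longrightarrow> reverse p \<in> unit_phase"
  by (simp add: unit_phase_def)

lemma unit_bundle_reverse: "\<theta> \<in> unit_bundle \<Longrightarrow> reverse \<theta> \<in> unit_bundle"
  by (auto simp: unit_bundle_eq Theta_reverse[symmetric] unit_reverse)

lemma orbit_reverse:
  fixes p :: "'n::finite phase"
  assumes p: "p \<in> unit_phase"
  shows "orbit (reverse p) t = reverse (orbit p (- t))"
proof -
  have geodesic_field_r: "geodesic_field (reverse a) = - reverse (geodesic_field a)" for a :: "'n phase"
    by (simp add: geodesic_field_def reverse_def prod_eq_iff)
  have "integral_curve geodesic_field (\<lambda>t. reverse (orbit p (- t)))"
    unfolding integral_curve_def geodesic_field_r
  proof
    fix t
    have "((\<lambda>t. orbit p (- t)) has_vector_derivative - geodesic_field (orbit p (- t))) (at t)"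
      using has_vector_derivative_reflect[of "orbit p" "\<lambda>t. geodesic_field (orbit p t)"] orbit(2)[OF p] by (simp add: integral_curve_def)
    from bounded_linear.has_vector_derivative[OF bounded_linear_reverse this]
    show "((\<lambda>t. reverse (orbit p (- t))) has_vector_derivative - reverse (geodesic_field (orbit p (- t)))) (at t)"
      by (simp add: reverse_def prod_eq_iff)
  qed
  from orbit_unique[OF this] p show ?thesis by (simp add: orbit(1) unit_reverse) metis
qed

lemma flow_reverse:
  assumes "\<theta> \<in> unit_bundle"
  shows "flow t \<theta> = reverse (flow (- t) (reverse \<theta>))"
  using assms
  by (auto simp: unit_bundle_eq flow_Theta unit_reverse orbit_reverse simp flip: Theta_reverse)

lemma velocity_reverse: "velocity (reverse \<theta>) = - velocity \<theta>"
  by (simp add: velocity_def angular_velocity_def vec_eq_iff prod_eq_iff algebra_simps)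

lemma tangent_vec_reverse: "tangent_vec (reverse \<theta>) u \<nu> = reverse (tangent_vec \<theta> u (- \<nu>))"
  by (simp add: tangent_vec_def Let_def base_state_def frame_lift_def velocity_reverse prod_eq_iff vec_eq_iff algebra_simps)

definition E_stable :: "'n::finite tangent \<Rightarrow>
    'n tangent set" where
  "E_stable \<theta> = (\<lambda>u. tangent_vec \<theta> u (- stable_shape (base_state \<theta>) u)) ` {u. u \<bullet> velocity \<theta> = 0}"

text \<open>
  The time reversal of the stable bundle, in the form to which \<open>continuous_subbundle_graph\<close> applies.
\<close>
definition E_unstable :: "'n::finite tangent \<Rightarrow>
    'n tangent set" where
  "E_unstable \<theta> = (\<lambda>u. tangent_vec \<theta> u (stable_shape (base_state (reverse \<theta>)) u)) ` {u. u \<bullet> velocity \<theta> = 0}"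

lemma E_unstable_reverse: "E_unstable \<theta> = reverse ` E_stable (reverse \<theta>)"
  unfolding E_unstable_def E_stable_def image_image tangent_vec_reverse by (simp add: velocity_reverse)

lemma stable_shape_orthogonal: "u \<bullet> velocity \<theta> = 0 \<Longrightarrow> stable_shape (base_state \<theta>) u \<bullet> velocity \<theta> = 0"
  unfolding stable_shape_def using plane_normal_orthogonal[of "base_state \<theta>"] by (intro aniso_orthogonal) (simp add: base_state_def)

lemma E_stable_tangent:
  assumes "\<theta> \<in> unit_bundle" shows "E_stable \<theta> \<subseteq> tangent_space unit_bundle \<theta>"
  unfolding tangent_space_tangent_vec[OF assms] E_stable_def using stable_shape_orthogonal[of _ \<theta>] by fastforce

lemma E_stable_flow:
  fixes \<theta> :: "'n::finite tangent"
  assumes \<theta>: "\<theta> \<in> unit_bundle" and \<xi>: "\<xi> \<in> E_stable \<theta>"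
  shows "Dflow t \<theta> \<xi> \<in> E_stable (flow t \<theta>)"
    "t \<ge> 0 \<Longrightarrow> sasaki (flow t \<theta>)
        (Dflow t \<theta> \<xi>) (Dflow t \<theta> \<xi>)
      \<le> (contraction_const * contraction_rate powr t)\<^sup>2 * sasaki \<theta> \<xi> \<xi>"
proof -
  obtain p :: "'n phase" where p: "p \<in> unit_phase" "\<theta> = Theta p" using \<theta> by (auto simp: unit_bundle_eq)
  obtain u where u: "u \<bullet> snd p = 0" "\<xi> = tangent_vec \<theta> u (- stable_shape p u)"
    using \<xi> p(2) by (auto simp: E_stable_def velocity_Theta stable_shape_base_state[OF p(1)])
  obtain U where U: "U 0 = u" "\<And>t. U t \<bullet> snd (orbit p t) = 0"
    "\<And>t. ((\<lambda>t. frame_lift (orbit p t) (U t) (- stable_shape (orbit p t) (U t))) has_vector_derivative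
       d_geodesic_field (orbit p t) (frame_lift (orbit p t) (U t) (- stable_shape (orbit p t) (U t)))) (at t)"
    "\<And>t. t \<ge> 0 \<Longrightarrow> (norm (U t))\<^sup>2 + (norm (stable_shape (orbit p t) (U t)))\<^sup>2
       \<le> (contraction_const * contraction_rate powr t)\<^sup>2 * (norm u)\<^sup>2"
    using stable_jacobi_field[OF p(1) u(1)] by blast
  note o = orbit(3)[OF p(1)]
  have "snd (frame_lift p u (- stable_shape p u)) \<bullet> snd p = 0"
    using u(1) stable_shape_orthogonal[of u \<theta>] by (simp add: frame_lift_tangent p(2) velocity_Theta stable_shape_base_state[OF p(1)])
  then have d: "Dflow t \<theta> \<xi> = tangent_vec (flow t \<theta>) (U t) (- stable_shape (orbit p t) (U t))" for t
    using flow_differential[OF p(1) U(3), of t]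
    by (simp add: orbit(1)[OF p(1)] U(1) u(2) p(2) tangent_vec_Theta flow_Theta[OF p(1)])
  show "Dflow t \<theta> \<xi> \<in> E_stable (flow t \<theta>)"
    unfolding d E_stable_def using U(2)[of t]
    by (auto simp: p(2) flow_Theta[OF p(1)] velocity_Theta stable_shape_base_state[OF o] intro!: imageI)
  assume t: "t \<ge> 0"
  have "sasaki (flow t \<theta>)
      (Dflow t \<theta> \<xi>) (Dflow t \<theta> \<xi>)
      \<le> (contraction_const * contraction_rate powr t)\<^sup>2 * (norm u)\<^sup>2"
    unfolding d sasaki_tangent_vec[OF flow_unit_bundle[OF \<theta>]] using U(4)[OF t] by simp
  also have "\<dots> \<le> (contraction_const * contraction_rate powr t)\<^sup>2 * sasaki \<theta> \<xi> \<xi>"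
    unfolding u(2) sasaki_tangent_vec[OF \<theta>] by (intro mult_left_mono) auto
  finally show "sasaki (flow t \<theta>)
      (Dflow t \<theta> \<xi>) (Dflow t \<theta> \<xi>)
    \<le> (contraction_const * contraction_rate powr t)\<^sup>2 * sasaki \<theta> \<xi> \<xi>" .
qed

lemma flow_differentiable_at: "\<theta> \<in> unit_bundle \<Longrightarrow> flow t differentiable (at \<theta> within unit_bundle)"
  using flow_differentiable_on by (auto simp: differentiable_on_def)

lemma flow_curve:
  assumes c: "\<And>s. c s \<in> unit_bundle" "(c has_vector_derivative \<xi>) (at 0)"
  shows "((\<lambda>s. flow t (c s)) has_vector_derivative Dflow t (c 0) \<xi>) (at 0)"
proof (rule has_vector_derivative_compose_within[OF _ c(2,1)])
  show "(flow t has_derivative Dflow t (c 0)) (at (c 0) within unit_bundle)"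
    using flow_differentiable_at[OF c(1)] unfolding differential_on_def
    by (rule frechet_derivative_works[THEN iffD1])
qed

text \<open>
  Reversal of velocities conjugates the flow to its inverse.
\<close>
lemma differential_reverse:
  assumes \<theta>: "\<theta> \<in> unit_bundle" and \<xi>: "reverse \<xi> \<in> tangent_space unit_bundle (reverse \<theta>)"
  shows "Dflow t \<theta> \<xi> = reverse (Dflow (- t) (reverse \<theta>) (reverse \<xi>))"
proof -
  obtain c where c: "c 0 = reverse \<theta>" "\<And>s. c s \<in> unit_bundle" "(c has_vector_derivative reverse \<xi>) (at 0)"
    using \<xi> by (auto simp: tangent_space_def)
  show ?thesis
  proof (rule differential_on_curve[where c = "\<lambda>s. reverse (c s)", OF flow_differentiable_at[OF \<theta>]])
    show "((\<lambda>s. reverse (c s)) has_vector_derivative \<xi>) (at 0)"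
      using bounded_linear.has_vector_derivative[OF bounded_linear_reverse c(3)] by simp
    have "flow t (reverse (c s)) = reverse (flow (- t) (c s))" for s
      using flow_reverse[OF unit_bundle_reverse[OF c(2)]] by simp
    then show "((\<lambda>s. flow t (reverse (c s))) has_vector_derivative
        reverse (Dflow (- t) (reverse \<theta>) (reverse \<xi>))) (at 0)"
      using bounded_linear.has_vector_derivative[OF bounded_linear_reverse flow_curve[OF c(2,3)]] c(1) by simp
  qed (use c in \<open>auto simp: unit_bundle_reverse\<close>)
qed

lemma sasaki_reverse:
  assumes \<theta>: "\<theta> \<in> unit_bundle" and \<xi>: "\<xi> \<in> tangent_space unit_bundle \<theta>"
  shows "sasaki (reverse \<theta>) (reverse \<xi>) (reverse \<xi>)
    = sasaki \<theta> \<xi> \<xi>"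
proof -
  obtain u \<nu> where "\<xi> = tangent_vec \<theta> u \<nu>" using \<xi> unfolding tangent_space_tangent_vec[OF \<theta>] by blast
  then have "reverse \<xi> = tangent_vec (reverse \<theta>) u (- \<nu>)" "\<xi> = tangent_vec \<theta> u \<nu>" by (simp_all add: tangent_vec_reverse)
  then show ?thesis using sasaki_tangent_vec[OF \<theta>] sasaki_tangent_vec[OF unit_bundle_reverse[OF \<theta>]] by simp
qed

lemma E_unstable_flow:
  assumes \<theta>: "\<theta> \<in> unit_bundle" and \<xi>: "\<xi> \<in> E_unstable \<theta>"
  shows "Dflow t \<theta> \<xi> \<in> E_unstable (flow t \<theta>)"
    "t \<ge> 0 \<Longrightarrow> sasaki (flow (- t) \<theta>)
        (Dflow (- t) \<theta> \<xi>) (Dflow (- t) \<theta> \<xi>)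
      \<le> (contraction_const * contraction_rate powr t)\<^sup>2 * sasaki \<theta> \<xi> \<xi>"
proof -
  note r\<theta> = unit_bundle_reverse[OF \<theta>]
  have r\<xi>: "reverse \<xi> \<in> E_stable (reverse \<theta>)" using \<xi> by (auto simp: E_unstable_reverse)
  then have tan: "reverse \<xi> \<in> tangent_space unit_bundle (reverse \<theta>)" using E_stable_tangent[OF r\<theta>] by blast
  have fr: "reverse (flow t \<theta>) = flow (- t) (reverse \<theta>)" for t
    using flow_reverse[OF \<theta>, of t] by simp
  show "Dflow t \<theta> \<xi> \<in> E_unstable (flow t \<theta>)"
    unfolding differential_reverse[OF \<theta> tan] E_unstable_reverse fr
    by (intro imageI E_stable_flow(1)[OF r\<theta> r\<xi>])
  assume t: "t \<ge> 0"
  let ?d = "Dflow t (reverse \<theta>) (reverse \<xi>)"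
  have "?d \<in> tangent_space unit_bundle (flow t (reverse \<theta>))"
    using E_stable_flow(1)[OF r\<theta> r\<xi>] E_stable_tangent[OF flow_unit_bundle[OF r\<theta>]] by blast
  then have "sasaki (reverse (flow t (reverse \<theta>))) (reverse ?d) (reverse ?d)
      = sasaki (flow t (reverse \<theta>)) ?d ?d"
    by (rule sasaki_reverse[OF flow_unit_bundle[OF r\<theta>]])
  also have "\<dots> \<le> (contraction_const * contraction_rate powr t)\<^sup>2 * sasaki (reverse \<theta>) (reverse \<xi>) (reverse \<xi>)"
    by (rule E_stable_flow(2)[OF r\<theta> r\<xi> t])
  also have "sasaki (reverse \<theta>) (reverse \<xi>) (reverse \<xi>) = sasaki \<theta> \<xi> \<xi>"
    using sasaki_reverse[OF r\<theta> tan] by simp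
  finally show "sasaki (flow (- t) \<theta>)
        (Dflow (- t) \<theta> \<xi>) (Dflow (- t) \<theta> \<xi>)
      \<le> (contraction_const * contraction_rate powr t)\<^sup>2 * sasaki \<theta> \<xi> \<xi>"
    using flow_reverse[OF \<theta>, of "- t"] differential_reverse[OF \<theta> tan, of "- t"] by simp
qed

lemma E_unstable_tangent:
  assumes "\<theta> \<in> unit_bundle" shows "E_unstable \<theta> \<subseteq> tangent_space unit_bundle \<theta>"
  unfolding tangent_space_tangent_vec[OF assms] E_unstable_def
  using stable_shape_orthogonal[of _ "reverse \<theta>"] by (fastforce simp: velocity_reverse)

text \<open>
  Invariance of a subbundle in both time directions upgrades inclusion to equality, by the chain rule for
  the flow composed with its inverse.
\<close>
lemma invariant_image:
  assumes sub: "\<And>\<theta>. \<theta> \<in> unit_bundle \<Longrightarrow> E \<theta> \<subseteq> tangent_space unit_bundle \<theta>"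
    and inv: "\<And>\<theta> \<xi> t. \<theta> \<in> unit_bundle \<Longrightarrow> \<xi> \<in> E \<theta> \<Longrightarrow> Dflow t \<theta> \<xi> \<in> E (flow t \<theta>)"
    and \<theta>: "\<theta> \<in> unit_bundle"
  shows "Dflow t \<theta> ` E \<theta> = E (flow t \<theta>)"
proof (intro equalityI subsetI)
  fix \<xi> assume \<xi>: "\<xi> \<in> E (flow t \<theta>)"
  define \<eta> where "\<eta> = Dflow (- t) (flow t \<theta>) \<xi>"
  have ret: "flow (- t) (flow t \<theta>) = \<theta>" using flow_add[OF \<theta>, of "- t" t] flow_0[OF \<theta>] by simp
  have \<eta>: "\<eta> \<in> E \<theta>" using inv[OF flow_unit_bundle[OF \<theta>] \<xi>, of "- t"] by (simp add: \<eta>_def ret)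
  obtain c where c: "c 0 = flow t \<theta>" "\<And>s. c s \<in> unit_bundle" "(c has_vector_derivative \<xi>) (at 0)"
    using \<xi> sub[OF flow_unit_bundle[OF \<theta>]] by (force simp: tangent_space_def)
  have "Dflow t \<theta> \<eta> = \<xi>"
  proof (rule differential_on_curve[where c = "\<lambda>s. flow (- t) (c s)", OF flow_differentiable_at[OF \<theta>]])
    show "((\<lambda>s. flow (- t) (c s)) has_vector_derivative \<eta>) (at 0)"
      using flow_curve[OF c(2,3), of "- t"] by (simp add: \<eta>_def c(1))
    have "flow t (flow (- t) (c s)) = c s" for s
      using flow_add[OF c(2), of t "- t"] flow_0[OF c(2)] by simp
    then show "((\<lambda>s. flow t (flow (- t) (c s))) has_vector_derivative \<xi>) (at 0)"
      using c(3) by simp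
  qed (use c ret in \<open>auto simp: flow_unit_bundle\<close>)
  with \<eta> show "\<xi> \<in> Dflow t \<theta> ` E \<theta>" by blast
qed (use inv[OF \<theta>] in blast)

lemma generator: "\<theta> \<in> unit_bundle \<Longrightarrow> vector_derivative (\<lambda>t. flow t \<theta>) (at 0) = tangent_vec \<theta> (velocity \<theta>) 0"
proof -
  assume "\<theta> \<in> unit_bundle"
  then obtain p where p: "p \<in> unit_phase" "\<theta> = Theta p" by (auto simp: unit_bundle_eq)
  have "((\<lambda>t. Theta (orbit p t)) has_vector_derivative dTheta (orbit p 0) (geodesic_field (orbit p 0))) (at 0)"
    by (rule Theta_curve[OF orbit(2)[OF p(1)]])
  then have "vector_derivative (\<lambda>t. Theta (orbit p t)) (at 0) = dTheta p (geodesic_field p)"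
    by (simp add: vector_derivative_at orbit(1)[OF p(1)])
  then show ?thesis
    by (simp add: p(2) flow_Theta[OF p(1)] velocity_Theta tangent_vec_Theta geodesic_field_frame_lift)
qed

text \<open>
  After removing the component along the velocity, the splitting of a vector \<open>(u, \<nu>)\<close> amounts to solving
  \<open>(S + S') us = S' u - \<nu>\<close> for the two operators \<open>S\<close>, \<open>S'\<close> of the stable and the unstable bundle. Both are diagonal in the
  same decomposition, with positive eigenvalues.
\<close>
lemma splitting:
  assumes \<theta>: "\<theta> \<in> unit_bundle"
  shows "direct_sum3 (tangent_space unit_bundle \<theta>) (E_stable \<theta>) (span {tangent_vec \<theta> (velocity \<theta>) 0}) (E_unstable \<theta>)"
proof -
  define v n where "v = velocity \<theta>" and "n = plane_normal (base_state \<theta>)"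
  define a b a' b' where "a = slope_par (base_state \<theta>)" and "b = slope_perp (base_state \<theta>)"
    and "a' = slope_par (base_state (reverse \<theta>))" and "b' = slope_perp (base_state (reverse \<theta>))"
  have pos: "a > 0" "b > 0" "a' > 0" "b' > 0"
    using slope_pos base_state_unit[OF \<theta>] base_state_unit[OF unit_bundle_reverse[OF \<theta>]] by (simp_all add: a_def b_def a'_def b'_def)
  have n_rev: "plane_normal (base_state (reverse \<theta>)) = n"
    by (simp add: n_def plane_normal_def base_state_def velocity_reverse sgn_minus)
  have S: "stable_shape (base_state \<theta>) = aniso n a b" and S': "stable_shape (base_state (reverse \<theta>)) = aniso n a' b'"
    by (simp_all add: stable_shape_def n_rev a_def b_def a'_def b'_def flip: n_def)
  have nn: "n \<bullet> n = 1 \<or> n = 0" unfolding n_def by (rule plane_normal_unit[OF base_state_unit[OF \<theta>]])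
  have nv: "n \<bullet> v = 0" using plane_normal_orthogonal[of "base_state \<theta>"] by (simp add: n_def v_def base_state_def)
  have vv: "v \<bullet> v = 1" using velocity_norm[OF \<theta>] by (simp add: v_def norm_eq_1)
  have perp: "subspace {u. u \<bullet> v = 0}" by (simp add: subspace_def inner_add_left)
  have E_stable: "E_stable \<theta> = (\<lambda>u. tangent_vec \<theta> u (- aniso n a b u)) ` {u. u \<bullet> v = 0}"
    and E_unstable: "E_unstable \<theta> = (\<lambda>u. tangent_vec \<theta> u (aniso n a' b' u)) ` {u. u \<bullet> v = 0}"
    by (simp_all add: E_stable_def E_unstable_def S S' v_def)
  have lin: "linear (\<lambda>u. tangent_vec \<theta> u (- aniso n a b u))" "linear (\<lambda>u. tangent_vec \<theta> u (aniso n a' b' u))"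
    by (intro tangent_vec_linear aniso_linear)+
  have sub: "subspace (E_stable \<theta>)" "subspace (E_unstable \<theta>)"
    unfolding E_stable E_unstable by (intro linear_subspace_image lin perp)+
  have sp: "span {tangent_vec \<theta> v 0} = {tangent_vec \<theta> (r *\<^sub>R v) 0 | r. True}"
    using tangent_vec_scale[of \<theta> _ v 0] by (auto simp: span_singleton)
  show ?thesis
    unfolding direct_sum3_def v_def[symmetric]
  proof (intro conjI sub subspace_span ballI impI)
    show "tangent_space unit_bundle \<theta> = {x + y + z | x y z. x \<in> E_stable \<theta> \<and> y \<in> span {tangent_vec \<theta> v 0} \<and> z \<in> E_unstable \<theta>}"
    proof (intro equalityI subsetI)
      fix \<xi> assume "\<xi> \<in> tangent_space unit_bundle \<theta>"
      then obtain u \<nu> where \<xi>: "\<xi> = tangent_vec \<theta> u \<nu>" and \<nu>: "\<nu> \<bullet> v = 0"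
        unfolding tangent_space_tangent_vec[OF \<theta>] v_def by blast
      define r where "r = u \<bullet> v"
      define u0 where "u0 = u - r *\<^sub>R v"
      have u0: "u0 \<bullet> v = 0" by (simp add: u0_def r_def inner_diff_left vv)
      define y where "y = aniso n a' b' u0 - \<nu>"
      have y: "y \<bullet> v = 0" unfolding y_def inner_diff_left \<nu> aniso_orthogonal[OF nv u0] by simp
      \<comment> \<open>The inverse of the sum of the two operators, applied to the right hand side.\<close>
      define us where "us = aniso n (1 / (a + a')) (1 / (b + b')) y"
      have us: "us \<bullet> v = 0" unfolding us_def by (rule aniso_orthogonal[OF nv y])
      have one: "a * (1 / (a + a')) + a' * (1 / (a + a')) = 1" "b * (1 / (b + b')) + b' * (1 / (b + b')) = 1"
        using pos unfolding distrib_right[symmetric] by auto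
      have "aniso n a b us + aniso n a' b' us = aniso n 1 1 y"
        unfolding aniso_add us_def aniso_compose[OF nn] one ..
      then have eq: "aniso n a b us + aniso n a' b' us = aniso n a' b' u0 - \<nu>"
        by (simp add: aniso_1 y_def)
      have "\<xi> = tangent_vec \<theta> (us + r *\<^sub>R v + (u0 - us)) (- aniso n a b us + 0 + aniso n a' b' (u0 - us))"
      proof -
        have "- aniso n a b us + 0 + aniso n a' b' (u0 - us) = aniso n a' b' u0 - (aniso n a b us + aniso n a' b' us)"
          unfolding linear_diff[OF aniso_linear] by simp
        also have "\<dots> = \<nu>" unfolding eq by simp
        finally show ?thesis by (simp add: \<xi> u0_def)
      qed
      also have "\<dots> = tangent_vec \<theta> us (- aniso n a b us) + tangent_vec \<theta> (r *\<^sub>R v) 0 + tangent_vec \<theta> (u0 - us) (aniso n a' b' (u0 - us))"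
        by (simp only: tangent_vec_add)
      finally have "\<xi> = \<dots>" .
      moreover have "tangent_vec \<theta> us (- aniso n a b us) \<in> E_stable \<theta>" unfolding E_stable using us by blast
      moreover have "tangent_vec \<theta> (u0 - us) (aniso n a' b' (u0 - us)) \<in> E_unstable \<theta>"
        unfolding E_unstable using us u0 by (intro imageI) (simp add: inner_diff_left)
      moreover have "tangent_vec \<theta> (r *\<^sub>R v) 0 \<in> span {tangent_vec \<theta> v 0}" unfolding sp by blast
      ultimately show "\<xi> \<in> {x + y + z | x y z. x \<in> E_stable \<theta> \<and> y \<in> span {tangent_vec \<theta> v 0} \<and> z \<in> E_unstable \<theta>}" by blast
    next
      fix \<xi> assume "\<xi> \<in> {x + y + z | x y z. x \<in> E_stable \<theta> \<and> y \<in> span {tangent_vec \<theta> v 0} \<and> z \<in> E_unstable \<theta>}"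
      then obtain us r uu where \<xi>: "\<xi> = tangent_vec \<theta> us (- aniso n a b us) + tangent_vec \<theta> (r *\<^sub>R v) 0 + tangent_vec \<theta> uu (aniso n a' b' uu)"
        and o: "us \<bullet> v = 0" "uu \<bullet> v = 0"
        unfolding E_stable E_unstable sp by blast
      have "\<xi> = tangent_vec \<theta> (us + r *\<^sub>R v + uu) (- aniso n a b us + 0 + aniso n a' b' uu)"
        unfolding \<xi> by (simp only: tangent_vec_add)
      moreover have "(- aniso n a b us + 0 + aniso n a' b' uu) \<bullet> v = 0"
        using aniso_orthogonal[OF nv o(1)] aniso_orthogonal[OF nv o(2)] by (simp add: inner_diff_left inner_add_left)
      ultimately show "\<xi> \<in> tangent_space unit_bundle \<theta>" unfolding tangent_space_tangent_vec[OF \<theta>] v_def by blast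
    qed
  next
    fix x y z assume xyz: "x \<in> E_stable \<theta>" "y \<in> span {tangent_vec \<theta> v 0}" "z \<in> E_unstable \<theta>" "x + y + z = 0"
    obtain us r uu where x: "x = tangent_vec \<theta> us (- aniso n a b us)" and y: "y = tangent_vec \<theta> (r *\<^sub>R v) 0"
      and z: "z = tangent_vec \<theta> uu (aniso n a' b' uu)" and o: "us \<bullet> v = 0" "uu \<bullet> v = 0"
      using xyz unfolding E_stable E_unstable sp by blast
    have "tangent_vec \<theta> (us + r *\<^sub>R v + uu) (- aniso n a b us + 0 + aniso n a' b' uu) = 0"
      using xyz(4) unfolding x y z by (simp only: tangent_vec_add)
    from tangent_vec_zero_iff[OF \<theta> this]
    have 1: "us + r *\<^sub>R v + uu = 0" and 2: "aniso n a' b' uu = aniso n a b us" by simp_all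
    have "(us + r *\<^sub>R v + uu) \<bullet> v = r" by (simp add: inner_add_left o vv)
    then have r: "r = 0" using 1 by simp
    then have uu: "uu = - us" using 1 by (simp add: add_eq_0_iff)
    have "aniso n (a + a') (b + b') us = 0"
    proof -
      have "aniso n a b us = - aniso n a' b' us"
        using 2 unfolding uu linear_neg[OF aniso_linear] by simp
      then show ?thesis by (simp flip: aniso_add)
    qed
    then have us: "us = 0" using aniso_inj[OF nn] pos by (metis add_pos_pos)
    have 0: "tangent_vec \<theta> 0 0 = 0" using tangent_vec_scale[of \<theta> 0 0 0] by simp
    have an0: "aniso n a b 0 = 0" "aniso n a' b' 0 = 0" using linear_0[OF aniso_linear] by blast+
    show "x = 0" "y = 0" "z = 0" unfolding x y z uu us r using 0 an0 by simp_all
  qed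
qed

lemma tangent_vec_continuous:
  assumes "continuous_on S a" "continuous_on S b"
  shows "continuous_on S (\<lambda>\<theta>. tangent_vec \<theta> (a \<theta>) (b \<theta>))"
  unfolding tangent_vec_def Let_def frame_lift_def base_state_def velocity_def angular_velocity_def
  by (intro continuous_intros continuous_on_vec_lambda assms continuous_on_compose2[OF g_cont[of UNIV]]
      continuous_on_compose2[OF g1_cont[of UNIV]]) auto

lemma velocity_continuous: "continuous_on S velocity"
  unfolding velocity_def[abs_def] angular_velocity_def
  by (intro continuous_intros continuous_on_vec_lambda continuous_on_compose2[OF g_cont[of UNIV]]) auto

lemma base_state_continuous: "continuous_on S base_state"
  unfolding base_state_def[abs_def] by (intro continuous_intros velocity_continuous)

lemma E_stable_continuous: "continuous_subbundle unit_bundle E_stable"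
proof (rule continuous_subbundle_graph[OF velocity_continuous velocity_norm, where L = "\<lambda>\<theta> u. tangent_vec \<theta> u (- stable_shape (base_state \<theta>) u)"])
  show "linear (\<lambda>u. tangent_vec \<theta> u (- stable_shape (base_state \<theta>) u))" for \<theta>
    by (intro tangent_vec_linear stable_shape_linear)
  show "continuous_on unit_bundle (\<lambda>\<theta>. tangent_vec \<theta> (u - (u \<bullet> velocity \<theta>) *\<^sub>R velocity \<theta>) (- stable_shape (base_state \<theta>) (u - (u \<bullet> velocity \<theta>) *\<^sub>R velocity \<theta>)))" for u
    by (intro tangent_vec_continuous continuous_intros stable_shape_continuous velocity_continuous base_state_continuous base_state_unit)
qed (auto simp: E_stable_def dest: tangent_vec_zero_iff)

lemma reverse_continuous: "continuous_on S (reverse :: 'a::real_normed_vector \<times> 'b::real_normed_vector \<Rightarrow> _)"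
  by (rule linear_continuous_on[OF bounded_linear_reverse])

lemma E_unstable_continuous: "continuous_subbundle unit_bundle E_unstable"
proof (rule continuous_subbundle_graph[OF velocity_continuous velocity_norm, where L = "\<lambda>\<theta> u. tangent_vec \<theta> u (stable_shape (base_state (reverse \<theta>)) u)"])
  show "linear (\<lambda>u. tangent_vec \<theta> u (stable_shape (base_state (reverse \<theta>)) u))" for \<theta>
    by (intro tangent_vec_linear stable_shape_linear)
  show "continuous_on unit_bundle (\<lambda>\<theta>. tangent_vec \<theta> (u - (u \<bullet> velocity \<theta>) *\<^sub>R velocity \<theta>) (stable_shape (base_state (reverse \<theta>)) (u - (u \<bullet> velocity \<theta>) *\<^sub>R velocity \<theta>)))" for u
    by (intro tangent_vec_continuous continuous_intros stable_shape_continuous velocity_continuous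
        continuous_on_compose2[OF base_state_continuous reverse_continuous] base_state_unit unit_bundle_reverse) auto
qed (auto simp: E_unstable_def dest: tangent_vec_zero_iff)

lemma contraction_rate_bounds: "0 < contraction_rate" "contraction_rate < 1" "contraction_const > 0"
proof -
  have "c0\<^sup>2 / (1 + neg_curv_max) > 0" using c0 neg_curv_max_nonneg by (intro divide_pos_pos) auto
  then show "0 < contraction_rate" "contraction_rate < 1" by (simp_all add: contraction_rate_def)
  have "1 + (1 + neg_curv_max)\<^sup>2 > 0" by (intro add_pos_nonneg) auto
  then show "contraction_const > 0" by (simp add: contraction_const_def decay_const_def)
qed

lemma sqrt_estimate:
  assumes "A \<le> (contraction_const * contraction_rate powr t)\<^sup>2 * B"
  shows "sqrt A \<le> contraction_const * contraction_rate powr t * sqrt B"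
proof -
  have "sqrt A \<le> sqrt ((contraction_const * contraction_rate powr t)\<^sup>2 * B)" using assms by simp
  also have "\<dots> = contraction_const * contraction_rate powr t * sqrt B"
    using contraction_rate_bounds by (simp add: real_sqrt_mult)
  finally show ?thesis .
qed

lemma geodesic_flow_anosov_warped: "geodesic_flow_anosov (UNIV \<times> torus) angular_param (warp_metric :: (real \<times> (complex ^ 'n::finite)) metric)"
  unfolding geodesic_flow_anosov_def unit_bundle_def[symmetric] flow_def[symmetric] anosov_flow_def
proof (rule conjI[OF complete conjI], rule allI, rule flow_differentiable_on,
    rule exI[of _ E_stable], rule exI[of _ E_unstable], rule exI[of _ contraction_const], rule exI[of _ contraction_rate],
    intro conjI E_stable_continuous E_unstable_continuous contraction_rate_bounds ballI)
  fix \<theta> :: "'n::finite tangent" assume \<theta>: "\<theta> \<in> unit_bundle"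
  show "direct_sum3 (tangent_space unit_bundle \<theta>) (E_stable \<theta>) (span {vector_derivative (\<lambda>t. flow t \<theta>) (at 0)}) (E_unstable \<theta>)"
    unfolding generator[OF \<theta>] by (rule splitting[OF \<theta>])
  show "\<forall>t. Dflow t \<theta> ` E_stable \<theta> = E_stable (flow t \<theta>)"
    using invariant_image[OF E_stable_tangent E_stable_flow(1) \<theta>] by blast
  show "\<forall>t. Dflow t \<theta> ` E_unstable \<theta> = E_unstable (flow t \<theta>)"
    using invariant_image[OF E_unstable_tangent E_unstable_flow(1) \<theta>] by blast
qed (auto intro!: sqrt_estimate E_stable_flow(2) E_unstable_flow(2))

lemma nonpositive_curvature_warped: "nonpositive_sectional_curvature M angular_param (warp_metric :: (real \<times> (complex ^ 'n::finite)) metric)"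
  unfolding nonpositive_sectional_curvature_def sectional_curvature_def Let_def coord_metric_def[symmetric]
  using sectional_curvature_nonpos by blast

end

lemma periodic_int:
  fixes h :: "real \<Rightarrow> real"
  assumes "\<And>x. h (x + T) = h x"
  shows "h (x + of_int k * T) = h x"
proof -
  have nat: "h (x + real n * T) = h x" for x n
  proof (induction n)
    case (Suc n)
    have "h (x + real (Suc n) * T) = h ((x + real n * T) + T)" by (simp add: algebra_simps)
    then show ?case using Suc assms by simp
  qed simp
  show ?thesis
  proof (cases "k \<ge> 0")
    case True
    then show ?thesis using nat[of x "nat k"] by simp
  next
    case False
    then show ?thesis using nat[of "x + of_int k * T" "nat (- k)"] by simp
  qed
qed

lemma periodic_bounded:
  fixes h :: "real \<Rightarrow> real"
  assumes h: "continuous_on UNIV h" and T: "T > 0" and per: "\<And>x. h (x + T) = h x"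
  obtains H where "\<And>x. h x \<le> H"
proof -
  have "compact (h ` {0..T})"
    by (intro compact_continuous_image continuous_on_subset[OF h]) auto
  then obtain H where H: "\<And>x. x \<in> {0..T} \<Longrightarrow> norm (h x) \<le> H"
    using compact_imp_bounded bounded_iff by (metis imageI)
  have "h x \<le> H" for x
  proof -
    define k where "k = \<lfloor>x / T\<rfloor>"
    have "of_int k \<le> x / T" "x / T < of_int k + 1" unfolding k_def by linarith+
    then have "x + of_int (- k) * T \<in> {0..T}" using T by (auto simp: field_simps)
    then have "norm (h (x + of_int (- k) * T)) \<le> H" by (rule H)
    then show ?thesis using periodic_int[of h T x "- k", OF per] by simp
  qed
  then show ?thesis using that by blast
qed

theorem mainTheorem3:
  fixes f g h :: "real \<Rightarrow> real" and T C1 C2 :: real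
    and P :: "(real \<times> (complex ^ 'n)) set" and m :: "(real \<times> (complex ^ 'n)) metric"
  assumes "smooth_real g"
    and f_eq: "\<And>x. f x = exp (g x)"
    and h_eq: "\<And>x. h x = deriv (deriv g) x + (deriv g x)\<^sup>2"
    and A: "\<And>x. h x \<ge> 0"
    and B: "T > 0" "\<And>x. h (x + T) = h x"
    and C: "C1 > 0" "C2 > 0" "\<And>x. C1 / 2 < deriv g x \<and> deriv g x < C2 / 2"
    and P_eq: "P = UNIV \<times> torus"
    and m_eq: "m = warped_metric flat_metric f flat_metric"
  shows "nonpositive_sectional_curvature P angular_param m \<and>
         geodesic_flow_anosov P angular_param m"
proof -
  have smooth: "((deriv ^^ k) g has_real_derivative (deriv ^^ Suc k) g x) (at x)" for k x
    using assms(1) by (simp add: smooth_real_def DERIV_deriv_iff_field_differentiable)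
  have d: "(g has_real_derivative deriv g x) (at x)" "(deriv g has_real_derivative deriv (deriv g) x) (at x)" for x
    using smooth[of 0 x] smooth[of 1 x] by simp_all
  have cont: "continuous_on UNIV (deriv (deriv g))" "continuous_on UNIV (deriv g)"
    using DERIV_isCont[OF smooth[of 2]] DERIV_isCont[OF d(2)]
    by (auto simp: numeral_2_eq_2 intro!: continuous_at_imp_continuous_on)
  have "continuous_on UNIV h"
    unfolding h_eq[abs_def] by (intro continuous_intros cont)
  then obtain H where H: "\<And>x. h x \<le> H" using periodic_bounded B by metis
  have C': "C1 / 2 \<le> deriv g x" "deriv g x \<le> C2 / 2" for x
    using C(3)[of x] by auto
  interpret warping g "deriv g" "deriv (deriv g)" H "C1 / 2" "C2 / 2"
    by unfold_locales (use d cont A H C(1) C' h_eq in auto)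
  have "f = (\<lambda>x. exp (g x))" using f_eq by blast
  then have "m = warp_metric" by (simp add: m_eq warp_metric_def)
  then show ?thesis unfolding P_eq using nonpositive_curvature_warped geodesic_flow_anosov_warped by blast
qed

end
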